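(* Let $\psi$ be a function on $\mathbb{R}^{2n}$ and let $\sigma$ be the associated function on $\mathbb{C}^n$, related to $\psi$ by $$\psi(u,v)=(\mathcal{F}_1^{-1}\sigma)\big(\tfrac12(u+v),\,u-v\big),\qquad \sigma(x+iy)=(2\pi)^{-n/2}\int_{\mathbb{R}^n}e^{-ix\cdot\xi}\,\psi(\xi+\tfrac12y,\xi-\tfrac12y)\,d\xi,$$ where $\sigma\in L^1(\mathbb{C}^n)$. Then the operator $$S_KF(z)=\int_{\mathbb{C}^n}F(w)\,B\psi(\bar w,z)\,d\nu(w),\qquad F\in\mathcal{F}(\mathbb{C}^n),$$ corresponds to the pseudo-differential operator $W(\sigma)$ on $L^2(\mathbb{R}^n)$, i.e. $S_K=C_n\,B\circ W(\sigma)\circ B^*$ for a constant $C_n>0$ depending only on $n$. Consequently, for every $s\ge0$, $S_K$ is bounded on $\mathcal{F}^{s,2}(\mathbb{C}^n)$ if and only if $W(\sigma)$ is bounded on the Hermite-Sobolev space $W_H^{s,2}(\mathbb{R}^n)$.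
   Context: For $z,w\in\mathbb{C}^n$ write $z\cdot w=\sum_jz_jw_j$, $z^2=z\cdot z$. Let $d\nu(z)=c_ne^{-\frac12|z|^2}dz$ on $\mathbb{C}^n$ with $c_n=(2\pi)^{-n}$, so that $e^{\frac12z\cdot\bar w}$ is the reproducing kernel of the Fock space $\mathcal{F}(\mathbb{C}^n)$ (the Hilbert space of entire functions square integrable with respect to $\nu$). The Bargmann transform on $\mathbb{R}^d$ ($d=n$ or $d=2n$) is $Bf(z)=\pi^{-d/4}e^{-\frac14z^2}\int_{\mathbb{R}^d}f(u)e^{-\frac12|u|^2}e^{u\cdot z}du$, $z\in\mathbb{C}^d$; for $d=n$ it is unitary from $L^2(\mathbb{R}^n)$ onto $\mathcal{F}(\mathbb{C}^n)$ with inverse $B^*$. For a function $\psi$ on $\mathbb{R}^{2n}=\mathbb{R}^n\times\mathbb{R}^n$, $B\psi(z,w)$, $z,w\in\mathbb{C}^n$, is its Bargmann transform on $\mathbb{R}^{2n}$, with $z$ corresponding to the first variable of $\psi$ and $w$ to the second. For $z=x+iy\in\mathbb{C}^n$, $\pi(z)f(\xi)=e^{i(x\cdot\xi+\frac12x\cdot y)}f(\xi+y)$ on $L^2(\mathbb{R}^n)$. For $\sigma\in L^1(\mathbb{C}^n)$ the Weyl transform is $W(\sigma)f(\xi)=\int_{\mathbb{C}^n}\sigma(z)\,\pi(z)f(\xi)\,dz$. One writes $\sigma(x,y)=\sigma(x+iy)$, and $\mathcal{F}_1^{-1}\sigma(\xi,y)=(2\pi)^{-n/2}\int_{\mathbb{R}^n}e^{ix\cdot\xi}\sigma(x,y)\,dx$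 is the inverse Fourier transform in the first set of variables. Let $H=-\Delta+|x|^2$ on $\mathbb{R}^n$, with powers defined spectrally. $W_H^{s,2}(\mathbb{R}^n)=\{f\in L^2(\mathbb{R}^n):H^{s/2}f\in L^2(\mathbb{R}^n)\}$ with norm $\|H^{s/2}f\|_2$, and $\mathcal{F}^{s,2}(\mathbb{C}^n)$ is its image under $B$ with norm $\|F\|=\|H^{s/2}B^*F\|_2$. An operator is bounded on such a space if it maps the space boundedly into itself. *)

theory Defs
  imports "HOL-Analysis.Analysis"
begin

text \<open>The dimension n is \<open>CARD('n)\<close>. All integrals are taken with respect to the completed
  Lebesgue measure; on \<open>complex^'n\<close>, whose euclidean structure is that of R^(2n), this is the
  measure written dz. Functions stand for their classes modulo null sets, so that relations
  between L^p functions are imposed almost everywhere.\<close>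

section \<open>Vectors\<close>

text \<open>The bilinear product, without conjugation.\<close>
definition cdot :: "complex^'n \<Rightarrow> complex^'n \<Rightarrow> complex" where
  "cdot z w = (\<Sum>j\<in>UNIV. z $ j * w $ j)"

definition cvec :: "real^'n \<Rightarrow> real^'n \<Rightarrow> complex^'n" where
  "cvec x y = (\<chi> j. Complex (x $ j) (y $ j))"

definition Re_vec :: "complex^'n \<Rightarrow> real^'n" where
  "Re_vec z = (\<chi> j. Re (z $ j))"

definition Im_vec :: "complex^'n \<Rightarrow> real^'n" where
  "Im_vec z = (\<chi> j. Im (z $ j))"

definition cnj_vec :: "complex^'n \<Rightarrow> complex^'n" where
  "cnj_vec z = (\<chi> j. cnj (z $ j))"

definition of_real_vec :: "real^'n \<Rightarrow> complex^'n" where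
  "of_real_vec x = (\<chi> j. of_real (x $ j))"

section \<open>Square integrable functions\<close>

definition L2 :: "(real^'n \<Rightarrow> complex) set" where
  "L2 = {f. f \<in> borel_measurable lebesgue \<and> integrable lebesgue (\<lambda>x. (norm (f x))\<^sup>2)}"

definition l2_inner :: "(real^'n \<Rightarrow> complex) \<Rightarrow> (real^'n \<Rightarrow> complex) \<Rightarrow> complex" where
  "l2_inner f g = (LINT x|lebesgue. f x * cnj (g x))"

definition l2_norm :: "(real^'n \<Rightarrow> complex) \<Rightarrow> real" where
  "l2_norm f = sqrt (LINT x|lebesgue. (norm (f x))\<^sup>2)"

section \<open>Fock space and Bargmann transform\<close>

definition fock_measure :: "(complex^'n) measure" where
  "fock_measure = density lebesgue
     (\<lambda>z. ennreal ((2 * pi) powr (- real CARD('n)) * exp (- (norm z)\<^sup>2 / 2)))"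

text \<open>Entire functions of several variables: everywhere complex (Frechet) differentiable.\<close>
definition entire :: "(complex^'n \<Rightarrow> complex) \<Rightarrow> bool" where
  "entire F \<longleftrightarrow> (\<forall>z. \<exists>D. (F has_derivative D) (at z) \<and> (\<forall>c h. D (c *s h) = c * D h))"

definition fock :: "(complex^'n \<Rightarrow> complex) set" where
  "fock = {F. entire F \<and> integrable fock_measure (\<lambda>z. (norm (F z))\<^sup>2)}"

definition bargmann :: "(real^'n \<Rightarrow> complex) \<Rightarrow> complex^'n \<Rightarrow> complex" where
  "bargmann f z = of_real (pi powr (- real CARD('n) / 4)) * exp (- cdot z z / 4) *
     (LINT u|lebesgue. f u * of_real (exp (- (norm u)\<^sup>2 / 2)) * exp (cdot (of_real_vec u) z))"

text \<open>The same transform on R^d for d = 2n, with R^(2n) and C^(2n) written as products.\<close>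
definition bargmann2 ::
  "((real^'n) \<times> (real^'n) \<Rightarrow> complex) \<Rightarrow> complex^'n \<Rightarrow> complex^'n \<Rightarrow> complex" where
  "bargmann2 \<psi> z w =
     of_real (pi powr (- real (2 * CARD('n)) / 4)) * exp (- (cdot z z + cdot w w) / 4) *
     (LINT p|lebesgue. \<psi> p * of_real (exp (- (norm p)\<^sup>2 / 2)) *
        exp (cdot (of_real_vec (fst p)) z + cdot (of_real_vec (snd p)) w))"

text \<open>The inverse of the Bargmann transform from L^2 onto the Fock space; its values are
  determined up to null sets.\<close>
definition bargmann_inv :: "(complex^'n \<Rightarrow> complex) \<Rightarrow> real^'n \<Rightarrow> complex" where
  "bargmann_inv = inv_into L2 bargmann"

definition S_op ::
  "((real^'n) \<times> (real^'n) \<Rightarrow> complex) \<Rightarrow> (complex^'n \<Rightarrow> complex) \<Rightarrow> complex^'n \<Rightarrow> complex" where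
  "S_op \<psi> F z = (LINT w|fock_measure. F w * bargmann2 \<psi> (cnj_vec w) z)"

section \<open>Weyl transform\<close>

definition heis :: "complex^'n \<Rightarrow> (real^'n \<Rightarrow> complex) \<Rightarrow> real^'n \<Rightarrow> complex" where
  "heis z f \<xi> = cis (Re_vec z \<bullet> \<xi> + (Re_vec z \<bullet> Im_vec z) / 2) * f (\<xi> + Im_vec z)"

definition weyl :: "(complex^'n \<Rightarrow> complex) \<Rightarrow> (real^'n \<Rightarrow> complex) \<Rightarrow> real^'n \<Rightarrow> complex" where
  "weyl \<sigma> f \<xi> = (LINT z|lebesgue. \<sigma> z * heis z f \<xi>)"

definition fourier1_inv :: "(complex^'n \<Rightarrow> complex) \<Rightarrow> real^'n \<Rightarrow> real^'n \<Rightarrow> complex" where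
  "fourier1_inv \<sigma> \<xi> y = of_real ((2 * pi) powr (- real CARD('n) / 2)) *
     (LINT x|lebesgue. cis (x \<bullet> \<xi>) * \<sigma> (cvec x y))"

text \<open>The two relations between a kernel and its symbol. For an integrable symbol the integral in
  the first one converges for almost every value of u - v. The integral in the second one need
  not converge absolutely (it then has no meaning as a Lebesgue integral), so the formula is
  required only for those y for which it does; there it is Fourier inversion of the first
  relation.\<close>
definition kernel_symbol ::
  "((real^'n) \<times> (real^'n) \<Rightarrow> complex) \<Rightarrow> (complex^'n \<Rightarrow> complex) \<Rightarrow> bool" where
  "kernel_symbol \<psi> \<sigma> \<longleftrightarrow>
     (AE (u, v) in lebesgue. \<psi> (u, v) = fourier1_inv \<sigma> ((1/2) *\<^sub>R (u + v)) (u - v)) \<and>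
     (AE y in lebesgue.
        integrable lebesgue (\<lambda>\<xi>. \<psi> (\<xi> + (1/2) *\<^sub>R y, \<xi> - (1/2) *\<^sub>R y)) \<longrightarrow>
        (AE x in lebesgue. \<sigma> (cvec x y) =
           of_real ((2 * pi) powr (- real CARD('n) / 2)) *
           (LINT \<xi>|lebesgue. cis (- (x \<bullet> \<xi>)) * \<psi> (\<xi> + (1/2) *\<^sub>R y, \<xi> - (1/2) *\<^sub>R y))))"

section \<open>The Hermite operator and its powers\<close>

definition partial :: "'n \<Rightarrow> (real^'n \<Rightarrow> complex) \<Rightarrow> real^'n \<Rightarrow> complex" where
  "partial i f x = vector_derivative (\<lambda>t::real. f (x + t *\<^sub>R axis i 1)) (at 0)"

definition C1 :: "(real^'n \<Rightarrow> complex) \<Rightarrow> bool" where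
  "C1 f \<longleftrightarrow> (\<forall>i. (\<forall>x. (\<lambda>t::real. f (x + t *\<^sub>R axis i 1)) differentiable (at 0)) \<and>
                 continuous_on UNIV (partial i f))"

definition C2 :: "(real^'n \<Rightarrow> complex) \<Rightarrow> bool" where
  "C2 f \<longleftrightarrow> C1 f \<and> (\<forall>i. C1 (partial i f))"

definition laplacian :: "(real^'n \<Rightarrow> complex) \<Rightarrow> real^'n \<Rightarrow> complex" where
  "laplacian f x = (\<Sum>i\<in>UNIV. partial i (partial i f) x)"

definition hermite_op :: "(real^'n \<Rightarrow> complex) \<Rightarrow> real^'n \<Rightarrow> complex" where
  "hermite_op f x = - laplacian f x + of_real ((norm x)\<^sup>2) * f x"

definition eigenspace :: "real \<Rightarrow> (real^'n \<Rightarrow> complex) set" where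
  "eigenspace l = {\<phi>. C2 \<phi> \<and> \<phi> \<in> L2 \<and> (\<forall>x. hermite_op \<phi> x = of_real l * \<phi> x)}"

text \<open>The spectrum of H is discrete and consists of the eigenvalues 2k + n, the eigenfunctions
  being the (smooth) Hermite functions.\<close>
definition hermite_spectrum :: "'n::finite itself \<Rightarrow> real set" where
  "hermite_spectrum _ = {l. \<exists>\<phi> \<in> (eigenspace l :: (real^'n \<Rightarrow> complex) set). \<exists>x. \<phi> x \<noteq> 0}"

text \<open>\<open>p\<close> is the orthogonal projection of \<open>f\<close> onto the eigenspace for \<open>l\<close>.\<close>
definition is_eigenprojection ::
  "real \<Rightarrow> (real^'n \<Rightarrow> complex) \<Rightarrow> (real^'n \<Rightarrow> complex) \<Rightarrow> bool" where
  "is_eigenprojection l f p \<longleftrightarrow>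
     p \<in> eigenspace l \<and> (\<forall>\<phi>\<in>eigenspace l. l2_inner f \<phi> = l2_inner p \<phi>)"

text \<open>Spectral calculus: \<open>f\<close> lies in the domain of \<open>H^r\<close> and \<open>H^r f = g\<close>, where \<open>H^r f\<close> is the
  sum over the spectrum of \<open>l^r\<close> times the projection of \<open>f\<close> onto the eigenspace for \<open>l\<close>,
  with (unconditional) convergence in L^2.\<close>
definition is_hermite_power ::
  "real \<Rightarrow> (real^'n \<Rightarrow> complex) \<Rightarrow> (real^'n \<Rightarrow> complex) \<Rightarrow> bool" where
  "is_hermite_power r f g \<longleftrightarrow> f \<in> L2 \<and> g \<in> L2 \<and>
     (\<exists>P. (\<forall>l\<in>hermite_spectrum TYPE('n). is_eigenprojection l f (P l)) \<and>
          ((\<lambda>A. l2_norm (\<lambda>x. g x - (\<Sum>l\<in>A. of_real (l powr r) * P l x))) \<longlongrightarrow> 0)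
            (finite_subsets_at_top (hermite_spectrum TYPE('n))))"

definition hermite_power :: "real \<Rightarrow> (real^'n \<Rightarrow> complex) \<Rightarrow> real^'n \<Rightarrow> complex" where
  "hermite_power r f = (SOME g. is_hermite_power r f g)"

section \<open>Sobolev spaces\<close>

definition hermite_sobolev :: "real \<Rightarrow> (real^'n \<Rightarrow> complex) set" where
  "hermite_sobolev s = {f \<in> L2. \<exists>g. is_hermite_power (s / 2) f g}"

definition hermite_sobolev_norm :: "real \<Rightarrow> (real^'n \<Rightarrow> complex) \<Rightarrow> real" where
  "hermite_sobolev_norm s f = l2_norm (hermite_power (s / 2) f)"

definition fock_sobolev :: "real \<Rightarrow> (complex^'n \<Rightarrow> complex) set" where
  "fock_sobolev s = bargmann ` hermite_sobolev s"

definition fock_sobolev_norm :: "real \<Rightarrow> (complex^'n \<Rightarrow> complex) \<Rightarrow> real" where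
  "fock_sobolev_norm s F = l2_norm (hermite_power (s / 2) (bargmann_inv F))"

definition bounded_op_on :: "'a set \<Rightarrow> ('a \<Rightarrow> real) \<Rightarrow> ('a \<Rightarrow> 'a) \<Rightarrow> bool" where
  "bounded_op_on X N T \<longleftrightarrow> (\<forall>f\<in>X. T f \<in> X) \<and> (\<exists>C. \<forall>f\<in>X. N (T f) \<le> C * N f)"

end

theory Submission
  imports Defs "HOL-Probability.Characteristic_Functions" "HOL-Complex_Analysis.Cauchy_Integral_Formula"
begin

text \<open>
  The Bargmann transform is integration over R^n against the function \<open>kern z\<close>, so it is a pairing
  with \<open>kern z\<close>. Fix \<open>z\<close> and put \<open>h u = cnj (\<integral>v. \<psi> (u, v) * kern z v)\<close>. By Fubini the integral
  kernel of \<open>S_op \<psi>\<close> at \<open>(w, z)\<close> is \<open>cnj (bargmann h w)\<close>, hence \<open>S_op \<psi> F z\<close> is the pairing of \<open>F\<close>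
  with \<open>bargmann h\<close> in the Fock space. If \<open>F = bargmann f\<close>, unitarity turns it into the pairing
  of \<open>f\<close> with \<open>h\<close>, which is \<open>\<integral>u. f u * (\<integral>v. \<psi> (u, v) * kern z v)\<close>. On the other side, the substitution
  \<open>u = \<xi> + y\<close> in the definition of the Weyl transform shows that \<open>\<integral>u. \<psi> (u, v) * f u\<close> is
  \<open>(2 pi)^(-n/2)\<close> times the value of the Weyl transform of \<open>f\<close> at \<open>v\<close>
  (\<open>weyl_borel_eq_kernel\<close>), so the pairing is \<open>(2 pi)^(-n/2)\<close> times its Bargmann transform.
  All integrals over \<open>\<psi>\<close> converge because \<open>\<psi> (u, v)\<close> is dominated by an integrable function of
  \<open>u - v\<close>, so that Young's inequality applies.

  The part of unitarity that carries this argument is \<open>entire_eq_bargmann\<close>: every entire \<open>F\<close> in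
  the Fock space is \<open>bargmann f\<close> for some \<open>f\<close> with \<open>\<langle>F, bargmann h\<rangle> = \<langle>f, h\<rangle>\<close> for all \<open>h\<close>. The natural
  candidate, the integral of \<open>F w * cnj (kern w u)\<close> over \<open>w\<close>, does not converge absolutely in general.
  For bounded \<open>G\<close> in place of \<open>F\<close> it does, and defines \<open>synth G\<close>. The Bargmann transform of
  \<open>synth G\<close> is the integral of \<open>G\<close> against the reproducing kernel, whose modulus becomes
  \<open>exp (- |z - w|^2 / 4)\<close> after the Gaussian weights are divided evenly; Schur's test then bounds
  \<open>synth\<close> in L^2 (\<open>synth_bound\<close>), duality bounds \<open>bargmann\<close> (\<open>sqint_bargmann\<close>), and truncation
  together with completeness of L^2 extends the adjoint relation to every square integrable \<open>G\<close>
  (\<open>bargmann_adjoint_exists\<close>). If \<open>G = F\<close> is entire, the reproducing formula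
  (\<open>entire_reproducing\<close>) says that the function so obtained has Bargmann transform \<open>F\<close>. The formula
  is a mean value property: the Gaussian measure is invariant under multiplication of the vector
  by \<open>cis \<theta>\<close>, and averaging an entire function over these rotations gives its value at 0.

  The inverse Bargmann transform is a choice function, so \<open>f\<close> also has to be determined
  up to null sets by \<open>bargmann f\<close> (\<open>bargmann_inj\<close>). On purely imaginary vectors the Bargmann
  transform is a Fourier transform; if it vanishes there, then so do all Gaussian means
  of the function.

  The equivalence of boundedness is formal once \<open>S_op \<psi> (bargmann f) = C * bargmann (weyl \<sigma> f)\<close> is known
  for all \<open>f\<close> in L^2, since both Sobolev norms are defined by the powers of the Hermite operator on R^n.
  It uses that these powers depend on \<open>f\<close> only up to null sets, that they are determined
  up to null sets, and that they are homogeneous.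
\<close>

section \<open>Square integrable functions\<close>

lemma borel_measurable_cis [measurable]: "cis \<in> borel_measurable borel"
  by (intro borel_measurable_continuous_onI continuous_intros)

lemma borel_measurable_cnj [measurable]:
  "f \<in> borel_measurable M \<Longrightarrow> (\<lambda>x. cnj (f x)) \<in> borel_measurable M"
  by (rule measurable_compose[where N=borel]) (auto intro!: borel_measurable_continuous_onI continuous_intros)

lemma norm_integral_le_nn_integral:
  fixes f :: "'a \<Rightarrow> complex"
  shows "ennreal (norm (LINT x|M. f x)) \<le> (\<integral>\<^sup>+x. ennreal (norm (f x)) \<partial>M)"
  by (cases "integrable M f") (auto intro: integral_norm_bound_ennreal simp: not_integrable_integral_eq)

text \<open>Square integrability over an arbitrary measure: it is applied to Lebesgue measure on R^n, to its Borel
  restriction and to the Gaussian measure on C^n.\<close>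

definition sqint :: "'a measure \<Rightarrow> ('a \<Rightarrow> complex) \<Rightarrow> bool" where
  "sqint M f \<longleftrightarrow> f \<in> borel_measurable M \<and> integrable M (\<lambda>x. (norm (f x))\<^sup>2)"

abbreviation sqnorm :: "'a measure \<Rightarrow> ('a \<Rightarrow> complex) \<Rightarrow> real" where
  "sqnorm M f \<equiv> LINT x|M. (norm (f x))\<^sup>2"

lemma sqint_measurable: "sqint M f \<Longrightarrow> f \<in> borel_measurable M"
  by (simp add: sqint_def)

lemma sqint_integrable: "sqint M f \<Longrightarrow> integrable M (\<lambda>x. (norm (f x))\<^sup>2)"
  by (simp add: sqint_def)

lemma sqintI_nn:
  assumes [measurable]: "f \<in> borel_measurable M" and "(\<integral>\<^sup>+x. ennreal ((norm (f x))\<^sup>2) \<partial>M) < \<infinity>"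
  shows "sqint M f"
  using assms unfolding sqint_def by (auto intro!: integrableI_nonneg)

lemma sqint_nn_integral:
  "sqint M f \<Longrightarrow> (\<integral>\<^sup>+x. ennreal ((norm (f x))\<^sup>2) \<partial>M) = ennreal (sqnorm M f)"
  by (intro nn_integral_eq_integral) (auto simp: sqint_def)

lemma norm_add_power2_le:
  fixes a b :: "'a :: real_normed_vector"
  shows "(norm (a + b))\<^sup>2 \<le> 2 * (norm a)\<^sup>2 + 2 * (norm b)\<^sup>2"
proof -
  have "(norm (a + b))\<^sup>2 \<le> (norm a + norm b)\<^sup>2"
    by (intro power_mono norm_triangle_ineq) auto
  also have "\<dots> \<le> 2 * (norm a)\<^sup>2 + 2 * (norm b)\<^sup>2"
    using sum_squares_bound[of "norm a" "norm b"] by (simp add: power2_sum)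
  finally show ?thesis .
qed

lemma sqint_add:
  assumes f: "sqint M f" and g: "sqint M g"
  shows "sqint M (\<lambda>x. f x + g x)"
proof -
  note [measurable] = sqint_measurable[OF f] sqint_measurable[OF g]
  have "integrable M (\<lambda>x. (norm (f x + g x))\<^sup>2)"
    by (rule Bochner_Integration.integrable_bound
          [of M "\<lambda>x. 2 * (norm (f x))\<^sup>2 + 2 * (norm (g x))\<^sup>2"])
       (use sqint_integrable[OF f] sqint_integrable[OF g] in
         \<open>auto intro!: AE_I2 norm_add_power2_le\<close>)
  then show ?thesis by (simp add: sqint_def)
qed

lemma sqint_cmult: "sqint M f \<Longrightarrow> sqint M (\<lambda>x. c * f x)"
  by (auto simp: sqint_def norm_mult power_mult_distrib)

lemma sqint_diff: "sqint M f \<Longrightarrow> sqint M g \<Longrightarrow> sqint M (\<lambda>x. f x - g x)"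
  using sqint_add[of M f "\<lambda>x. (-1) * g x"] sqint_cmult[of M g "-1"] by simp

lemma sqint_cnj: "sqint M f \<Longrightarrow> sqint M (\<lambda>x. cnj (f x))"
  by (simp add: sqint_def borel_measurable_cnj)

lemma sqint_cong_AE:
  assumes "sqint M f" "AE x in M. f x = g x" "g \<in> borel_measurable M"
  shows "sqint M g"
proof -
  note [measurable] = sqint_measurable[OF assms(1)] assms(3)
  have "integrable M (\<lambda>x. (norm (g x))\<^sup>2) \<longleftrightarrow> integrable M (\<lambda>x. (norm (f x))\<^sup>2)"
    using assms(2) by (intro integrable_cong_AE) auto
  with assms show ?thesis by (simp add: sqint_def)
qed

lemma sqint_bound:
  assumes "sqint M f" "g \<in> borel_measurable M" "\<And>x. norm (g x) \<le> norm (f x)"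
  shows "sqint M g"
proof -
  note [measurable] = assms(2)
  have "integrable M (\<lambda>x. (norm (g x))\<^sup>2)"
    by (rule Bochner_Integration.integrable_bound[OF sqint_integrable[OF assms(1)]])
       (use assms(3) in \<open>auto intro!: AE_I2 power_mono\<close>)
  then show ?thesis using assms(2) by (simp add: sqint_def)
qed

lemma sqint_integrable_mult:
  assumes f: "sqint M f" and g: "sqint M g"
  shows "integrable M (\<lambda>x. f x * g x)"
proof (rule Bochner_Integration.integrable_bound
          [of M "\<lambda>x. (norm (f x))\<^sup>2 + (norm (g x))\<^sup>2"])
  note [measurable] = sqint_measurable[OF f] sqint_measurable[OF g]
  show "(\<lambda>x. f x * g x) \<in> borel_measurable M" by simp
  have "norm (f x) * norm (g x) \<le> (norm (f x))\<^sup>2 + (norm (g x))\<^sup>2" for x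
    using sum_squares_bound[of "norm (f x)" "norm (g x)"]
      mult_nonneg_nonneg[OF norm_ge_zero[of "f x"] norm_ge_zero[of "g x"]] by linarith
  then show "AE x in M. norm (f x * g x) \<le> norm ((norm (f x))\<^sup>2 + (norm (g x))\<^sup>2)"
    by (auto simp: norm_mult)
qed (use sqint_integrable[OF f] sqint_integrable[OF g] in auto)

lemma Cauchy_Schwarz_integral:
  assumes f: "sqint M f" and g: "sqint M g"
  shows "(norm (LINT x|M. f x * g x))\<^sup>2 \<le> sqnorm M f * sqnorm M g"
proof -
  note [measurable] = sqint_measurable[OF f] sqint_measurable[OF g]
  have "ennreal (norm (LINT x|M. f x * g x)) \<le> (\<integral>\<^sup>+x. ennreal (norm (f x)) * ennreal (norm (g x)) \<partial>M)"
    using norm_integral_le_nn_integral[of M "\<lambda>x. f x * g x"] by (simp add: norm_mult ennreal_mult')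
  then have "(ennreal (norm (LINT x|M. f x * g x)))\<^sup>2 \<le> (\<integral>\<^sup>+x. ennreal (norm (f x)) * ennreal (norm (g x)) \<partial>M)\<^sup>2"
    by (rule power_mono_ennreal)
  also have "\<dots> \<le> (\<integral>\<^sup>+x. (ennreal (norm (f x)))\<^sup>2 \<partial>M) * (\<integral>\<^sup>+x. (ennreal (norm (g x)))\<^sup>2 \<partial>M)"
    by (rule Cauchy_Schwarz_nn_integral) auto
  also have "\<dots> = ennreal (sqnorm M f * sqnorm M g)"
    by (simp add: ennreal_power sqint_nn_integral[OF f] sqint_nn_integral[OF g] ennreal_mult')
  finally show ?thesis by (simp add: ennreal_power ennreal_le_iff)
qed

lemma tendsto_integral_mult_L2:
  assumes f: "\<And>k. sqint M (f k)" and g: "sqint M g" and h: "sqint M h"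
    and lim: "(\<lambda>k. LINT x|M. (norm (f k x - g x))\<^sup>2) \<longlonglongrightarrow> 0"
  shows "(\<lambda>k. LINT x|M. f k x * h x) \<longlonglongrightarrow> (LINT x|M. g x * h x)"
proof -
  have "(\<lambda>k. (norm ((LINT x|M. f k x * h x) - (LINT x|M. g x * h x)))\<^sup>2) \<longlonglongrightarrow> 0"
  proof (rule tendsto_sandwich[OF _ _ tendsto_const])
    show "(\<lambda>k. sqnorm M (\<lambda>x. f k x - g x) * sqnorm M h) \<longlonglongrightarrow> 0"
      using tendsto_mult_right[OF lim, of "sqnorm M h"] by simp
    show "\<forall>\<^sub>F k in sequentially. (norm ((LINT x|M. f k x * h x) - (LINT x|M. g x * h x)))\<^sup>2
       \<le> sqnorm M (\<lambda>x. f k x - g x) * sqnorm M h"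
    proof (intro always_eventually allI)
      fix k
      have "(LINT x|M. f k x * h x) - (LINT x|M. g x * h x) = (LINT x|M. (f k x - g x) * h x)"
        by (subst Bochner_Integration.integral_diff[symmetric])
           (auto intro!: sqint_integrable_mult f g h simp: algebra_simps)
      then show "(norm ((LINT x|M. f k x * h x) - (LINT x|M. g x * h x)))\<^sup>2
       \<le> sqnorm M (\<lambda>x. f k x - g x) * sqnorm M h"
        using Cauchy_Schwarz_integral[OF sqint_diff[OF f g] h] by simp
    qed
  qed auto
  then have "(\<lambda>k. norm ((LINT x|M. f k x * h x) - (LINT x|M. g x * h x))) \<longlonglongrightarrow> 0"
    using tendsto_real_sqrt by fastforce
  then show ?thesis
    by (simp add: LIM_zero_iff tendsto_norm_zero_iff)
qed

text \<open>A subsequence whose successive differences have squared norm at most \<open>4^(-k)\<close> converges almost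
  everywhere, and Fatou's lemma shows that its pointwise limit is the limit in L^2.\<close>

lemma L2_complete:
  assumes f: "\<And>k. sqint M (f k)"
    and C: "\<And>e. e > 0 \<Longrightarrow> \<exists>N. \<forall>m\<ge>N. \<forall>n\<ge>N. sqnorm M (\<lambda>x. f m x - f n x) < e"
  shows "\<exists>g. sqint M g \<and> (\<lambda>k. LINT x|M. (norm (f k x - g x))\<^sup>2) \<longlonglongrightarrow> 0"
proof -
  note [measurable] = sqint_measurable[OF f]
  \<comment> \<open>indices of a rapidly converging subsequence\<close>
  have "\<exists>N. \<forall>k. (\<forall>m\<ge>N k. \<forall>n\<ge>N k. sqnorm M (\<lambda>x. f m x - f n x) < (1/4) ^ k)
                \<and> N k \<le> N (Suc k)"
  proof (rule dependent_nat_choice, goal_cases)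
    case 1
    show ?case using C[of 1] by simp
  next
    case (2 N k)
    obtain N' where "\<forall>m\<ge>N'. \<forall>n\<ge>N'. sqnorm M (\<lambda>x. f m x - f n x) < (1/4) ^ Suc k"
      using C[of "(1/4) ^ Suc k"] by auto
    then show ?case by (intro exI[of _ "max N N'"]) auto
  qed
  then obtain N where N: "\<And>k m n. m \<ge> N k \<Longrightarrow> n \<ge> N k \<Longrightarrow>
      sqnorm M (\<lambda>x. f m x - f n x) < (1/4) ^ k" and Nm: "\<And>k. N k \<le> N (Suc k)"
    by blast
  have Nmono: "N j \<le> N k" if "j \<le> k" for j k
    using lift_Suc_mono_le[of N, OF Nm that] .
  define d where "d k x = f (N (Suc k)) x - f (N k) x" for k x
  have [measurable]: "d k \<in> borel_measurable M" for k unfolding d_def[abs_def] by simp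
  have sd: "sqint M (d k)" for k
    unfolding d_def[abs_def] by (rule sqint_diff[OF f f])
  have nd: "(\<integral>\<^sup>+x. ennreal ((norm (d k x))\<^sup>2) \<partial>M) \<le> ennreal ((1/4) ^ k)" for k
    unfolding sqint_nn_integral[OF sd] using N[of k "N (Suc k)" "N k"] Nm[of k]
    by (intro ennreal_leI) (simp add: d_def)
  \<comment> \<open>The weights \<open>2^k\<close> keep the sum finite, and finiteness of the weighted sum at \<open>x\<close> forces
    \<open>norm (d k x)\<close> to be at most \<open>2^(-k/2)\<close> eventually, which is summable.\<close>
  have "(\<integral>\<^sup>+x. (\<Sum>k. ennreal (2 ^ k * (norm (d k x))\<^sup>2)) \<partial>M)
      = (\<Sum>k. \<integral>\<^sup>+x. ennreal (2 ^ k * (norm (d k x))\<^sup>2) \<partial>M)"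
    by (rule nn_integral_suminf) simp
  also have "\<dots> \<le> (\<Sum>k. ennreal ((1/2) ^ k))"
  proof (intro suminf_le summableI)
    fix k
    have "(\<integral>\<^sup>+x. ennreal (2 ^ k * (norm (d k x))\<^sup>2) \<partial>M)
        = ennreal (2 ^ k) * (\<integral>\<^sup>+x. ennreal ((norm (d k x))\<^sup>2) \<partial>M)"
      by (simp add: ennreal_mult' nn_integral_cmult)
    also have "\<dots> \<le> ennreal (2 ^ k) * ennreal ((1/4) ^ k)"
      by (intro mult_left_mono nd) auto
    also have "\<dots> = ennreal ((1/2) ^ k)"
      by (simp add: ennreal_mult'[symmetric] power_mult_distrib[symmetric])
    finally show "(\<integral>\<^sup>+x. ennreal (2 ^ k * (norm (d k x))\<^sup>2) \<partial>M) \<le> ennreal ((1/2) ^ k)" .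
  qed
  also have "\<dots> = ennreal (\<Sum>k. (1/2) ^ k)"
    by (rule suminf_ennreal2) auto
  finally have fin: "(\<integral>\<^sup>+x. (\<Sum>k. ennreal (2 ^ k * (norm (d k x))\<^sup>2)) \<partial>M) < \<infinity>"
    by (rule le_less_trans) simp
  have "AE x in M. (\<Sum>k. ennreal (2 ^ k * (norm (d k x))\<^sup>2)) \<noteq> \<infinity>"
    by (rule nn_integral_PInf_AE) (use fin in auto)
  then have conv: "AE x in M. (\<lambda>k. f (N k) x) \<longlonglongrightarrow> lim (\<lambda>k. f (N k) x)"
  proof eventually_elim
    case (elim x)
    have sm: "summable (\<lambda>k. 2 ^ k * (norm (d k x))\<^sup>2)"
      by (rule summable_suminf_not_top) (use elim in auto)
    then have "(\<lambda>k. 2 ^ k * (norm (d k x))\<^sup>2) \<longlonglongrightarrow> 0"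
      by (rule summable_LIMSEQ_zero)
    then have "\<forall>\<^sub>F k in sequentially. 2 ^ k * (norm (d k x))\<^sup>2 < 1"
      by (rule order_tendstoD(2)) simp
    then have "\<forall>\<^sub>F k in sequentially. norm (d k x) \<le> sqrt (1/2) ^ k"
    proof eventually_elim
      case (elim k)
      have "(norm (d k x))\<^sup>2 \<le> (1/2) ^ k"
        using elim by (simp add: power_divide field_simps)
      also have "\<dots> = (sqrt (1/2) ^ k)\<^sup>2"
        by (metis power_mult mult.commute real_sqrt_pow2 zero_le_divide_1_iff zero_le_numeral)
      finally show ?case
        by (rule power2_le_imp_le) simp
    qed
    moreover have "summable (\<lambda>k. sqrt (1/2) ^ k)"
      by (rule summable_geometric) (simp add: real_sqrt_divide)
    ultimately have "summable (\<lambda>k. d k x)"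
      by (rule summable_comparison_test_ev)
    then have "convergent (\<lambda>n. \<Sum>k<n. d k x)"
      by (simp add: summable_iff_convergent)
    moreover have "(\<Sum>k<n. d k x) = f (N n) x - f (N 0) x" for n
      unfolding d_def by (rule sum_lessThan_telescope)
    ultimately have "convergent (\<lambda>n. f (N n) x - f (N 0) x)" by simp
    then have "convergent (\<lambda>n. (f (N n) x - f (N 0) x) + f (N 0) x)"
      by (intro convergent_add convergent_const)
    then show ?case by (simp add: convergent_LIMSEQ_iff)
  qed
  define g where "g x = lim (\<lambda>k. f (N k) x)" for x
  have gm[measurable]: "g \<in> borel_measurable M"
    unfolding g_def[abs_def] by (rule borel_measurable_lim_metric) simp
  have bound: "(\<integral>\<^sup>+x. ennreal ((norm (f m x - g x))\<^sup>2) \<partial>M) \<le> ennreal ((1/4) ^ k)" if "m \<ge> N k" for m k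
  proof -
    have "(\<integral>\<^sup>+x. ennreal ((norm (f m x - g x))\<^sup>2) \<partial>M)
        = (\<integral>\<^sup>+x. liminf (\<lambda>j. ennreal ((norm (f m x - f (N j) x))\<^sup>2)) \<partial>M)"
    proof (rule nn_integral_cong_AE)
      show "AE x in M. ennreal ((norm (f m x - g x))\<^sup>2)
          = liminf (\<lambda>j. ennreal ((norm (f m x - f (N j) x))\<^sup>2))"
        using conv
      proof eventually_elim
        case (elim x)
        have "(\<lambda>j. ennreal ((norm (f m x - f (N j) x))\<^sup>2)) \<longlonglongrightarrow> ennreal ((norm (f m x - g x))\<^sup>2)"
          using elim unfolding g_def by (intro tendsto_intros)
        then show ?case by (rule lim_imp_Liminf[OF trivial_limit_sequentially, symmetric])
      qed
    qed
    also have "\<dots> \<le> liminf (\<lambda>j. \<integral>\<^sup>+x. ennreal ((norm (f m x - f (N j) x))\<^sup>2) \<partial>M)"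
      by (rule nn_integral_liminf) simp
    also have "\<dots> \<le> ennreal ((1/4) ^ k)"
    proof (rule Liminf_le)
      show "\<forall>\<^sub>F j in sequentially. (\<integral>\<^sup>+x. ennreal ((norm (f m x - f (N j) x))\<^sup>2) \<partial>M) \<le> ennreal ((1/4) ^ k)"
        using eventually_ge_at_top[of k]
      proof eventually_elim
        case (elim j)
        show ?case
          unfolding sqint_nn_integral[OF sqint_diff[OF f f]]
          using N[of k m "N j"] that Nmono[OF elim] by (intro ennreal_leI) auto
      qed
    qed simp
    finally show ?thesis .
  qed
  have sg': "sqint M (\<lambda>x. f (N 0) x - g x)"
    by (rule sqintI_nn) (use bound[where k=0 and m="N 0"] in \<open>auto simp: le_less_trans\<close>)
  then have "sqint M (\<lambda>x. f (N 0) x - (f (N 0) x - g x))"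
    by (rule sqint_diff[OF f])
  then have sg: "sqint M g" by simp
  have "(\<lambda>k. LINT x|M. (norm (f k x - g x))\<^sup>2) \<longlonglongrightarrow> 0"
  proof (rule LIMSEQ_I)
    fix e :: real assume "e > 0"
    then obtain k where k: "(1/4) ^ k < e"
      using real_arch_pow_inv[of e "1/4"] by auto
    have "norm (sqnorm M (\<lambda>x. f m x - g x) - 0) < e" if "m \<ge> N k" for m
    proof -
      have "sqnorm M (\<lambda>x. f m x - g x) \<le> (1/4) ^ k"
        using bound[OF that] unfolding sqint_nn_integral[OF sqint_diff[OF f sg]]
        by (simp add: ennreal_le_iff)
      with k show ?thesis by simp
    qed
    then show "\<exists>no. \<forall>m\<ge>no. norm (sqnorm M (\<lambda>x. f m x - g x) - 0) < e" by blast
  qed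
  with sg show ?thesis by blast
qed

section \<open>Borel representatives\<close>

lemma completion_ex_borel_measurable_complex:
  fixes g :: "'a \<Rightarrow> complex"
  assumes g: "g \<in> borel_measurable (completion M)"
  shows "\<exists>g'\<in>borel_measurable M. AE x in M. g x = g' x"
proof -
  have "(\<lambda>x. Re (g x)) \<in> borel_measurable (completion M)" "(\<lambda>x. Im (g x)) \<in> borel_measurable (completion M)"
    using g by measurable
  then obtain a b where m: "a \<in> borel_measurable M" "b \<in> borel_measurable M"
    and ab: "AE x in M. Re (g x) = a x" "AE x in M. Im (g x) = b x"
    using completion_ex_borel_measurable_real by metis
  have "AE x in M. g x = of_real (a x) + \<i> * of_real (b x)"
    using ab by eventually_elim (simp add: complex_eq_iff)
  moreover have "(\<lambda>x. of_real (a x) + \<i> * of_real (b x) :: complex) \<in> borel_measurable M"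
    using m by measurable
  ultimately show ?thesis by (rule bexI)
qed

lemma sqint_completion: "f \<in> borel_measurable M \<Longrightarrow> sqint (completion M) f \<longleftrightarrow> sqint M f"
  unfolding sqint_def by (simp add: integrable_completion measurable_completion)

lemma L2_eq_sqint: "f \<in> L2 \<longleftrightarrow> sqint lebesgue f"
  by (simp add: L2_def sqint_def)

text \<open>Product measures and Fubini's theorem are applied to Borel functions; this replaces a member of L^2 by a
  Borel function in its class.\<close>

lemma L2_borel_representative:
  assumes "f \<in> L2"
  obtains f0 where "sqint lborel f0" "AE x in lborel. f x = f0 x" "f0 \<in> L2"
proof -
  obtain f0 where f0: "f0 \<in> borel_measurable lborel" "AE x in lborel. f x = f0 x"
    using completion_ex_borel_measurable_complex[of f lborel] assms by (auto simp: L2_def)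
  then have "sqint lebesgue f0"
    using assms sqint_cong_AE[of lebesgue f f0] AE_completion[OF f0(2)]
      measurable_completion[OF f0(1)]
    by (auto simp: L2_eq_sqint)
  with f0 show ?thesis by (intro that) (auto simp: sqint_completion L2_eq_sqint)
qed

section \<open>Vectors in C^n\<close>

lemma Re_vec_nth [simp]: "Re_vec z $ j = Re (z $ j)" by (simp add: Re_vec_def)
lemma Im_vec_nth [simp]: "Im_vec z $ j = Im (z $ j)" by (simp add: Im_vec_def)
lemma cnj_vec_nth [simp]: "cnj_vec z $ j = cnj (z $ j)" by (simp add: cnj_vec_def)
lemma of_real_vec_nth [simp]: "of_real_vec x $ j = of_real (x $ j)" by (simp add: of_real_vec_def)
lemma cvec_nth [simp]: "cvec x y $ j = Complex (x $ j) (y $ j)" by (simp add: cvec_def)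

lemma Re_vec_cvec [simp]: "Re_vec (cvec x y) = x" by (simp add: vec_eq_iff)
lemma Im_vec_cvec [simp]: "Im_vec (cvec x y) = y" by (simp add: vec_eq_iff)
lemma cnj_vec_cnj_vec [simp]: "cnj_vec (cnj_vec z) = z" by (simp add: vec_eq_iff)
lemma cnj_vec_of_real_vec [simp]: "cnj_vec (of_real_vec u) = of_real_vec u" by (simp add: vec_eq_iff)
lemma Re_vec_cnj_vec [simp]: "Re_vec (cnj_vec z) = Re_vec z" by (simp add: vec_eq_iff)
lemma Im_vec_cnj_vec [simp]: "Im_vec (cnj_vec z) = - Im_vec z" by (simp add: vec_eq_iff)

lemma cdot_commute: "cdot z w = cdot w z" by (simp add: cdot_def mult.commute)
lemma cdot_add_right: "cdot z (w + v) = cdot z w + cdot z v"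
  by (simp add: cdot_def algebra_simps sum.distrib)
lemma cdot_add_left: "cdot (w + v) z = cdot w z + cdot v z"
  by (simp add: cdot_def algebra_simps sum.distrib)
lemma cdot_scale_right: "cdot z (c *s w) = c * cdot z w"
  by (simp add: cdot_def sum_distrib_left algebra_simps)
lemma cnj_cdot: "cnj (cdot z w) = cdot (cnj_vec z) (cnj_vec w)"
  by (simp add: cdot_def)
lemma cdot_zero [simp]: "cdot z 0 = 0" "cdot 0 z = 0"
  by (simp_all add: cdot_def)

lemma Re_cdot: "Re (cdot z w) = Re_vec z \<bullet> Re_vec w - Im_vec z \<bullet> Im_vec w"
  by (simp add: cdot_def inner_vec_def sum_subtractf)
lemma Im_cdot: "Im (cdot z w) = Re_vec z \<bullet> Im_vec w + Im_vec z \<bullet> Re_vec w"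
  by (simp add: cdot_def inner_vec_def sum.distrib)
lemma Re_vec_of_real_vec [simp]: "Re_vec (of_real_vec u) = u" by (simp add: vec_eq_iff)
lemma Im_vec_of_real_vec [simp]: "Im_vec (of_real_vec u) = 0" by (simp add: vec_eq_iff)

lemma inner_complex_vec: "z \<bullet> w = Re_vec z \<bullet> Re_vec w + Im_vec z \<bullet> Im_vec w" for z w :: "complex^'n"
  by (simp add: inner_vec_def inner_complex_def sum.distrib)

lemma Re_cdot_cnj: "Re (cdot z (cnj_vec w)) = z \<bullet> w"
  by (simp add: Re_cdot inner_complex_vec)

lemma norm_complex_vec: "(norm z)\<^sup>2 = (norm (Re_vec z))\<^sup>2 + (norm (Im_vec z))\<^sup>2" for z :: "complex^'n"
  by (simp add: power2_norm_eq_inner inner_complex_vec)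

lemma cdot_cnj_self: "cdot z (cnj_vec z) = of_real ((norm z)\<^sup>2)"
  by (simp add: complex_eq_iff Re_cdot_cnj power2_norm_eq_inner Im_cdot inner_commute)

lemma cdot_of_real_vec: "cdot (of_real_vec u) (of_real_vec v) = of_real (u \<bullet> v)"
  by (simp add: complex_eq_iff Re_cdot Im_cdot)

lemma continuous_on_Re_vec [continuous_intros]:
  "continuous_on S f \<Longrightarrow> continuous_on S (\<lambda>x. Re_vec (f x))"
  unfolding Re_vec_def by (intro continuous_intros)
lemma continuous_on_Im_vec [continuous_intros]:
  "continuous_on S f \<Longrightarrow> continuous_on S (\<lambda>x. Im_vec (f x))"
  unfolding Im_vec_def by (intro continuous_intros)
lemma continuous_on_cnj_vec [continuous_intros]:
  "continuous_on S f \<Longrightarrow> continuous_on S (\<lambda>x. cnj_vec (f x))"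
  unfolding cnj_vec_def by (intro continuous_intros)
lemma continuous_on_of_real_vec [continuous_intros]:
  "continuous_on S f \<Longrightarrow> continuous_on S (\<lambda>x. of_real_vec (f x))"
  unfolding of_real_vec_def by (intro continuous_intros)
lemma continuous_on_cvec [continuous_intros]:
  "continuous_on S f \<Longrightarrow> continuous_on S g \<Longrightarrow> continuous_on S (\<lambda>x. cvec (f x) (g x))"
  unfolding cvec_def Complex_eq by (intro continuous_intros)
lemma continuous_on_cdot [continuous_intros]:
  "continuous_on S f \<Longrightarrow> continuous_on S g \<Longrightarrow> continuous_on S (\<lambda>x. cdot (f x) (g x))"
  unfolding cdot_def by (intro continuous_intros)
lemma continuous_on_smult_vec [continuous_intros]:
  fixes g :: "_ \<Rightarrow> complex^'n"
  shows "continuous_on S f \<Longrightarrow> continuous_on S g \<Longrightarrow> continuous_on S (\<lambda>x. f x *s g x)"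
  unfolding vector_scalar_mult_def by (intro continuous_intros)

lemma borel_measurable_Re_vec [measurable]: "Re_vec \<in> borel_measurable borel"
  by (intro borel_measurable_continuous_onI continuous_intros)
lemma borel_measurable_Im_vec [measurable]: "Im_vec \<in> borel_measurable borel"
  by (intro borel_measurable_continuous_onI continuous_intros)
lemma borel_measurable_cnj_vec [measurable]: "cnj_vec \<in> borel_measurable borel"
  by (intro borel_measurable_continuous_onI continuous_intros)
lemma borel_measurable_of_real_vec [measurable]: "of_real_vec \<in> borel_measurable borel"
  by (intro borel_measurable_continuous_onI continuous_intros)
lemma borel_measurable_cvec [measurable (raw)]:
  "f \<in> borel_measurable M \<Longrightarrow> g \<in> borel_measurable M \<Longrightarrow> (\<lambda>x. cvec (f x) (g x)) \<in> borel_measurable M"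
  by (rule borel_measurable_continuous_Pair[where H=cvec]) (auto intro!: continuous_intros)
lemma borel_measurable_cdot [measurable (raw)]:
  "f \<in> borel_measurable M \<Longrightarrow> g \<in> borel_measurable M \<Longrightarrow> (\<lambda>x. cdot (f x) (g x)) \<in> borel_measurable M"
  by (rule borel_measurable_continuous_Pair[where H=cdot]) (auto intro!: continuous_intros)
lemma borel_measurable_smult_vec [measurable (raw)]:
  fixes g :: "_ \<Rightarrow> complex^'n"
  shows "f \<in> borel_measurable M \<Longrightarrow> g \<in> borel_measurable M \<Longrightarrow> (\<lambda>x. f x *s g x) \<in> borel_measurable M"
  by (rule borel_measurable_continuous_Pair[where H="(*s)"]) (auto intro!: continuous_intros)

section \<open>Gaussian integrals\<close>

lemma prod_Basis_real_vec: "(\<Prod>b\<in>(Basis::(real^'n) set). g b) = (\<Prod>i\<in>UNIV. g (axis i 1))"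
proof -
  have B: "(Basis::(real^'n) set) = range (\<lambda>i. axis i 1)" by (auto simp: Basis_vec_def)
  show ?thesis unfolding B
    by (subst prod.reindex) (auto simp: inj_on_def axis_eq_axis)
qed

text \<open>Lebesgue measure on R^n is by construction an image of a product of one-dimensional ones, indexed by the
  standard basis; this restates it for coordinates indexed by \<open>'n\<close>.\<close>

lemma has_bochner_integral_prod_vec:
  fixes f :: "'n::finite \<Rightarrow> real \<Rightarrow> complex"
  assumes f: "\<And>i. has_bochner_integral lborel (f i) (I i)"
  shows "has_bochner_integral lborel (\<lambda>x::real^'n. \<Prod>i\<in>UNIV. f i (x $ i)) (\<Prod>i\<in>UNIV. I i)"
proof -
  define h where "h b = f (THE i. b = axis i 1)" for b :: "real^'n"
  have h: "h (axis i 1) = f i" for i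
    unfolding h_def by (rule arg_cong[where f=f]) (auto simp: axis_eq_axis)
  have int: "integrable lborel (f i)" "integral\<^sup>L lborel (f i) = I i" for i
    using f[of i] by (auto simp: has_bochner_integral_iff)
  have hi: "integrable lborel (h b)" if "b \<in> Basis" for b
    using that int(1) by (auto simp: Basis_vec_def h)
  have [measurable]: "f i \<in> borel_measurable borel" for i
    using borel_measurable_integrable[OF int(1)] by simp
  interpret product_sigma_finite "\<lambda>_::real^'n. lborel :: real measure" ..
  have eq: "(\<Prod>i\<in>UNIV. f i ((\<Sum>b\<in>Basis. g b *\<^sub>R b) $ i)) = (\<Prod>b\<in>Basis. h b (g b))" for g :: "real^'n \<Rightarrow> real"
  proof -
    have "(\<Sum>b\<in>Basis. g b *\<^sub>R b) $ i = g (axis i 1)" for i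
      by (subst cart_eq_inner_axis) (simp add: inner_sum_left_Basis)
    then show ?thesis by (simp add: prod_Basis_real_vec h)
  qed
  have [measurable]: "(\<lambda>g. \<Sum>b\<in>Basis. g b *\<^sub>R (b::real^'n)) \<in> (\<Pi>\<^sub>M b\<in>Basis. lborel) \<rightarrow>\<^sub>M borel"
    by simp
  have "integrable (\<Pi>\<^sub>M b\<in>Basis. lborel) (\<lambda>g. \<Prod>b\<in>(Basis::(real^'n) set). h b (g b))"
    by (rule product_integrable_prod) (auto intro: hi)
  moreover have "integral\<^sup>L (\<Pi>\<^sub>M b\<in>Basis. lborel) (\<lambda>g. \<Prod>b\<in>(Basis::(real^'n) set). h b (g b)) = (\<Prod>i\<in>UNIV. I i)"
    by (subst product_integral_prod) (auto intro: hi simp: prod_Basis_real_vec h int)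
  ultimately show ?thesis
    unfolding has_bochner_integral_iff
    by (subst (1 2) lborel_eq) (simp add: integrable_distr_eq integral_distr eq del: sum_component vector_scaleR_component)
qed

text \<open>The characteristic function of the standard normal distribution, without the normalizing factor.\<close>

lemma has_bochner_integral_gaussian_iexp:
  "has_bochner_integral lborel (\<lambda>x. of_real (exp (- x\<^sup>2 / 2)) * exp (\<i> * of_real (t * x)))
     (of_real (sqrt (2 * pi) * exp (- t\<^sup>2 / 2)))"
proof -
  have "char std_normal_distribution t = of_real (exp (- t\<^sup>2 / 2))"
    by (simp add: char_std_normal_distribution)
  then have *: "(LINT x|lborel. std_normal_density x *\<^sub>R exp (\<i> * of_real (t * x))) = of_real (exp (- t\<^sup>2 / 2))"
    unfolding char_def by (subst (asm) integral_density) (auto simp: normal_density_nonneg)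
  have "integrable lborel (\<lambda>x. std_normal_density x *\<^sub>R exp (\<i> * of_real (t * x)))"
    by (rule Bochner_Integration.integrable_bound[of _ std_normal_density])
       (auto simp: norm_exp_i_times simp flip: of_real_mult intro!: integrable_normal_density)
  with * have "has_bochner_integral lborel (\<lambda>x. std_normal_density x *\<^sub>R exp (\<i> * of_real (t * x)))
     (of_real (exp (- t\<^sup>2 / 2)))"
    by (simp add: has_bochner_integral_iff)
  then have "has_bochner_integral lborel (\<lambda>x. sqrt (2 * pi) *\<^sub>R (std_normal_density x *\<^sub>R exp (\<i> * of_real (t * x))))
     (sqrt (2 * pi) *\<^sub>R of_real (exp (- t\<^sup>2 / 2)))"
    by (rule has_bochner_integral_scaleR_right)
  then
  show ?thesis
    by (simp add: std_normal_density_def scaleR_conv_of_real)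
qed

lemma has_bochner_integral_gaussian_1d:
  fixes b :: complex
  assumes a: "a > 0"
  shows "has_bochner_integral lborel (\<lambda>x. exp (- of_real (a * x\<^sup>2) + b * of_real x))
     (of_real (sqrt (pi / a)) * exp (b\<^sup>2 / of_real (4 * a)))"
proof -
  define p q where "p = Re b" and "q = Im b"
  \<comment> \<open>The substitution \<open>c + s * x\<close> for \<open>x\<close> completes the square in the real part of the exponent
    and scales the quadratic term to that of the standard normal density.\<close>
  define s c where "s = 1 / sqrt (2 * a)" and "c = p / (2 * a)"
  have s: "s > 0" "s\<^sup>2 = 1 / (2 * a)" using a by (auto simp: s_def power_divide)
  have b: "b = of_real p + \<i> * of_real q" by (simp add: p_def q_def complex_eq_iff)
  define K where "K = exp (of_real (p\<^sup>2 / (4 * a)) + \<i> * of_real (q * c) :: complex)"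
  have eq: "exp (- of_real (a * (c + s * x)\<^sup>2) + b * of_real (c + s * x))
     = K * (of_real (exp (- x\<^sup>2 / 2)) * exp (\<i> * of_real (q * s * x)))" for x
  proof -
    have "a * s\<^sup>2 = 1 / 2" "2 * a * c = p" using a s by (auto simp: c_def)
    then have e: "- (a * (c + s * x)\<^sup>2) + p * (c + s * x) = p\<^sup>2 / (4 * a) - x\<^sup>2 / 2"
    proof -
      have "- (a * (c + s * x)\<^sup>2) + p * (c + s * x)
          = - (a * s\<^sup>2) * x\<^sup>2 + (p - 2 * a * c) * s * x + (p * c - a * c\<^sup>2)"
        by (simp add: power2_eq_square algebra_simps)
      also have "p * c - a * c\<^sup>2 = p\<^sup>2 / (4 * a)"
        using a by (simp add: c_def power2_eq_square field_simps)
      finally show ?thesis using \<open>a * s\<^sup>2 = 1 / 2\<close> \<open>2 * a * c = p\<close> by simp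
    qed
    have "- of_real (a * (c + s * x)\<^sup>2) + b * of_real (c + s * x)
        = of_real (- (a * (c + s * x)\<^sup>2) + p * (c + s * x)) + \<i> * of_real (q * (c + s * x))"
      by (simp add: b algebra_simps)
    also have "\<dots> = (of_real (p\<^sup>2 / (4 * a)) + \<i> * of_real (q * c))
         + (of_real (- x\<^sup>2 / 2) + \<i> * of_real (q * s * x))"
      unfolding e by (simp add: algebra_simps)
    finally show ?thesis
      unfolding K_def by (simp only: exp_add exp_of_real)
  qed
  have "has_bochner_integral lborel (\<lambda>x. K * (of_real (exp (- x\<^sup>2 / 2)) * exp (\<i> * of_real (q * s * x))))
     (K * of_real (sqrt (2 * pi) * exp (- (q * s)\<^sup>2 / 2)))"
    by (intro has_bochner_integral_mult_right has_bochner_integral_gaussian_iexp)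
  also have "K * of_real (sqrt (2 * pi) * exp (- (q * s)\<^sup>2 / 2))
     = (of_real (sqrt (pi / a)) * exp (b\<^sup>2 / of_real (4 * a))) /\<^sub>R \<bar>s\<bar>"
  proof -
    have "sqrt (2 * pi) = sqrt (pi / a) * sqrt (2 * a)"
      using a by (simp add: real_sqrt_mult[symmetric])
    then have 1: "sqrt (2 * pi) = sqrt (pi / a) / s"
      by (simp add: s_def)
    have "b\<^sup>2 / of_real (4 * a) = of_real (p\<^sup>2 / (4 * a)) + \<i> * of_real (q * c) + of_real (- (q * s)\<^sup>2 / 2)"
      using a s by (simp add: b c_def power2_eq_square complex_eq_iff field_simps)
    then have "exp (b\<^sup>2 / of_real (4 * a)) = K * of_real (exp (- (q * s)\<^sup>2 / 2))"
      unfolding K_def by (simp only: exp_add exp_of_real)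
    then show ?thesis using s(1) unfolding 1 by (simp add: scaleR_conv_of_real field_simps)
  qed
  finally show ?thesis
    unfolding eq[symmetric]
    by (subst lborel_has_bochner_integral_real_affine_iff[of s _ _ c]) (use s(1) in auto)
qed

lemma has_bochner_integral_gaussian:
  fixes b :: "complex^'n"
  assumes a: "a > 0"
  shows "has_bochner_integral lborel (\<lambda>u::real^'n. exp (- of_real (a * (norm u)\<^sup>2) + cdot (of_real_vec u) b))
     (of_real ((pi / a) powr (real CARD('n) / 2)) * exp (cdot b b / of_real (4 * a)))"
proof -
  have "has_bochner_integral lborel
     (\<lambda>u::real^'n. \<Prod>i\<in>UNIV. exp (- of_real (a * (u $ i)\<^sup>2) + b $ i * of_real (u $ i)))
     (\<Prod>i\<in>UNIV. of_real (sqrt (pi / a)) * exp ((b $ i)\<^sup>2 / of_real (4 * a)))"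
    by (rule has_bochner_integral_prod_vec has_bochner_integral_gaussian_1d[OF a])+
  also have "(\<lambda>u::real^'n. \<Prod>i\<in>UNIV. exp (- of_real (a * (u $ i)\<^sup>2) + b $ i * of_real (u $ i)))
      = (\<lambda>u. exp (- of_real (a * (norm u)\<^sup>2) + cdot (of_real_vec u) b))"
  proof
    fix u :: "real^'n"
    have "(norm u)\<^sup>2 = (\<Sum>i\<in>UNIV. (u $ i)\<^sup>2)"
      unfolding power2_norm_eq_inner inner_vec_def by (simp add: power2_eq_square)
    then show "(\<Prod>i\<in>UNIV. exp (- of_real (a * (u $ i)\<^sup>2) + b $ i * of_real (u $ i)))
      = exp (- of_real (a * (norm u)\<^sup>2) + cdot (of_real_vec u) b)"
      by (simp only: exp_sum[symmetric, OF finite])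
         (simp add: sum.distrib sum_negf cdot_def sum_distrib_left mult.commute sum_subtractf)
  qed
  also have "(\<Prod>i\<in>UNIV. of_real (sqrt (pi / a)) * exp ((b $ i)\<^sup>2 / of_real (4 * a)))
     = of_real ((pi / a) powr (real CARD('n) / 2)) * exp (cdot b b / of_real (4 * a))"
  proof -
    have "(sqrt (pi / a)) ^ CARD('n) = (pi / a) powr (real CARD('n) / 2)"
      using a by (simp add: powr_half_sqrt[symmetric] powr_powr powr_realpow[symmetric])
    then show ?thesis
      by (simp add: prod.distrib exp_sum[symmetric] cdot_def power2_eq_square sum_divide_distrib
           flip: of_real_power)
  qed
  finally show ?thesis .
qed

lemma has_bochner_integral_gaussian_real:
  fixes b :: "real^'n"
  assumes a: "a > 0"
  shows "has_bochner_integral lborel (\<lambda>u::real^'n. exp (- (a * (norm u)\<^sup>2) + b \<bullet> u))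
     ((pi / a) powr (real CARD('n) / 2) * exp ((norm b)\<^sup>2 / (4 * a)))"
proof -
  have "exp (- of_real (a * (norm u)\<^sup>2) + cdot (of_real_vec u) (of_real_vec b))
      = complex_of_real (exp (- (a * (norm u)\<^sup>2) + b \<bullet> u))" for u :: "real^'n"
    by (simp add: cdot_of_real_vec inner_commute exp_of_real[symmetric] del: exp_of_real)
  moreover have "of_real ((pi / a) powr (real CARD('n) / 2)) * exp (cdot (of_real_vec b) (of_real_vec b) / of_real (4 * a))
     = complex_of_real ((pi / a) powr (real CARD('n) / 2) * exp ((norm b)\<^sup>2 / (4 * a)))"
    by (simp add: cdot_of_real_vec power2_norm_eq_inner exp_of_real[symmetric] del: exp_of_real)
  ultimately have "has_bochner_integral lborel (\<lambda>u::real^'n. complex_of_real (exp (- (a * (norm u)\<^sup>2) + b \<bullet> u)))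
     (complex_of_real ((pi / a) powr (real CARD('n) / 2) * exp ((norm b)\<^sup>2 / (4 * a))))"
    using has_bochner_integral_gaussian[OF a, of "of_real_vec b"] by (simp only:)
  from has_bochner_integral_bounded_linear[OF bounded_linear_Re this] show ?thesis by simp
qed

lemma nn_integral_gaussian:
  fixes b :: "real^'n"
  assumes a: "a > 0"
  shows "(\<integral>\<^sup>+u. ennreal (exp (- (a * (norm u)\<^sup>2) + b \<bullet> u)) \<partial>lborel)
     = ennreal ((pi / a) powr (real CARD('n) / 2) * exp ((norm b)\<^sup>2 / (4 * a)))"
  using has_bochner_integral_gaussian_real[OF a, of b]
  by (subst nn_integral_eq_integral) (auto simp: has_bochner_integral_iff)

section \<open>Lebesgue measure on C^n and its rotations\<close>

lemma prod_Basis_complex_vec: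
  "(\<Prod>b\<in>(Basis::(complex^'n) set). g b) = (\<Prod>i\<in>UNIV. g (axis i 1)) * (\<Prod>i\<in>UNIV. g (axis i \<i>))"
proof -
  have B: "(Basis::(complex^'n) set) = range (\<lambda>i. axis i 1) \<union> range (\<lambda>i. axis i \<i>)"
    by (auto simp: Basis_vec_def Basis_complex_def)
  show ?thesis unfolding B
    by (subst prod.union_disjoint)
       (auto simp: prod.reindex inj_on_def axis_eq_axis o_def)
qed

text \<open>Both measures give a box the product of its side lengths.\<close>

lemma lborel_cvec:
  "(lborel :: (complex^'n) measure) = distr (lborel \<Otimes>\<^sub>M lborel) borel (\<lambda>p. cvec (fst p) (snd p))"
proof (rule lborel_eqI)
  fix l u :: "complex^'n"
  assume le: "\<And>b. b \<in> Basis \<Longrightarrow> l \<bullet> b \<le> u \<bullet> b"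
  have le1: "Re (l $ i) \<le> Re (u $ i)" for i
    using le[of "axis i 1"] by (auto simp: Basis_vec_def inner_axis inner_complex_def Basis_complex_def)
  have le2: "Im (l $ i) \<le> Im (u $ i)" for i
    using le[of "axis i \<i>"] by (auto simp: Basis_vec_def inner_axis inner_complex_def Basis_complex_def)
  have box: "(\<lambda>p. cvec (fst p) (snd p)) -` box l u
     = box (Re_vec l) (Re_vec u) \<times> box (Im_vec l) (Im_vec u)"
    by (auto simp: mem_box Basis_vec_def inner_axis Basis_complex_def inner_complex_def)
  have "emeasure (distr (lborel \<Otimes>\<^sub>M lborel) borel (\<lambda>p. cvec (fst p) (snd p))) (box l u)
     = emeasure lborel (box (Re_vec l) (Re_vec u)) * emeasure lborel (box (Im_vec l) (Im_vec u))"
    by (subst emeasure_distr) (auto simp: box lborel.emeasure_pair_measure_Times space_pair_measure)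
  also have "\<dots> = ennreal (\<Prod>i\<in>UNIV. Re (u $ i) - Re (l $ i)) * ennreal (\<Prod>i\<in>UNIV. Im (u $ i) - Im (l $ i))"
  proof -
    have "emeasure lborel (box a b) = ennreal (\<Prod>i\<in>UNIV. b $ i - a $ i)"
      if "\<And>i. a $ i \<le> b $ i" for a b :: "real^'n"
    proof -
      have "emeasure lborel (box a b) = ennreal (\<Prod>c\<in>Basis. (b - a) \<bullet> c)"
        by (rule emeasure_lborel_box) (use that in \<open>auto simp: Basis_vec_def inner_axis\<close>)
      then show ?thesis by (simp add: prod_Basis_real_vec inner_axis)
    qed
    then show ?thesis using le1 le2 by simp
  qed
  also have "\<dots> = ennreal (\<Prod>b\<in>Basis. (u - l) \<bullet> b)"
    using le1 le2 by (simp add: prod_Basis_complex_vec inner_axis inner_complex_def ennreal_mult'[symmetric] prod_nonneg)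
  finally show "emeasure (distr (lborel \<Otimes>\<^sub>M lborel) borel (\<lambda>p. cvec (fst p) (snd p))) (box l u)
     = ennreal (\<Prod>b\<in>Basis. (u - l) \<bullet> b)" .
qed simp

lemma nn_integral_cvec:
  fixes f :: "complex^'n \<Rightarrow> ennreal"
  assumes [measurable]: "f \<in> borel_measurable borel"
  shows "(\<integral>\<^sup>+z. f z \<partial>lborel) = (\<integral>\<^sup>+x. \<integral>\<^sup>+y. f (cvec x y) \<partial>lborel \<partial>lborel)"
  by (subst lborel_cvec) (simp add: nn_integral_distr lborel.nn_integral_fst[symmetric])

lemma distr_shear:
  fixes a :: real
  shows "distr (lborel \<Otimes>\<^sub>M lborel) (lborel \<Otimes>\<^sub>M lborel) (\<lambda>p::(real^'n) \<times> (real^'n). (fst p + a *\<^sub>R snd p, snd p))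
     = lborel \<Otimes>\<^sub>M lborel" (is "?D = _")
proof (rule measure_eqI)
  fix A assume "A \<in> sets ?D"
  then have A: "A \<in> sets (lborel \<Otimes>\<^sub>M lborel)" by simp
  then have [measurable]: "A \<in> sets (borel \<Otimes>\<^sub>M borel)"
    using sets_pair_measure_cong[OF sets_lborel sets_lborel] by blast
  have "emeasure ?D A = (\<integral>\<^sup>+p. indicator A p \<partial>?D)"
    by (rule nn_integral_indicator[symmetric]) simp
  also have "\<dots> = (\<integral>\<^sup>+y. \<integral>\<^sup>+x. indicator A (x + a *\<^sub>R y, y) \<partial>lborel \<partial>lborel)"
    by (subst nn_integral_distr) (simp_all add: lborel_pair.nn_integral_snd[symmetric])
  also have "\<dots> = (\<integral>\<^sup>+y. \<integral>\<^sup>+x. indicator A (x, y) \<partial>lborel \<partial>lborel)"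
  proof (rule nn_integral_cong)
    fix y :: "real^'n"
    show "(\<integral>\<^sup>+x. indicator A (x + a *\<^sub>R y, y) \<partial>lborel) = (\<integral>\<^sup>+x. indicator A (x, y) \<partial>lborel)"
      by (subst lborel_distr_plus[of "a *\<^sub>R y", symmetric])
         (simp add: nn_integral_distr add.commute)
  qed
  also have "\<dots> = emeasure (lborel \<Otimes>\<^sub>M lborel) A"
    by (subst lborel_pair.nn_integral_snd) (use A in auto)
  finally show "emeasure ?D A = emeasure (lborel \<Otimes>\<^sub>M lborel) A" .
qed simp

lemma distr_shear_snd:
  fixes a :: real
  shows "distr (lborel \<Otimes>\<^sub>M lborel) (lborel \<Otimes>\<^sub>M lborel) (\<lambda>p::(real^'n) \<times> (real^'n). (fst p, snd p + a *\<^sub>R fst p))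
     = lborel \<Otimes>\<^sub>M lborel"
proof -
  let ?P = "lborel \<Otimes>\<^sub>M lborel :: ((real^'n) \<times> (real^'n)) measure"
  define sw where "sw p = (snd p, fst p)" for p :: "(real^'n) \<times> (real^'n)"
  define S where "S p = (fst p + a *\<^sub>R snd p, snd p)" for p :: "(real^'n) \<times> (real^'n)"
  have [measurable]: "sw \<in> ?P \<rightarrow>\<^sub>M ?P" "S \<in> ?P \<rightarrow>\<^sub>M ?P"
    unfolding sw_def[abs_def] S_def[abs_def] by simp_all
  have sw: "distr ?P ?P sw = ?P"
    using lborel_pair.distr_pair_swap[where ?'a="real^'n" and ?'b="real^'n"]
    unfolding sw_def[abs_def] case_prod_beta' by (rule sym)
  have S: "distr ?P ?P S = ?P"
    unfolding S_def[abs_def] by (rule distr_shear)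
  have "distr ?P ?P (\<lambda>p. (fst p, snd p + a *\<^sub>R fst p)) = distr (distr (distr ?P ?P sw) ?P S) ?P sw"
    by (simp add: distr_distr o_def) (simp add: sw_def S_def)
  then show ?thesis by (simp add: sw S)
qed

text \<open>A plane rotation that does not reverse direction is a product of three shears, and shears preserve Lebesgue
  measure by translation invariance and Fubini.\<close>

lemma distr_rotation_shears:
  assumes c: "cos (\<theta> / 2) \<noteq> 0"
  shows "distr lborel borel (\<lambda>z. cis \<theta> *s z) = (lborel :: (complex^'n) measure)"
proof -
  define t where "t = tan (\<theta> / 2)"
  define S1 where "S1 p = (fst p + (-t) *\<^sub>R snd p, snd p)" for p :: "(real^'n) \<times> (real^'n)"
  define S2 where "S2 p = (fst p, snd p + sin \<theta> *\<^sub>R fst p)" for p :: "(real^'n) \<times> (real^'n)"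
  define cv where "cv p = cvec (fst p) (snd p)" for p :: "(real^'n) \<times> (real^'n)"
  let ?P = "lborel \<Otimes>\<^sub>M lborel :: ((real^'n) \<times> (real^'n)) measure"
  have [measurable]: "S1 \<in> ?P \<rightarrow>\<^sub>M ?P" "S2 \<in> ?P \<rightarrow>\<^sub>M ?P" "cv \<in> ?P \<rightarrow>\<^sub>M borel"
    unfolding S1_def[abs_def] S2_def[abs_def] cv_def[abs_def] by simp_all
  have inv: "distr ?P ?P S1 = ?P" "distr ?P ?P S2 = ?P"
    using distr_shear[of "-t"] distr_shear_snd[of "sin \<theta>"]
    unfolding S1_def[abs_def] S2_def[abs_def] by simp_all
  have cb: "lborel = distr ?P borel cv"
    unfolding cv_def[abs_def] by (rule lborel_cvec)
  have sn: "sin \<theta> = 2 * sin (\<theta>/2) * cos (\<theta>/2)" and cs: "cos \<theta> = 1 - 2 * (sin (\<theta>/2))\<^sup>2"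
    using sin_double[of "\<theta>/2"] cos_double_sin[of "\<theta>/2"] by simp_all
  have st: "sin \<theta> * t = 2 * (sin (\<theta>/2))\<^sup>2"
    using c by (simp add: t_def tan_def sn power2_eq_square)
  have e1: "1 - t * sin \<theta> = cos \<theta>" using st by (simp add: cs mult.commute)
  have "t * (1 + cos \<theta>) = sin \<theta>"
  proof -
    have "1 + cos \<theta> = 2 * (cos (\<theta>/2))\<^sup>2" using cos_double_cos[of "\<theta>/2"] by simp
    then show ?thesis using c by (simp add: t_def tan_def sn power2_eq_square)
  qed
  then have e2: "t + t * cos \<theta> = sin \<theta>" by (simp add: algebra_simps)
  \<comment> \<open>Two shears in the first coordinate with parameter \<open>- tan (\<theta> / 2)\<close> around one in the second
    coordinate with parameter \<open>sin \<theta>\<close>.\<close>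
  have rot: "cis \<theta> *s cv p = cv (S1 (S2 (S1 p)))" for p
  proof -
    have "cis \<theta> * Complex x y = Complex (x - t * y - t * (y + sin \<theta> * (x - t * y))) (y + sin \<theta> * (x - t * y))" for x y
    proof -
      have "x - t * y - t * (y + sin \<theta> * (x - t * y)) = x * (1 - t * sin \<theta>) - y * (t + t * (1 - t * sin \<theta>))"
        by (simp add: algebra_simps)
      moreover have "y + sin \<theta> * (x - t * y) = sin \<theta> * x + (1 - t * sin \<theta>) * y"
        by (simp add: algebra_simps)
      ultimately show ?thesis by (simp add: e1 e2 complex_eq_iff)
    qed
    then show ?thesis by (simp add: vec_eq_iff cv_def S1_def S2_def)
  qed
  have "distr lborel borel (\<lambda>z. cis \<theta> *s z) = distr (distr ?P borel cv) borel (\<lambda>z. cis \<theta> *s z)"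
    by (subst cb) simp
  also have "\<dots> = distr ?P borel (\<lambda>p. cis \<theta> *s cv p)"
    by (subst distr_distr) (simp_all add: o_def)
  also have "\<dots> = distr ?P borel (\<lambda>p. cv (S1 (S2 (S1 p))))"
    by (simp add: rot)
  also have "\<dots> = distr (distr ?P ?P S1) borel (\<lambda>p. cv (S1 (S2 p)))"
    by (subst distr_distr) (simp_all add: o_def)
  also have "\<dots> = distr (distr ?P ?P S2) borel (\<lambda>p. cv (S1 p))"
    by (subst distr_distr) (simp_all add: o_def inv)
  also have "\<dots> = distr (distr ?P ?P S1) borel cv"
    by (subst distr_distr) (simp_all add: o_def inv)
  also have "\<dots> = lborel" by (simp add: inv cb[symmetric])
  finally show ?thesis .
qed

lemma distr_rotation:
  "distr lborel borel (\<lambda>z. cis \<theta> *s z) = (lborel :: (complex^'n) measure)"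
proof (cases "cos (\<theta> / 2) = 0")
  case True
  have "cos (\<theta> / 2 / 2) \<noteq> 0"
    using True cos_double_cos[of "\<theta>/2/2"] by auto
  then have *: "distr lborel borel (\<lambda>z. cis (\<theta>/2) *s z) = (lborel :: (complex^'n) measure)"
    by (rule distr_rotation_shears)
  have "distr lborel borel (\<lambda>z. cis \<theta> *s z) = distr (distr lborel borel (\<lambda>z. cis (\<theta>/2) *s z)) borel (\<lambda>z::complex^'n. cis (\<theta>/2) *s z)"
    by (subst distr_distr) (simp_all add: o_def vec_eq_iff mult.assoc[symmetric] cis_mult)
  then show ?thesis by (simp add: *)
qed (rule distr_rotation_shears)

section \<open>The Gaussian measure\<close>

definition fock_density :: "complex^'n \<Rightarrow> real" where
  "fock_density z = (2 * pi) powr (- real CARD('n)) * exp (- (norm z)\<^sup>2 / 2)"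

text \<open>The Gaussian measure on Borel sets, of which \<open>fock_measure\<close> is the completion.\<close>

definition fock_borel :: "(complex^'n) measure" where
  "fock_borel = density lborel (\<lambda>z. ennreal (fock_density z))"

lemma fock_density_pos: "fock_density z > 0" by (simp add: fock_density_def)

lemma fock_density_nonneg [simp]: "fock_density z \<ge> 0" by (simp add: fock_density_def)

lemma borel_measurable_fock_density [measurable]: "fock_density \<in> borel_measurable borel"
  unfolding fock_density_def[abs_def] by simp

lemma sets_fock_borel [simp, measurable_cong]: "sets fock_borel = sets borel"
  by (simp add: fock_borel_def)

lemma space_fock_borel [simp]: "space fock_borel = UNIV"
  by (simp add: fock_borel_def)

lemma fock_measure_eq: "fock_measure = completion fock_borel"
  unfolding fock_measure_def fock_borel_def
  by (subst completion_density_eq) (auto simp: fock_density_pos fock_density_def)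

lemma nn_integral_fock_borel:
  assumes [measurable]: "f \<in> borel_measurable borel"
  shows "(\<integral>\<^sup>+z. f z \<partial>fock_borel) = (\<integral>\<^sup>+z. ennreal (fock_density z) * f z \<partial>lborel)"
  unfolding fock_borel_def by (subst nn_integral_density) auto

lemma nn_integral_gaussian_complex:
  fixes b d :: "real^'n"
  assumes a: "a > 0" and c: "c > 0"
  shows "(\<integral>\<^sup>+z. ennreal (exp (- (a * (norm (Re_vec z))\<^sup>2) + b \<bullet> Re_vec z)
              * exp (- (c * (norm (Im_vec z))\<^sup>2) + d \<bullet> Im_vec z)) \<partial>lborel)
     = ennreal ((pi / a) powr (real CARD('n) / 2) * exp ((norm b)\<^sup>2 / (4 * a))
         * ((pi / c) powr (real CARD('n) / 2) * exp ((norm d)\<^sup>2 / (4 * c))))"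
proof -
  have "(\<integral>\<^sup>+z. ennreal (exp (- (a * (norm (Re_vec z))\<^sup>2) + b \<bullet> Re_vec z)
              * exp (- (c * (norm (Im_vec z))\<^sup>2) + d \<bullet> Im_vec z)) \<partial>lborel)
    = (\<integral>\<^sup>+x. ennreal (exp (- (a * (norm x)\<^sup>2) + b \<bullet> x)) *
        (\<integral>\<^sup>+y. ennreal (exp (- (c * (norm y)\<^sup>2) + d \<bullet> y)) \<partial>lborel) \<partial>lborel)"
    by (subst nn_integral_cvec)
       (simp_all add: ennreal_mult' nn_integral_cmult del: add_uminus_conv_diff uminus_add_conv_diff)
  also have "\<dots> = ennreal ((pi / a) powr (real CARD('n) / 2) * exp ((norm b)\<^sup>2 / (4 * a)))
         * ennreal ((pi / c) powr (real CARD('n) / 2) * exp ((norm d)\<^sup>2 / (4 * c)))"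
    unfolding nn_integral_gaussian[OF c]
    by (subst nn_integral_multc) (simp_all only: nn_integral_gaussian[OF a], simp)
  finally show ?thesis by (simp add: ennreal_mult'[symmetric])
qed

lemma emeasure_fock_borel: "emeasure (fock_borel :: (complex^'n) measure) UNIV = 1"
proof -
  let ?n = "real CARD('n)"
  have "emeasure (fock_borel :: (complex^'n) measure) UNIV = (\<integral>\<^sup>+z. ennreal (fock_density (z::complex^'n)) \<partial>lborel)"
    using nn_integral_fock_borel[of "\<lambda>z::complex^'n. 1"] by simp
  also have "\<dots> = (\<integral>\<^sup>+(z::complex^'n). ennreal ((2 * pi) powr (- ?n)) *
      ennreal (exp (- ((1/2) * (norm (Re_vec z))\<^sup>2) + 0 \<bullet> Re_vec z)
              * exp (- ((1/2) * (norm (Im_vec z))\<^sup>2) + 0 \<bullet> Im_vec z)) \<partial>lborel)"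
  proof (intro nn_integral_cong)
    fix z :: "complex^'n"
    have "exp (- (norm z)\<^sup>2 / 2) = exp (- ((1/2) * (norm (Re_vec z))\<^sup>2) + 0 \<bullet> Re_vec z)
              * exp (- ((1/2) * (norm (Im_vec z))\<^sup>2) + 0 \<bullet> Im_vec z)"
      unfolding exp_add[symmetric] norm_complex_vec
      by (rule arg_cong[where f=exp]) (simp add: field_simps)
    then show "ennreal (fock_density z) = ennreal ((2 * pi) powr (- ?n)) *
      ennreal (exp (- ((1/2) * (norm (Re_vec z))\<^sup>2) + 0 \<bullet> Re_vec z)
              * exp (- ((1/2) * (norm (Im_vec z))\<^sup>2) + 0 \<bullet> Im_vec z))"
      by (simp only: fock_density_def ennreal_mult'[symmetric] powr_ge_zero)
  qed
  also have "\<dots> = ennreal ((2 * pi) powr (- ?n) * ((2 * pi) powr (?n / 2) * (2 * pi) powr (?n / 2)))"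
    by (subst nn_integral_cmult, simp, subst nn_integral_gaussian_complex)
       (simp_all add: ennreal_mult'[symmetric] mult.commute)
  also have "(2 * pi) powr (- ?n) * ((2 * pi) powr (?n / 2) * (2 * pi) powr (?n / 2)) = 1"
    by (simp add: powr_add[symmetric])
  finally show ?thesis by simp
qed

interpretation fock_borel: prob_space fock_borel
  by standard (simp add: emeasure_fock_borel)

section \<open>The Bargmann kernel\<close>

text \<open>\<open>bargmann f z\<close> is the integral of \<open>f u * kern z u\<close>.\<close>

definition kern :: "complex^'n \<Rightarrow> real^'n \<Rightarrow> complex" where
  "kern z u = of_real (pi powr (- real CARD('n) / 4)) * exp (- cdot z z / 4) *
     of_real (exp (- (norm u)\<^sup>2 / 2)) * exp (cdot (of_real_vec u) z)"

lemma borel_measurable_kern [measurable (raw)]: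
  assumes [measurable]: "f \<in> borel_measurable M" "g \<in> borel_measurable M"
  shows "(\<lambda>x. kern (f x) (g x)) \<in> borel_measurable M"
  unfolding kern_def by measurable

lemma bargmann_kern: "bargmann f z = (LINT u|lebesgue. f u * kern z u)"
  unfolding bargmann_def kern_def by (subst integral_mult_right_zero[symmetric]) (simp add: mult_ac)

lemma bargmann_borel:
  assumes [measurable]: "f \<in> borel_measurable borel"
  shows "bargmann f z = (LINT u|lborel. f u * kern z u)"
  unfolding bargmann_kern by (rule integral_completion) simp

lemma cnj_kern: "cnj (kern z u) = kern (cnj_vec z) u"
  by (simp add: kern_def exp_cnj cnj_cdot)

lemma norm_kern: "norm (kern z u) = pi powr (- real CARD('n) / 4) *
    exp (- ((norm (Re_vec z))\<^sup>2 - (norm (Im_vec z))\<^sup>2) / 4 - (norm u)\<^sup>2 / 2 + u \<bullet> Re_vec z)"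
  for z :: "complex^'n"
proof -
  have r: "Re (- cdot z z / 4) = - Re (cdot z z) / 4" "Re (cdot (of_real_vec u) z) = u \<bullet> Re_vec z"
    by (simp_all add: Re_divide Re_cdot[of "of_real_vec u"])
  have "norm (kern z u) = pi powr (- real CARD('n) / 4) *
     (exp (- Re (cdot z z) / 4) * exp (- (norm u)\<^sup>2 / 2) * exp (u \<bullet> Re_vec z))"
    unfolding kern_def norm_mult norm_exp_eq_Re r by simp
  moreover have "- Re (cdot z z) / 4 + - (norm u)\<^sup>2 / 2 + u \<bullet> Re_vec z
     = - ((norm (Re_vec z))\<^sup>2 - (norm (Im_vec z))\<^sup>2) / 4 - (norm u)\<^sup>2 / 2 + u \<bullet> Re_vec z"
    by (simp add: Re_cdot power2_norm_eq_inner)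
  ultimately show ?thesis
    unfolding exp_add[symmetric] by simp
qed

text \<open>With \<open>cnj_vec w\<close> for \<open>w\<close>, the right-hand side is the reproducing kernel of the
  Fock space at \<open>(z, w)\<close>.\<close>

lemma has_bochner_integral_kern_kern:
  "has_bochner_integral lborel (\<lambda>u. kern z u * kern w u) (exp (cdot z w / 2))"
  for z w :: "complex^'n"
proof -
  let ?c = "complex_of_real (pi powr (- real CARD('n) / 2)) * exp (- (cdot z z + cdot w w) / 4)"
  have c: "pi powr (- real CARD('n) / 4) * pi powr (- real CARD('n) / 4) = pi powr (- real CARD('n) / 2)"
    by (simp add: powr_add[symmetric])
  have "kern z u * kern w u = ?c * exp (- of_real (1 * (norm u)\<^sup>2) + cdot (of_real_vec u) (z + w))" for u
  proof -
    have "kern z u * kern w u = of_real (pi powr (- real CARD('n) / 4) * pi powr (- real CARD('n) / 4)) *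
       (exp (- cdot z z / 4) * exp (- cdot w w / 4)) * (exp (- of_real ((norm u)\<^sup>2) / 2) * exp (- of_real ((norm u)\<^sup>2) / 2)
         * exp (cdot (of_real_vec u) z) * exp (cdot (of_real_vec u) w))"
      unfolding kern_def of_real_mult by (simp add: mult_ac exp_of_real[symmetric] del: exp_of_real)
    also have "\<dots> = ?c * exp (- of_real (1 * (norm u)\<^sup>2) + cdot (of_real_vec u) (z + w))"
      unfolding c mult.assoc exp_add[symmetric]
      by (intro arg_cong2[where f="(*)"] arg_cong[where f=exp] refl) (simp add: cdot_add_right field_simps)
    finally show ?thesis .
  qed
  moreover have "?c * (of_real ((pi / 1) powr (real CARD('n) / 2)) * exp (cdot (z + w) (z + w) / of_real (4 * 1)))
     = exp (cdot z w / 2)"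
  proof -
    have "cdot (z + w) (z + w) = cdot z z + cdot w w + 2 * cdot z w"
      by (simp add: cdot_add_left cdot_add_right cdot_commute)
    then have e: "exp (- (cdot z z + cdot w w) / 4) * exp (cdot (z + w) (z + w) / of_real (4 * 1)) = exp (cdot z w / 2)"
      by (simp add: exp_add[symmetric] field_simps)
    have p: "pi powr (- real CARD('n) / 2) * (pi / 1) powr (real CARD('n) / 2) = 1"
      by (simp add: powr_add[symmetric])
    have "?c * (of_real ((pi / 1) powr (real CARD('n) / 2)) * exp (cdot (z + w) (z + w) / of_real (4 * 1)))
      = of_real (pi powr (- real CARD('n) / 2) * (pi / 1) powr (real CARD('n) / 2)) *
       (exp (- (cdot z z + cdot w w) / 4) * exp (cdot (z + w) (z + w) / of_real (4 * 1)))"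
      unfolding of_real_mult by (simp only: mult_ac)
    also have "\<dots> = exp (cdot z w / 2)" unfolding p e by simp
    finally show ?thesis .
  qed
  ultimately show ?thesis
    using has_bochner_integral_mult_right[OF has_bochner_integral_gaussian[of 1 "z + w"], of ?c] by simp
qed

lemma sqint_kern: "sqint lborel (kern z)"
proof -
  have "has_bochner_integral lborel (\<lambda>u. complex_of_real ((norm (kern z u))\<^sup>2)) (exp (cdot z (cnj_vec z) / 2))"
    using has_bochner_integral_kern_kern[of z "cnj_vec z"]
    by (simp only: complex_norm_square cnj_kern[symmetric])
  from has_bochner_integral_bounded_linear[OF bounded_linear_Re this]
  have "integrable lborel (\<lambda>u. (norm (kern z u))\<^sup>2)" by (simp add: has_bochner_integral_iff)
  then show ?thesis by (simp add: sqint_def)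
qed

lemma bargmann_cnj_kern: "bargmann (\<lambda>u. cnj (kern z u)) w = exp (cdot w (cnj_vec z) / 2)"
  using has_bochner_integral_kern_kern[of w "cnj_vec z"]
  by (subst bargmann_borel) (simp_all add: cnj_kern mult.commute has_bochner_integral_iff)

lemma borel_measurable_bargmann [measurable]:
  assumes "sqint lborel h"
  shows "bargmann h \<in> borel_measurable borel"
proof -
  have [measurable]: "h \<in> borel_measurable borel" using sqint_measurable[OF assms] by simp
  have "bargmann h = (\<lambda>z. LINT u|lborel. h u * kern z u)"
    by (rule ext) (rule bargmann_borel, simp)
  then show ?thesis by simp
qed

section \<open>The adjoint of the Bargmann transform on bounded functions\<close>

text \<open>The reproducing kernel of the Fock space.\<close>

abbreviation rkern :: "complex^'n \<Rightarrow> complex^'n \<Rightarrow> complex" where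
  "rkern z w \<equiv> exp (cdot z (cnj_vec w) / 2)"

text \<open>The formal adjoint of the Bargmann transform; for bounded \<open>G\<close> the integral converges
  absolutely.\<close>

definition synth :: "(complex^'n \<Rightarrow> complex) \<Rightarrow> real^'n \<Rightarrow> complex" where
  "synth G u = (LINT w|fock_borel. G w * cnj (kern w u))"

text \<open>For bounded \<open>G\<close> this makes \<open>synth G\<close> decay like a Gaussian, which justifies the
  exchanges of integrals below. The exponent is \<open>- 1/2 + 1/3\<close>: the first term stems from
  \<open>kern\<close>, the second from the Gaussian integral over the real part of \<open>w\<close>.\<close>

lemma nn_integral_norm_kern:
  "\<exists>K\<ge>0. \<forall>u. (\<integral>\<^sup>+w. ennreal (norm (kern (w::complex^'n) u)) \<partial>fock_borel) = ennreal (K * exp (- (1/6) * (norm u)\<^sup>2))"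
proof -
  let ?n = "real CARD('n)"
  define C where "C = (2 * pi) powr (- ?n) * pi powr (- ?n / 4)"
  let ?K = "C * ((pi / (3/4)) powr (?n / 2) * (pi / (1/4)) powr (?n / 2))"
  have "?K \<ge> 0" by (simp add: C_def)
  moreover
  have "(\<integral>\<^sup>+w. ennreal (norm (kern (w::complex^'n) u)) \<partial>fock_borel) = ennreal (?K * exp (- (1/6) * (norm u)\<^sup>2))"
    for u :: "real^'n"
  proof -
  have "(\<integral>\<^sup>+w. ennreal (norm (kern (w::complex^'n) u)) \<partial>fock_borel)
     = (\<integral>\<^sup>+w. ennreal (fock_density w) * ennreal (norm (kern (w::complex^'n) u)) \<partial>lborel)"
    by (rule nn_integral_fock_borel) simp
  also have "\<dots> = (\<integral>\<^sup>+(w::complex^'n). ennreal (C * exp (- (norm u)\<^sup>2 / 2)) *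
      ennreal (exp (- ((3/4) * (norm (Re_vec w))\<^sup>2) + u \<bullet> Re_vec w)
              * exp (- ((1/4) * (norm (Im_vec w))\<^sup>2) + 0 \<bullet> Im_vec w)) \<partial>lborel)"
    (is "_ = nn_integral _ ?g")
  proof (rule nn_integral_cong)
    fix w :: "complex^'n"
    have "exp (- (norm w)\<^sup>2 / 2) * exp (- ((norm (Re_vec w))\<^sup>2 - (norm (Im_vec w))\<^sup>2) / 4 - (norm u)\<^sup>2 / 2 + u \<bullet> Re_vec w)
      = exp (- (norm u)\<^sup>2 / 2) * (exp (- ((3/4) * (norm (Re_vec w))\<^sup>2) + u \<bullet> Re_vec w)
              * exp (- ((1/4) * (norm (Im_vec w))\<^sup>2) + 0 \<bullet> Im_vec w))"
      unfolding exp_add[symmetric] norm_complex_vec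
      by (rule arg_cong[where f=exp]) (simp add: field_simps)
    then have "fock_density w * norm (kern w u) = C * exp (- (norm u)\<^sup>2 / 2) *
      (exp (- ((3/4) * (norm (Re_vec w))\<^sup>2) + u \<bullet> Re_vec w)
              * exp (- ((1/4) * (norm (Im_vec w))\<^sup>2) + 0 \<bullet> Im_vec w))"
      unfolding fock_density_def norm_kern C_def by (simp only: mult_ac)
    then show "ennreal (fock_density w) * ennreal (norm (kern w u)) = ?g w"
      by (simp add: ennreal_mult'[symmetric] C_def)
  qed
  also have "\<dots> = ennreal (C * exp (- (norm u)\<^sup>2 / 2)) *
      ennreal ((pi / (3/4)) powr (?n / 2) * exp ((norm u)\<^sup>2 / (4 * (3/4)))
         * ((pi / (1/4)) powr (?n / 2) * exp ((norm (0::real^'n))\<^sup>2 / (4 * (1/4)))))"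
    by (subst nn_integral_cmult, simp, subst nn_integral_gaussian_complex) auto
  also have "\<dots> = ennreal (?K * (exp (- (norm u)\<^sup>2 / 2) * exp ((norm u)\<^sup>2 / (4 * (3/4)))))"
    by (subst ennreal_mult'[symmetric]) (simp_all add: C_def mult_ac)
  also have "exp (- (norm u)\<^sup>2 / 2) * exp ((norm u)\<^sup>2 / (4 * (3/4))) = exp (- (1/6) * (norm u)\<^sup>2)"
    unfolding exp_add[symmetric] by (rule arg_cong[where f=exp]) (simp add: field_simps)
  finally show ?thesis .
  qed
  ultimately show ?thesis by blast
qed

lemma sqint_gaussian:
  assumes "a > 0"
  shows "sqint lborel (\<lambda>u::real^'n. complex_of_real (C * exp (- a * (norm u)\<^sup>2)))"
proof -
  have "integrable lborel (\<lambda>u::real^'n. C\<^sup>2 * exp (- (2 * a * (norm u)\<^sup>2) + 0 \<bullet> u))"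
    using has_bochner_integral_gaussian_real[of "2 * a" "0::real^'n"] assms
    by (auto simp: has_bochner_integral_iff)
  then show ?thesis
    by (simp add: sqint_def norm_mult power_mult_distrib exp_double[symmetric] mult.assoc del: of_real_mult)
qed

lemma synth_kern_bound:
  fixes G :: "complex^'n \<Rightarrow> complex"
  assumes G[measurable]: "G \<in> borel_measurable borel" and M: "\<And>w. norm (G w) \<le> M"
  shows "\<exists>K\<ge>0. \<forall>u. (\<integral>\<^sup>+w. ennreal (norm (G w * cnj (kern w u))) \<partial>fock_borel) \<le> ennreal (K * exp (- (1/6) * (norm u)\<^sup>2))"
proof -
  obtain K where K: "K \<ge> 0"
    "\<And>u. (\<integral>\<^sup>+w. ennreal (norm (kern (w::complex^'n) u)) \<partial>fock_borel) = ennreal (K * exp (- (1/6) * (norm u)\<^sup>2))"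
    using nn_integral_norm_kern by blast
  have M0: "M \<ge> 0" using M[of 0] norm_ge_zero[of "G 0"] by linarith
  show ?thesis
  proof (intro exI[of _ "M * K"] conjI allI)
    fix u :: "real^'n"
    have "(\<integral>\<^sup>+w. ennreal (norm (G w * cnj (kern w u))) \<partial>fock_borel)
       \<le> (\<integral>\<^sup>+w. ennreal M * ennreal (norm (kern w u)) \<partial>fock_borel)"
      using M M0 by (intro nn_integral_mono) (auto simp: norm_mult ennreal_mult'[symmetric] intro!: ennreal_leI mult_right_mono)
    also have "\<dots> = ennreal M * ennreal (K * exp (- (1/6) * (norm u)\<^sup>2))"
      by (subst nn_integral_cmult) (auto simp: K(2))
    also have "\<dots> = ennreal (M * K * exp (- (1/6) * (norm u)\<^sup>2))"
      using M0 by (simp add: ennreal_mult'[symmetric] mult.assoc)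
    finally show "(\<integral>\<^sup>+w. ennreal (norm (G w * cnj (kern w u))) \<partial>fock_borel) \<le> ennreal (M * K * exp (- (1/6) * (norm u)\<^sup>2))" .
  qed (use K M0 in auto)
qed

lemma synth_integrable:
  fixes G :: "complex^'n \<Rightarrow> complex"
  assumes G[measurable]: "G \<in> borel_measurable borel" and M: "\<And>w. norm (G w) \<le> M"
  shows "integrable fock_borel (\<lambda>w. G w * cnj (kern w u))"
proof -
  obtain K where "K \<ge> 0" and K: "\<And>u. (\<integral>\<^sup>+w. ennreal (norm (G w * cnj (kern w u))) \<partial>fock_borel) \<le> ennreal (K * exp (- (1/6) * (norm u)\<^sup>2))"
    using synth_kern_bound[OF G M] by blast
  show ?thesis
  proof (rule integrableI_bounded)
    show "(\<integral>\<^sup>+w. ennreal (norm (G w * cnj (kern w u))) \<partial>fock_borel) < \<infinity>"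
      using K[of u] by (rule le_less_trans) simp
  qed simp
qed

lemma sqint_synth:
  fixes G :: "complex^'n \<Rightarrow> complex"
  assumes G[measurable]: "G \<in> borel_measurable borel" and M: "\<And>w. norm (G w) \<le> M"
  shows "sqint lborel (synth G)"
proof -
  obtain K where K0: "K \<ge> 0" and K: "\<And>u. (\<integral>\<^sup>+w. ennreal (norm (G w * cnj (kern w u))) \<partial>fock_borel) \<le> ennreal (K * exp (- (1/6) * (norm u)\<^sup>2))"
    using synth_kern_bound[OF G M] by blast
  have m: "synth G \<in> borel_measurable borel"
    unfolding synth_def[abs_def] by (intro fock_borel.borel_measurable_lebesgue_integral) simp
  show ?thesis
  proof (rule sqint_bound[OF sqint_gaussian[of "1/6" K]])
    fix u
    have "ennreal (norm (synth G u)) \<le> ennreal (K * exp (- (1/6) * (norm u)\<^sup>2))"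
      unfolding synth_def
      by (rule order_trans[OF integral_norm_bound_ennreal[OF synth_integrable[OF G M]] K])
    then show "norm (synth G u) \<le> norm (complex_of_real (K * exp (- (1/6) * (norm u)\<^sup>2)))"
      using K0 by (subst (asm) ennreal_le_iff) (auto simp: norm_mult)
  qed (use m in auto)
qed

lemma synth_adjoint:
  fixes G :: "complex^'n \<Rightarrow> complex"
  assumes G[measurable]: "G \<in> borel_measurable borel" and M: "\<And>w. norm (G w) \<le> M"
    and h: "sqint lborel h"
  shows "(LINT w|fock_borel. G w * cnj (bargmann h w)) = (LINT u|lborel. synth G u * cnj (h u))"
proof -
  note [measurable] = sqint_measurable[OF h, simplified]
  obtain K where K0: "K \<ge> 0" and K: "\<And>u. (\<integral>\<^sup>+w. ennreal (norm (G w * cnj (kern w u))) \<partial>fock_borel) \<le> ennreal (K * exp (- (1/6) * (norm u)\<^sup>2))"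
    using synth_kern_bound[OF G M] by blast
  interpret pair_sigma_finite lborel "fock_borel :: (complex^'n) measure" ..
  have int: "integrable (lborel \<Otimes>\<^sub>M fock_borel) (\<lambda>(u, w). G w * cnj (kern w u) * cnj (h u))"
  proof (rule integrableI_bounded)
    have "(\<integral>\<^sup>+p. ennreal (norm (case p of (u, w) \<Rightarrow> G w * cnj (kern w u) * cnj (h u))) \<partial>(lborel \<Otimes>\<^sub>M fock_borel))
       = (\<integral>\<^sup>+u. \<integral>\<^sup>+w. ennreal (norm (G w * cnj (kern w u) * cnj (h u))) \<partial>fock_borel \<partial>lborel)"
      by (subst fock_borel.nn_integral_fst[symmetric]) auto
    also have "\<dots> = (\<integral>\<^sup>+u. (\<integral>\<^sup>+w. ennreal (norm (G w * cnj (kern w u))) \<partial>fock_borel) * ennreal (norm (h u)) \<partial>lborel)"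
      by (intro nn_integral_cong) (simp add: norm_mult ennreal_mult' nn_integral_multc mult.assoc[symmetric])
    also have "\<dots> \<le> (\<integral>\<^sup>+u. ennreal (K * exp (- (1/6) * (norm u)\<^sup>2)) * ennreal (norm (h u)) \<partial>lborel)"
      by (intro nn_integral_mono mult_right_mono K) auto
    also have "\<dots> = (\<integral>\<^sup>+u. ennreal (norm (complex_of_real (K * exp (- (1/6) * (norm u)\<^sup>2)) * h u)) \<partial>lborel)"
      using K0 by (intro nn_integral_cong) (simp add: norm_mult ennreal_mult'[symmetric])
    also have "\<dots> < \<infinity>"
      using sqint_integrable_mult[OF sqint_gaussian[of "1/6" K] h] unfolding integrable_iff_bounded by simp
    finally show "(\<integral>\<^sup>+p. ennreal (norm (case p of (u, w) \<Rightarrow> G w * cnj (kern w u) * cnj (h u))) \<partial>(lborel \<Otimes>\<^sub>M fock_borel)) < \<infinity>" .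
  qed simp
  have "(LINT w|fock_borel. G w * cnj (bargmann h w))
      = (LINT w|fock_borel. LINT u|lborel. G w * cnj (kern w u) * cnj (h u))"
  proof (rule Bochner_Integration.integral_cong[OF refl])
    fix w :: "complex^'n"
    have "G w * cnj (bargmann h w) = G w * (LINT u|lborel. cnj (h u * kern w u))"
      by (subst bargmann_borel, simp) (rule arg_cong[where f="(*) (G w)"], rule Bochner_Integration.integral_cnj[symmetric])
    also have "\<dots> = (LINT u|lborel. G w * cnj (h u * kern w u))"
      by (rule integral_mult_right_zero[symmetric])
    finally show "G w * cnj (bargmann h w) = (LINT u|lborel. G w * cnj (kern w u) * cnj (h u))"
      by (simp only: complex_cnj_mult mult_ac)
  qed
  also have "\<dots> = (LINT u|lborel. LINT w|fock_borel. G w * cnj (kern w u) * cnj (h u))"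
    by (rule Fubini_integral[OF int])
  also have "\<dots> = (LINT u|lborel. synth G u * cnj (h u))"
    unfolding synth_def by simp
  finally show ?thesis .
qed

text \<open>The adjoint relation tested against \<open>cnj (kern z)\<close>, whose Bargmann transform is the
  reproducing kernel.\<close>

lemma bargmann_synth:
  fixes G :: "complex^'n \<Rightarrow> complex"
  assumes G[measurable]: "G \<in> borel_measurable borel" and M: "\<And>w. norm (G w) \<le> M"
  shows "bargmann (synth G) z = (LINT w|fock_borel. G w * rkern z w)"
proof -
  have [measurable]: "synth G \<in> borel_measurable borel"
    using sqint_measurable[OF sqint_synth[OF G M]] by simp
  have "bargmann (synth G) z = (LINT u|lborel. synth G u * cnj (cnj (kern z u)))"
    by (subst bargmann_borel) simp_all
  also have "\<dots> = (LINT w|fock_borel. G w * cnj (bargmann (\<lambda>u. cnj (kern z u)) w))"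
    by (rule synth_adjoint[OF G M sqint_cnj[OF sqint_kern], symmetric])
  also have "\<dots> = (LINT w|fock_borel. G w * rkern z w)"
    by (simp add: bargmann_cnj_kern exp_cnj cnj_cdot cdot_commute)
  finally show ?thesis .
qed

section \<open>Boundedness and the adjoint on L^2\<close>

text \<open>Schur's test for a convolution kernel, with the constant weight: bound \<open>g z * g w\<close> by the
  mean of the squares.\<close>

lemma nn_integral_schur:
  fixes g k :: "'a::euclidean_space \<Rightarrow> ennreal"
  assumes [measurable]: "g \<in> borel_measurable borel" "k \<in> borel_measurable borel"
    and even: "\<And>x. k (- x) = k x"
  shows "(\<integral>\<^sup>+z. \<integral>\<^sup>+w. g z * g w * k (z - w) \<partial>lborel \<partial>lborel) \<le> (\<integral>\<^sup>+t. k t \<partial>lborel) * (\<integral>\<^sup>+z. (g z)\<^sup>2 \<partial>lborel)"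
proof -
  let ?k = "\<integral>\<^sup>+t. k t \<partial>lborel" and ?g = "\<integral>\<^sup>+z. (g z)\<^sup>2 \<partial>lborel"
  have k1: "(\<integral>\<^sup>+w. k (w - z) \<partial>lborel) = ?k" for z
    by (subst lborel_distr_plus[of "- z", symmetric]) (simp add: nn_integral_distr)
  have k2: "(\<integral>\<^sup>+w. k (z - w) \<partial>lborel) = ?k" for z
    using k1[of z] even[of "z - _"] by simp
  have "2 * (\<integral>\<^sup>+z. \<integral>\<^sup>+w. g z * g w * k (z - w) \<partial>lborel \<partial>lborel)
      = (\<integral>\<^sup>+z. \<integral>\<^sup>+w. 2 * g z * g w * k (z - w) \<partial>lborel \<partial>lborel)"
    by (simp add: nn_integral_cmult mult.assoc)
  also have "\<dots> \<le> (\<integral>\<^sup>+z. \<integral>\<^sup>+w. (g z)\<^sup>2 * k (z - w) + (g w)\<^sup>2 * k (z - w) \<partial>lborel \<partial>lborel)"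
    unfolding distrib_right[symmetric]
    by (intro nn_integral_mono mult_right_mono sum_of_squares_ge_ennreal) auto
  also have "\<dots> = (\<integral>\<^sup>+z. \<integral>\<^sup>+w. (g z)\<^sup>2 * k (z - w) \<partial>lborel \<partial>lborel) + (\<integral>\<^sup>+z. \<integral>\<^sup>+w. (g w)\<^sup>2 * k (z - w) \<partial>lborel \<partial>lborel)"
    by (simp add: nn_integral_add)
  also have "(\<integral>\<^sup>+z. \<integral>\<^sup>+w. (g w)\<^sup>2 * k (z - w) \<partial>lborel \<partial>lborel) = (\<integral>\<^sup>+w. \<integral>\<^sup>+z. (g w)\<^sup>2 * k (z - w) \<partial>lborel \<partial>lborel)"
    by (rule lborel_pair.Fubini') simp
  also have "(\<integral>\<^sup>+z. \<integral>\<^sup>+w. (g z)\<^sup>2 * k (z - w) \<partial>lborel \<partial>lborel) + (\<integral>\<^sup>+w. \<integral>\<^sup>+z. (g w)\<^sup>2 * k (z - w) \<partial>lborel \<partial>lborel)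
     = 2 * (?k * ?g)"
    by (simp add: nn_integral_cmult nn_integral_multc k1 k2 mult_2 mult.commute)
  finally show ?thesis by (subst (asm) ennreal_mult_le_mult_iff) auto
qed

text \<open>The two Gaussian densities contribute \<open>- |z|^2/2 - |w|^2/2\<close> to the exponent and the kernel
  contributes \<open>z \<bullet> w / 2\<close>. Half of the densities completes the square to
  \<open>- |z - w|^2/4\<close>, a convolution kernel; the other half turns \<open>G\<close> into a square
  integrable function for Lebesgue measure.\<close>

lemma bergman_kernel_form_bound:
  fixes G :: "complex^'n \<Rightarrow> complex"
  assumes [measurable]: "G \<in> borel_measurable borel"
  shows "(\<integral>\<^sup>+z. \<integral>\<^sup>+w. ennreal (norm (G z * cnj (G w * rkern z w))) \<partial>fock_borel \<partial>fock_borel)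
    \<le> ennreal (2 ^ CARD('n)) * (\<integral>\<^sup>+z. ennreal ((norm (G z))\<^sup>2) \<partial>fock_borel)"
proof -
  define c where "c = (2 * pi) powr (- real CARD('n))"
  have c: "c > 0" by (simp add: c_def)
  define g where "g z = ennreal (norm (G z) * exp (- (norm z)\<^sup>2 / 4))" for z
  define k where "k z = ennreal (exp (- (norm z)\<^sup>2 / 4))" for z :: "complex^'n"
  have [measurable]: "g \<in> borel_measurable borel" "k \<in> borel_measurable borel"
    unfolding g_def[abs_def] k_def[abs_def] by measurable
  have kint: "(\<integral>\<^sup>+t. k t \<partial>lborel) = ennreal ((4 * pi) powr real CARD('n))"
  proof -
    have "k z = ennreal (exp (- ((1/4) * (norm (Re_vec z))\<^sup>2) + 0 \<bullet> Re_vec z)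
              * exp (- ((1/4) * (norm (Im_vec z))\<^sup>2) + 0 \<bullet> Im_vec z))" for z
      unfolding k_def exp_add[symmetric] norm_complex_vec
      by (intro arg_cong[where f=ennreal] arg_cong[where f=exp]) (simp add: field_simps)
    then have "(\<integral>\<^sup>+t. k t \<partial>lborel) = ennreal ((4 * pi) powr (real CARD('n) / 2) * (4 * pi) powr (real CARD('n) / 2))"
      by (simp only:, subst nn_integral_gaussian_complex) (simp_all add: mult.commute)
    then show ?thesis by (simp add: powr_add[symmetric])
  qed
  have e: "ennreal (fock_density z) * (ennreal (fock_density w) *
      ennreal (norm (G z * cnj (G w * rkern z w))))
     = ennreal (c\<^sup>2) * (g z * g w * k (z - w))" for z w
  proof -
    have "exp (- (norm z)\<^sup>2 / 2) * exp (- (norm w)\<^sup>2 / 2) * exp ((z \<bullet> w) / 2)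
       = exp (- (norm z)\<^sup>2 / 4) * exp (- (norm w)\<^sup>2 / 4) * exp (- (norm (z - w))\<^sup>2 / 4)"
      unfolding exp_add[symmetric]
      by (rule arg_cong[where f=exp]) (simp add: power2_norm_eq_inner inner_diff inner_commute field_simps)
    moreover have "norm (G z * cnj (G w * rkern z w))
       = norm (G z) * norm (G w) * exp ((z \<bullet> w) / 2)"
      by (simp add: norm_mult Re_cdot_cnj)
    ultimately have "fock_density z * (fock_density w * norm (G z * cnj (G w * rkern z w)))
      = c\<^sup>2 * ((norm (G z) * exp (- (norm z)\<^sup>2 / 4)) * (norm (G w) * exp (- (norm w)\<^sup>2 / 4)) * exp (- (norm (z - w))\<^sup>2 / 4))"
      unfolding fock_density_def c_def[symmetric] by (simp add: power2_eq_square mult_ac)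
    then show ?thesis
      unfolding g_def k_def by (simp add: ennreal_mult'[symmetric])
  qed
  have "(\<integral>\<^sup>+z. \<integral>\<^sup>+w. ennreal (norm (G z * cnj (G w * rkern z w))) \<partial>fock_borel \<partial>fock_borel)
    = (\<integral>\<^sup>+z. \<integral>\<^sup>+w. ennreal (fock_density z) * (ennreal (fock_density w) *
      ennreal (norm (G z * cnj (G w * rkern z w)))) \<partial>lborel \<partial>lborel)"
    by (simp add: nn_integral_fock_borel nn_integral_cmult)
  also have "\<dots> = ennreal (c\<^sup>2) * (\<integral>\<^sup>+z. \<integral>\<^sup>+w. g z * g w * k (z - w) \<partial>lborel \<partial>lborel)"
    unfolding e by (simp add: nn_integral_cmult)
  also have "\<dots> \<le> ennreal (c\<^sup>2) * (ennreal ((4 * pi) powr real CARD('n)) * (\<integral>\<^sup>+z. (g z)\<^sup>2 \<partial>lborel))"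
    unfolding kint[symmetric] by (intro mult_left_mono nn_integral_schur) (auto simp: k_def)
  also have "\<dots> = ennreal (c * (4 * pi) powr real CARD('n)) * (ennreal c * (\<integral>\<^sup>+z. (g z)\<^sup>2 \<partial>lborel))"
    using c by (simp add: power2_eq_square ennreal_mult mult_ac)
  also have "ennreal c * (\<integral>\<^sup>+z. (g z)\<^sup>2 \<partial>lborel) = (\<integral>\<^sup>+z. ennreal ((norm (G z))\<^sup>2) \<partial>fock_borel)"
    unfolding nn_integral_fock_borel[of "\<lambda>z. ennreal ((norm (G z))\<^sup>2)", simplified]
    by (simp add: nn_integral_cmult[symmetric] g_def fock_density_def c_def ennreal_power
        ennreal_mult'[symmetric] power_mult_distrib exp_double[symmetric] mult_ac)
  also have "c * (4 * pi) powr real CARD('n) = 2 ^ CARD('n)"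
  proof -
    have "(4 * pi) powr real CARD('n) = 2 powr real CARD('n) * (2 * pi) powr real CARD('n)"
      by (simp add: powr_mult[symmetric])
    moreover have "2 powr real CARD('n) = 2 ^ CARD('n)" by (rule powr_realpow) simp
    moreover have "(2 * pi) powr (- real CARD('n)) * (2 * pi) powr real CARD('n) = 1"
      by (simp add: powr_add[symmetric])
    ultimately show ?thesis unfolding c_def by simp
  qed
  finally show ?thesis .
qed

text \<open>The squared norm of \<open>synth G\<close> is the pairing of \<open>G\<close> with
  \<open>bargmann (synth G)\<close>, which is a quadratic form of \<open>G\<close> in the reproducing
  kernel.\<close>

lemma synth_bound:
  fixes G :: "complex^'n \<Rightarrow> complex"
  assumes G[measurable]: "G \<in> borel_measurable borel" and M: "\<And>w. norm (G w) \<le> M"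
  shows "sqnorm lborel (synth G) \<le> 2 ^ CARD('n) * sqnorm fock_borel G"
proof -
  let ?N = "sqnorm lborel (synth G)"
  have s: "sqint lborel (synth G)" by (rule sqint_synth[OF G M])
  have gs: "sqint fock_borel G" unfolding sqint_def
    by (intro conjI fock_borel.integrable_const_bound[where B="M\<^sup>2"] AE_I2) (auto intro!: power_mono M)
  have "complex_of_real ?N = (LINT u|lborel. synth G u * cnj (synth G u))"
    by (simp add: complex_norm_square[symmetric] del: of_real_power)
  also have "\<dots> = (LINT z|fock_borel. G z * cnj (bargmann (synth G) z))"
    by (rule synth_adjoint[OF G M s, symmetric])
  also have "\<dots> = (LINT z|fock_borel. LINT w|fock_borel. G z * cnj (G w * rkern z w))"
    by (simp add: bargmann_synth[OF G M] del: complex_cnj_mult)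
  finally have N: "complex_of_real ?N = (LINT z|fock_borel. LINT w|fock_borel. G z * cnj (G w * rkern z w))" .
  have "ennreal ?N = ennreal (norm (LINT z|fock_borel. LINT w|fock_borel. G z * cnj (G w * rkern z w)))"
    unfolding N[symmetric] by simp
  also have "\<dots> \<le> (\<integral>\<^sup>+z. ennreal (norm (LINT w|fock_borel. G z * cnj (G w * rkern z w))) \<partial>fock_borel)"
    by (rule norm_integral_le_nn_integral)
  also have "\<dots> \<le> (\<integral>\<^sup>+z. \<integral>\<^sup>+w. ennreal (norm (G z * cnj (G w * rkern z w))) \<partial>fock_borel \<partial>fock_borel)"
    by (intro nn_integral_mono norm_integral_le_nn_integral)
  also have "\<dots> \<le> ennreal (2 ^ CARD('n)) * (\<integral>\<^sup>+z. ennreal ((norm (G z))\<^sup>2) \<partial>fock_borel)"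
    by (rule bergman_kernel_form_bound) simp
  also have "\<dots> = ennreal (2 ^ CARD('n) * sqnorm fock_borel G)"
    by (simp add: sqint_nn_integral[OF gs] ennreal_mult'[symmetric])
  finally show ?thesis
    by (subst (asm) ennreal_le_iff) auto
qed

text \<open>Unlike restriction to balls, cutting off large values makes any function bounded.\<close>

definition trunc :: "nat \<Rightarrow> ('a \<Rightarrow> complex) \<Rightarrow> 'a \<Rightarrow> complex" where
  "trunc k F w = (if norm (F w) \<le> real k then F w else 0)"

lemma norm_trunc: "norm (trunc k F w) \<le> real k" "norm (trunc k F w) \<le> norm (F w)"
  by (auto simp: trunc_def)

lemma trunc_tendsto: "(\<lambda>k. trunc k F w) \<longlonglongrightarrow> F w"
proof (rule tendsto_eventually)
  obtain N where N: "norm (F w) \<le> real N" using real_arch_simple by blast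
  show "\<forall>\<^sub>F k in sequentially. trunc k F w = F w"
    using eventually_ge_at_top[of N] by eventually_elim (use N in \<open>auto simp: trunc_def\<close>)
qed

lemma measurable_trunc [measurable]:
  assumes [measurable]: "F \<in> borel_measurable M"
  shows "trunc k F \<in> borel_measurable M"
  unfolding trunc_def[abs_def] by measurable

lemma trunc_L2_tendsto:
  assumes F: "sqint M F"
  shows "(\<lambda>k. LINT w|M. (norm (trunc k F w - F w))\<^sup>2) \<longlonglongrightarrow> 0"
proof -
  note [measurable] = sqint_measurable[OF F]
  have "(\<lambda>k. LINT w|M. (norm (trunc k F w - F w))\<^sup>2) \<longlonglongrightarrow> (LINT w|M. 0)"
  proof (rule integral_dominated_convergence[where w="\<lambda>w. (norm (F w))\<^sup>2"])
    show "AE w in M. (\<lambda>k. (norm (trunc k F w - F w))\<^sup>2) \<longlonglongrightarrow> 0"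
    proof (rule AE_I2)
      fix w
      have "(\<lambda>k. (norm (trunc k F w - F w))\<^sup>2) \<longlonglongrightarrow> (norm (F w - F w))\<^sup>2"
        by (intro tendsto_intros trunc_tendsto)
      then show "(\<lambda>k. (norm (trunc k F w - F w))\<^sup>2) \<longlonglongrightarrow> 0" by simp
    qed
    show "AE w in M. norm ((norm (trunc k F w - F w))\<^sup>2) \<le> (norm (F w))\<^sup>2" for k
      by (auto simp: trunc_def)
  qed (use sqint_integrable[OF F] in simp_all)
  then show ?thesis by simp
qed

lemma sqint_trunc:
  assumes "sqint M F" shows "sqint M (trunc k F)"
  using assms measurable_trunc[OF sqint_measurable[OF assms]] norm_trunc(2) by (rule sqint_bound)

text \<open>Duality with \<open>synth\<close>: for a truncation \<open>G\<close> of \<open>bargmann h\<close> the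
  squared norm \<open>N\<close> of \<open>G\<close> is the pairing of \<open>synth G\<close> with
  \<open>h\<close>, so that \<open>N^2\<close> is at most a constant times \<open>N\<close>.\<close>

lemma sqint_bargmann:
  fixes h :: "real^'n \<Rightarrow> complex"
  assumes h: "sqint lborel h"
  shows "sqint fock_borel (bargmann h)"
proof -
  let ?F = "bargmann h" and ?H = "sqnorm lborel h"
  note [measurable] = sqint_measurable[OF h] borel_measurable_bargmann[OF h]
  have tb: "integrable fock_borel (\<lambda>w. (norm (trunc k ?F w))\<^sup>2)" for k
    by (intro fock_borel.integrable_const_bound[where B="(real k)\<^sup>2"] AE_I2)
       (auto intro!: power_mono norm_trunc)
  have bound: "sqnorm fock_borel (trunc k ?F) \<le> 2 ^ CARD('n) * ?H" for k
  proof -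
    let ?G = "trunc k ?F" and ?N = "sqnorm fock_borel (trunc k ?F)"
    have [measurable]: "?G \<in> borel_measurable borel" by simp
    have s: "sqint lborel (synth ?G)" by (rule sqint_synth[OF _ norm_trunc(1)]) simp
    have "complex_of_real ?N = (LINT w|fock_borel. ?G w * cnj (?F w))"
    proof -
      have "(LINT w|fock_borel. ?G w * cnj (?F w)) = (LINT w|fock_borel. complex_of_real ((norm (?G w))\<^sup>2))"
        by (intro Bochner_Integration.integral_cong) (auto simp: trunc_def complex_norm_square simp del: of_real_power)
      then show ?thesis by (simp only: integral_of_real tb)
    qed
    also have "\<dots> = (LINT u|lborel. synth ?G u * cnj (h u))"
      by (rule synth_adjoint[OF _ norm_trunc(1) h]) simp
    finally have N: "complex_of_real ?N = (LINT u|lborel. synth ?G u * cnj (h u))" .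
    have "?N\<^sup>2 = (norm (LINT u|lborel. synth ?G u * cnj (h u)))\<^sup>2"
      unfolding N[symmetric] by simp
    also have "\<dots> \<le> sqnorm lborel (synth ?G) * sqnorm lborel (\<lambda>u. cnj (h u))"
      by (rule Cauchy_Schwarz_integral[OF s sqint_cnj[OF h]])
    also have "\<dots> \<le> (2 ^ CARD('n) * ?N) * ?H"
      using synth_bound[of ?G "real k"] norm_trunc(1)[of k ?F] by (intro mult_mono) auto
    finally have "?N * ?N \<le> (2 ^ CARD('n) * ?H) * ?N" by (simp add: power2_eq_square mult_ac)
    moreover have "?N \<ge> 0" "?H \<ge> 0" by auto
    ultimately show ?thesis by (cases "?N = 0") (auto simp: mult_le_cancel_right)
  qed
  have "(\<integral>\<^sup>+w. ennreal ((norm (?F w))\<^sup>2) \<partial>fock_borel) = (\<integral>\<^sup>+w. liminf (\<lambda>k. ennreal ((norm (trunc k ?F w))\<^sup>2)) \<partial>fock_borel)"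
  proof (rule nn_integral_cong)
    fix w
    have "(\<lambda>k. ennreal ((norm (trunc k ?F w))\<^sup>2)) \<longlonglongrightarrow> ennreal ((norm (?F w))\<^sup>2)"
      by (intro tendsto_intros trunc_tendsto)
    then show "ennreal ((norm (?F w))\<^sup>2) = liminf (\<lambda>k. ennreal ((norm (trunc k ?F w))\<^sup>2))"
      by (rule lim_imp_Liminf[OF trivial_limit_sequentially, symmetric])
  qed
  also have "\<dots> \<le> liminf (\<lambda>k. \<integral>\<^sup>+w. ennreal ((norm (trunc k ?F w))\<^sup>2) \<partial>fock_borel)"
    by (rule nn_integral_liminf) simp
  also have "\<dots> \<le> ennreal (2 ^ CARD('n) * ?H)"
    by (intro Liminf_le always_eventually allI, simp, subst nn_integral_eq_integral[OF tb])
       (auto intro!: ennreal_leI bound)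
  also have "\<dots> < \<infinity>" by simp
  finally show ?thesis by (intro sqintI_nn) auto
qed

text \<open>The function \<open>f\<close> is the limit in L^2 of \<open>synth\<close> applied to the truncations of
  \<open>G\<close>.\<close>

lemma bargmann_adjoint_exists:
  fixes G :: "complex^'n \<Rightarrow> complex"
  assumes G: "sqint fock_borel G"
  shows "\<exists>f. sqint lborel f \<and> (\<forall>h. sqint lborel h \<longrightarrow>
     (LINT w|fock_borel. G w * cnj (bargmann h w)) = (LINT u|lborel. f u * cnj (h u)))"
proof -
  have [measurable]: "G \<in> borel_measurable borel" using sqint_measurable[OF G] by simp
  define f where "f k = synth (trunc k G)" for k
  have sf: "sqint lborel (f k)" for k
    unfolding f_def by (rule sqint_synth[OF _ norm_trunc(1)]) simp
  have d: "sqnorm lborel (\<lambda>u. f m u - f n u) \<le> 2 ^ CARD('n) *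
     (2 * sqnorm fock_borel (\<lambda>w. trunc m G w - G w) + 2 * sqnorm fock_borel (\<lambda>w. trunc n G w - G w))" for m n
  proof -
    have "f m u - f n u = synth (\<lambda>w. trunc m G w - trunc n G w) u" for u
      unfolding f_def synth_def left_diff_distrib
      by (subst Bochner_Integration.integral_diff)
         (auto intro!: synth_integrable[OF _ norm_trunc(1)])
    then have "sqnorm lborel (\<lambda>u. f m u - f n u) = sqnorm lborel (synth (\<lambda>w. trunc m G w - trunc n G w))"
      by simp
    also have "\<dots> \<le> 2 ^ CARD('n) * sqnorm fock_borel (\<lambda>w. trunc m G w - trunc n G w)"
    proof (rule synth_bound)
      show "norm (trunc m G w - trunc n G w) \<le> real m + real n" for w
        using norm_triangle_ineq4[of "trunc m G w" "trunc n G w"] norm_trunc(1)[of m G w] norm_trunc(1)[of n G w] by linarith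
    qed simp
    also have "\<dots> \<le> 2 ^ CARD('n) * (LINT w|fock_borel. 2 * (norm (trunc m G w - G w))\<^sup>2 + 2 * (norm (trunc n G w - G w))\<^sup>2)"
    proof (intro mult_left_mono integral_mono)
      show "(norm (trunc m G w - trunc n G w))\<^sup>2 \<le> 2 * (norm (trunc m G w - G w))\<^sup>2 + 2 * (norm (trunc n G w - G w))\<^sup>2" for w
        using norm_add_power2_le[of "trunc m G w - G w" "G w - trunc n G w"] by (simp add: norm_minus_commute)
    qed (auto intro!: sqint_integrable sqint_diff sqint_trunc G)
    also have "(LINT w|fock_borel. 2 * (norm (trunc m G w - G w))\<^sup>2 + 2 * (norm (trunc n G w - G w))\<^sup>2)
       = 2 * sqnorm fock_borel (\<lambda>w. trunc m G w - G w) + 2 * sqnorm fock_borel (\<lambda>w. trunc n G w - G w)"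
      by (subst Bochner_Integration.integral_add) (auto intro!: sqint_integrable sqint_diff sqint_trunc G)
    finally show ?thesis .
  qed
  have cauchy: "\<exists>N. \<forall>m\<ge>N. \<forall>n\<ge>N. sqnorm lborel (\<lambda>u. f m u - f n u) < e" if "e > 0" for e
  proof -
    let ?t = "\<lambda>k. sqnorm fock_borel (\<lambda>w. trunc k G w - G w)"
    define b where "b = e / (2 ^ CARD('n) * 4)"
    have "b > 0" using that by (simp add: b_def)
    then obtain N where N: "\<And>k. k \<ge> N \<Longrightarrow> ?t k < b"
      using order_tendstoD(2)[OF trunc_L2_tendsto[OF G]] unfolding eventually_sequentially by blast
    have "sqnorm lborel (\<lambda>u. f m u - f n u) < e" if "m \<ge> N" "n \<ge> N" for m n
    proof -
      have "2 ^ CARD('n) * (2 * ?t m + 2 * ?t n) < 2 ^ CARD('n) * (4 * b)"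
        using N[OF that(1)] N[OF that(2)] by (intro mult_strict_left_mono) auto
      also have "\<dots> = e" by (simp add: b_def)
      finally show ?thesis using d[of m n] by linarith
    qed
    then show ?thesis by blast
  qed
  obtain g where g: "sqint lborel g" "(\<lambda>k. LINT u|lborel. (norm (f k u - g u))\<^sup>2) \<longlonglongrightarrow> 0"
  proof -
    have "\<exists>g. sqint lborel g \<and> (\<lambda>k. LINT u|lborel. (norm (f k u - g u))\<^sup>2) \<longlonglongrightarrow> 0"
      by (rule L2_complete[OF sf]) (rule cauchy)
    then show thesis using that by blast
  qed
  have "(LINT w|fock_borel. G w * cnj (bargmann h w)) = (LINT u|lborel. g u * cnj (h u))" if h: "sqint lborel h" for h
  proof (rule LIMSEQ_unique)
    show "(\<lambda>k. LINT u|lborel. f k u * cnj (h u)) \<longlonglongrightarrow> (LINT u|lborel. g u * cnj (h u))"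
      by (rule tendsto_integral_mult_L2[OF sf g(1) sqint_cnj[OF h] g(2)])
    have "(\<lambda>k. LINT w|fock_borel. trunc k G w * cnj (bargmann h w)) \<longlonglongrightarrow> (LINT w|fock_borel. G w * cnj (bargmann h w))"
      by (rule tendsto_integral_mult_L2[OF sqint_trunc[OF G] G sqint_cnj[OF sqint_bargmann[OF h]] trunc_L2_tendsto[OF G]])
    moreover have "(LINT w|fock_borel. trunc k G w * cnj (bargmann h w)) = (LINT u|lborel. f k u * cnj (h u))" for k
      unfolding f_def by (rule synth_adjoint[OF _ norm_trunc(1) h]) simp
    ultimately show "(\<lambda>k. LINT u|lborel. f k u * cnj (h u)) \<longlonglongrightarrow> (LINT w|fock_borel. G w * cnj (bargmann h w))"
      by simp
  qed
  with g(1) show ?thesis by blast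
qed

section \<open>Bargmann transforms are entire\<close>

lemma norm_of_real_vec [simp]: "norm (of_real_vec u) = norm u"
  by (simp add: norm_vec_def)

lemma norm_cdot_le: "norm (cdot z w) \<le> norm z * norm w"
proof -
  have "norm (cdot z w) \<le> (\<Sum>j\<in>UNIV. \<bar>norm (z $ j)\<bar> * \<bar>norm (w $ j)\<bar>)"
    unfolding cdot_def by (rule sum_norm_le) (simp add: norm_mult)
  also have "\<dots> \<le> norm z * norm w"
    unfolding norm_vec_def by (rule L2_set_mult_ineq)
  finally show ?thesis .
qed

lemma bounded_linear_cdot: "bounded_linear (cdot z)"
proof (rule bounded_linear_intro[where K="norm z"])
  show "norm (cdot z w) \<le> norm w * norm z" for w
    using norm_cdot_le[of z w] by (simp add: mult.commute)
qed (simp_all add: cdot_add_right, simp add: cdot_def scaleR_sum_right)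

lemma has_derivative_cdot_self: "((\<lambda>z. cdot z z) has_derivative (\<lambda>k. 2 * cdot z k)) (at z)"
proof -
  have "((\<lambda>z. cdot z z) has_derivative (\<lambda>k. \<Sum>j\<in>UNIV. z $ j * k $ j + k $ j * z $ j)) (at z)"
    unfolding cdot_def
    by (intro has_derivative_sum has_derivative_mult bounded_linear.has_derivative[OF bounded_linear_vec_nth] has_derivative_ident)
  then show ?thesis by (simp add: cdot_def sum_distrib_left mult_ac)
qed

text \<open>One bound serves for the integrand of the Bargmann transform, for its derivative and for the remainder after
  the linear term.\<close>

lemma gaussian_dominates:
  fixes t R :: real
  assumes "t \<ge> 0"
  shows "(1 + t + t\<^sup>2) * exp (R * t - t\<^sup>2 / 2) \<le> 2 * exp ((R + 1)\<^sup>2) * exp (- (1/4) * t\<^sup>2)"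
proof -
  have "1 + t + t\<^sup>2 / 2 \<le> exp t"
    by (rule exp_lower_Taylor_quadratic[OF assms])
  then have "1 + t + t\<^sup>2 \<le> 2 * exp t" using assms by linarith
  then have "(1 + t + t\<^sup>2) * exp (R * t - t\<^sup>2 / 2) \<le> 2 * exp t * exp (R * t - t\<^sup>2 / 2)"
    by (rule mult_right_mono) simp
  also have "\<dots> = 2 * exp (t + (R * t - t\<^sup>2 / 2))" by (simp add: exp_add)
  also have "\<dots> \<le> 2 * exp ((R + 1)\<^sup>2 + (- (1/4) * t\<^sup>2))"
  proof -
    have "0 \<le> (t / 2 - (R + 1))\<^sup>2" by simp
    then have "t + (R * t - t\<^sup>2 / 2) \<le> (R + 1)\<^sup>2 + (- (1/4) * t\<^sup>2)"
      by (simp add: power2_eq_square field_simps)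
    then show ?thesis by simp
  qed
  finally show ?thesis by (simp only: exp_add mult.assoc)
qed

lemma norm_exp_remainder: "norm (exp (a + b) - exp a - b * exp a) \<le> (norm b)\<^sup>2 * exp (norm a + norm b)" for a b :: complex
proof -
  have "norm (exp b - (\<Sum>k\<le>1. b ^ k / fact k)) \<le> exp \<bar>Re b\<bar> * norm b ^ Suc 1 / fact 1"
    by (rule Taylor_exp)
  then have "norm (exp b - 1 - b) \<le> exp \<bar>Re b\<bar> * (norm b)\<^sup>2"
    by (simp add: power2_eq_square diff_diff_eq)
  also have "\<dots> \<le> exp (norm b) * (norm b)\<^sup>2"
    using abs_Re_le_cmod[of b] by (intro mult_right_mono) auto
  finally have 1: "norm (exp b - 1 - b) \<le> exp (norm b) * (norm b)\<^sup>2" .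
  have 2: "norm (exp a) \<le> exp (norm a)" by (rule norm_exp)
  have "norm (exp (a + b) - exp a - b * exp a) = norm (exp a) * norm (exp b - 1 - b)"
    unfolding norm_mult[symmetric] by (simp add: exp_add algebra_simps)
  also have "\<dots> \<le> exp (norm a) * (exp (norm b) * (norm b)\<^sup>2)"
    by (intro mult_mono 1 2) auto
  finally show ?thesis by (simp add: exp_add mult_ac)
qed

text \<open>Differentiation under the integral sign; the remainder after the linear term is of size \<open>|k|^2\<close>
  with an integrable majorant that is uniform for \<open>|k| \<le> 1\<close>.\<close>

lemma entire_bargmann:
  fixes h :: "real^'n \<Rightarrow> complex"
  assumes h: "sqint lborel h"
  shows "entire (bargmann h)"
proof -
  have [measurable]: "h \<in> borel_measurable borel" using sqint_measurable[OF h] by simp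
  define m where "m u = h u * of_real (exp (- (norm u)\<^sup>2 / 2))" for u
  have [measurable]: "m \<in> borel_measurable borel" unfolding m_def[abs_def] by simp
  \<comment> \<open>the common integrable majorant, up to constants\<close>
  define W where "W u = norm (h u) * exp (- (1/4) * (norm u)\<^sup>2)" for u
  have W: "integrable lborel W"
    using integrable_norm[OF sqint_integrable_mult[OF h sqint_gaussian[of "1/4" 1]]]
    by (simp add: W_def[abs_def] norm_mult)
  have dom: "norm (m u) * (1 + norm u + (norm u)\<^sup>2) * exp (R * norm u) \<le> (2 * exp ((R + 1)\<^sup>2)) * W u" for R u
  proof -
    have "norm (m u) * (1 + norm u + (norm u)\<^sup>2) * exp (R * norm u)
       = norm (h u) * ((1 + norm u + (norm u)\<^sup>2) * exp (R * norm u - (norm u)\<^sup>2 / 2))"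
    proof -
      have "exp (R * norm u - (norm u)\<^sup>2 / 2) = exp (R * norm u) * exp (- (norm u)\<^sup>2 / 2)"
        by (simp add: exp_add[symmetric])
      then show ?thesis by (simp only: m_def norm_mult norm_of_real abs_exp_cancel mult_ac)
    qed
    also have "\<dots> \<le> norm (h u) * (2 * exp ((R + 1)\<^sup>2) * exp (- (1/4) * (norm u)\<^sup>2))"
      by (intro mult_left_mono gaussian_dominates) auto
    finally show ?thesis by (simp add: W_def mult_ac)
  qed
  have domi: "integrable lborel (\<lambda>u. g u :: complex)"
    if [measurable]: "g \<in> borel_measurable borel"
      and g: "\<And>u. norm (g u) \<le> C * (norm (m u) * (1 + norm u + (norm u)\<^sup>2) * exp (R * norm u))" and "C \<ge> 0" for g C R
  proof (rule Bochner_Integration.integrable_bound[OF integrable_mult_right[OF W, of "C * (2 * exp ((R + 1)\<^sup>2))"]])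
    have "norm (g u) \<le> C * (2 * exp ((R + 1)\<^sup>2)) * W u" for u
      using order_trans[OF g[of u] mult_left_mono[OF dom[of u R] \<open>C \<ge> 0\<close>]] by (simp add: mult.assoc)
    then show "AE u in lborel. norm (g u) \<le> norm (C * (2 * exp ((R + 1)\<^sup>2)) * W u)"
      by (intro AE_I2) (metis abs_ge_self order_trans real_norm_def)
  qed simp
  define L where "L z = (LINT u|lborel. m u * exp (cdot (of_real_vec u) z))" for z
  define D where "D z k = (LINT u|lborel. m u * (cdot (of_real_vec u) k * exp (cdot (of_real_vec u) z)))" for z k
  have nexp: "norm (exp (cdot (of_real_vec u) z)) \<le> exp (norm z * norm u)" for u and z :: "complex^'n"
  proof -
    have "norm (exp (cdot (of_real_vec u) z)) \<le> exp (norm (cdot (of_real_vec u) z))" by (rule norm_exp)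
    also have "\<dots> \<le> exp (norm z * norm u)" using norm_cdot_le[of "of_real_vec u" z] by (simp add: mult.commute)
    finally show ?thesis .
  qed
  have Li: "integrable lborel (\<lambda>u. m u * exp (cdot (of_real_vec u) z))" for z
  proof (rule domi[of _ 1 "norm z"])
    fix u
    have "norm (m u) * norm (exp (cdot (of_real_vec u) z)) \<le> (norm (m u) * (1 + norm u + (norm u)\<^sup>2)) * exp (norm z * norm u)"
      by (intro mult_mono nexp) (auto intro!: mult_left_le_imp_le simp: algebra_simps)
    then show "norm (m u * exp (cdot (of_real_vec u) z)) \<le> 1 * (norm (m u) * (1 + norm u + (norm u)\<^sup>2) * exp (norm z * norm u))"
      by (simp add: norm_mult)
  qed auto
  have Dn: "norm (m u * (cdot (of_real_vec u) k * exp (cdot (of_real_vec u) z)))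
      \<le> norm k * (norm (m u) * (1 + norm u + (norm u)\<^sup>2) * exp (norm z * norm u))" for u k z
  proof -
    have "norm (m u) * (norm (cdot (of_real_vec u) k) * norm (exp (cdot (of_real_vec u) z)))
      \<le> norm (m u) * ((norm u * norm k) * exp (norm z * norm u))"
      using norm_cdot_le[of "of_real_vec u" k] by (intro mult_left_mono mult_mono nexp) auto
    also have "\<dots> \<le> norm (m u) * (((1 + norm u + (norm u)\<^sup>2) * norm k) * exp (norm z * norm u))"
      by (intro mult_left_mono mult_right_mono) auto
    finally show ?thesis by (simp add: norm_mult mult_ac)
  qed
  have Di: "integrable lborel (\<lambda>u. m u * (cdot (of_real_vec u) k * exp (cdot (of_real_vec u) z)))" for z k
    by (rule domi[of _ "norm k" "norm z", OF _ Dn]) auto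
  have Dlin: "D z (c *s k) = c * D z k" for z c k
    unfolding D_def by (subst integral_mult_right_zero[symmetric]) (simp add: cdot_scale_right mult_ac)
  have Dbl: "bounded_linear (D z)" for z
  proof (rule bounded_linear_intro[where K="2 * exp ((norm z + 1)\<^sup>2) * integral\<^sup>L lborel W"])
    show "D z (x + y) = D z x + D z y" for x y
      unfolding D_def by (subst Bochner_Integration.integral_add[symmetric, OF Di Di]) (simp add: cdot_add_right algebra_simps)
    show "D z (r *\<^sub>R x) = r *\<^sub>R D z x" for r x
      using Dlin[of z "of_real r" x] by (simp add: scaleR_conv_of_real vec_eq_iff scalar_mult_eq_scaleR[symmetric]
         vector_scalar_mult_def scaleR_vec_def)
    fix k
    have "norm (D z k) \<le> (LINT u|lborel. norm (m u * (cdot (of_real_vec u) k * exp (cdot (of_real_vec u) z))))"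
      unfolding D_def by (rule integral_norm_bound)
    also have "\<dots> \<le> (LINT u|lborel. norm k * ((2 * exp ((norm z + 1)\<^sup>2)) * W u))"
      by (intro integral_mono integrable_norm Di integrable_mult_right W order_trans[OF Dn] mult_left_mono dom) auto
    finally show "norm (D z k) \<le> norm k * (2 * exp ((norm z + 1)\<^sup>2) * integral\<^sup>L lborel W)"
      by simp
  qed
  have Lder: "(L has_derivative D z) (at z)" for z
  proof (rule has_derivativeI_sandwich[of 1])
    let ?C = "2 * exp ((norm z + 1 + 1)\<^sup>2) * integral\<^sup>L lborel W"
    show "((\<lambda>y. ?C * norm (y - z)) \<longlongrightarrow> 0) (at z)"
    proof -
      have "((\<lambda>y. ?C * norm (y - z)) \<longlongrightarrow> ?C * norm (z - z)) (at z)" by (intro tendsto_intros)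
      then show ?thesis by simp
    qed
    fix y assume y: "y \<noteq> z" "dist y z < 1"
    let ?k = "y - z"
    have k1: "norm ?k \<le> 1" using y by (simp add: dist_norm)
    let ?r = "\<lambda>u. m u * (exp (cdot (of_real_vec u) y) - exp (cdot (of_real_vec u) z) - cdot (of_real_vec u) ?k * exp (cdot (of_real_vec u) z))"
    have ri: "L y - L z - D z ?k = integral\<^sup>L lborel ?r" "integrable lborel ?r"
      unfolding L_def D_def right_diff_distrib
      by (simp_all add: Bochner_Integration.integral_diff Li Di)
    have rb: "norm (?r u) \<le> (norm ?k)\<^sup>2 * (norm (m u) * (1 + norm u + (norm u)\<^sup>2) * exp ((norm z + 1) * norm u))" for u
    proof -
      let ?a = "cdot (of_real_vec u) z" and ?b = "cdot (of_real_vec u) ?k"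
      have ab: "cdot (of_real_vec u) y = ?a + ?b" by (simp add: cdot_add_right[symmetric])
      have b: "norm ?b \<le> norm u * norm ?k" using norm_cdot_le[of "of_real_vec u" ?k] by simp
      then have b': "norm ?b \<le> norm u * 1" using k1 by (meson mult_left_mono norm_ge_zero order_trans)
      have a: "norm ?a \<le> norm u * norm z" using norm_cdot_le[of "of_real_vec u" z] by simp
      have "norm (exp (?a + ?b) - exp ?a - ?b * exp ?a) \<le> (norm ?b)\<^sup>2 * exp (norm ?a + norm ?b)"
        by (rule norm_exp_remainder)
      also have "\<dots> \<le> (norm u * norm ?k)\<^sup>2 * exp ((norm z + 1) * norm u)"
        using a b b' by (intro mult_mono power_mono) (auto simp: algebra_simps)
      also have "\<dots> = (norm ?k)\<^sup>2 * ((norm u)\<^sup>2 * exp ((norm z + 1) * norm u))"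
        by (simp add: power_mult_distrib mult_ac)
      also have "\<dots> \<le> (norm ?k)\<^sup>2 * ((1 + norm u + (norm u)\<^sup>2) * exp ((norm z + 1) * norm u))"
        by (intro mult_left_mono mult_right_mono) auto
      finally show ?thesis
        unfolding ab norm_mult using mult_left_mono[OF _ norm_ge_zero[of "m u"]] by (fastforce simp: mult_ac)
    qed
    have "norm (L y - L z - D z ?k) \<le> (LINT u|lborel. norm (?r u))"
      unfolding ri(1) by (rule integral_norm_bound)
    also have "\<dots> \<le> (LINT u|lborel. (norm ?k)\<^sup>2 * ((2 * exp ((norm z + 1 + 1)\<^sup>2)) * W u))"
      by (intro integral_mono integrable_norm ri integrable_mult_right W order_trans[OF rb] mult_left_mono dom) auto
    also have "\<dots> = (norm ?k)\<^sup>2 * ?C" by simp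
    finally show "norm (L y - L z - D z ?k) / norm ?k \<le> ?C * norm ?k"
      using y by (simp add: divide_le_eq power2_eq_square mult_ac)
  qed (use Dbl in auto)
  define c where "c = complex_of_real (pi powr (- real CARD('n) / 4))"
  have eq: "bargmann h = (\<lambda>z. c * exp ((-1/4) * cdot z z) * L z)"
  proof
    fix z
    have "bargmann h z = (LINT u|lborel. h u * kern z u)" by (rule bargmann_borel) simp
    also have "\<dots> = (LINT u|lborel. (c * exp ((-1/4) * cdot z z)) * (m u * exp (cdot (of_real_vec u) z)))"
      by (intro Bochner_Integration.integral_cong refl) (simp add: kern_def m_def c_def mult_ac)
    finally show "bargmann h z = c * exp ((-1/4) * cdot z z) * L z" by (simp add: L_def)
  qed
  show ?thesis unfolding entire_def
  proof
    fix z :: "complex^'n"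
    have 1: "((\<lambda>z. (-1/4) * cdot z z) has_derivative (\<lambda>k. (-1/4) * (2 * cdot z k))) (at z)"
      by (intro has_derivative_mult_right has_derivative_cdot_self)
    have "(exp has_derivative ((*) (exp ((-1/4) * cdot z z)))) (at ((-1/4) * cdot z z))"
      using DERIV_exp[of "(-1/4) * cdot z z"] by (simp only: has_field_derivative_def)
    from has_derivative_compose[OF 1 this]
    have 2: "((\<lambda>z. exp ((-1/4) * cdot z z)) has_derivative (\<lambda>k. exp ((-1/4) * cdot z z) * ((-1/4) * (2 * cdot z k)))) (at z)" .
    have "(bargmann h has_derivative (\<lambda>k. c * exp ((-1/4) * cdot z z) * D z k + c * (exp ((-1/4) * cdot z z) * ((-1/4) * (2 * cdot z k))) * L z)) (at z)"
      unfolding eq by (intro has_derivative_mult has_derivative_mult_right 2 Lder)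
    then show "\<exists>D. (bargmann h has_derivative D) (at z) \<and> (\<forall>c h. D (c *s h) = c * D h)"
      by (intro exI conjI) (auto simp: Dlin cdot_scale_right algebra_simps)
  qed
qed

section \<open>The reproducing formula\<close>

lemma entire_continuous: "entire F \<Longrightarrow> continuous_on UNIV F"
  unfolding entire_def
  by (metis has_derivative_continuous continuous_at_imp_continuous_on)

lemma entire_measurable: "entire F \<Longrightarrow> F \<in> borel_measurable borel"
  by (intro borel_measurable_continuous_onI entire_continuous)

lemma entire_slice_holomorphic:
  assumes "entire F"
  shows "(\<lambda>t. F (t *s v)) holomorphic_on S"
proof (rule holomorphic_on_subset[of _ UNIV])
  show "(\<lambda>t. F (t *s v)) holomorphic_on UNIV"
    unfolding holomorphic_on_def
  proof
    fix t
    obtain D where D: "(F has_derivative D) (at (t *s v))" "\<And>c h. D (c *s h) = c * D h"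
      using assms unfolding entire_def by metis
    have "bounded_linear (\<lambda>t::complex. t *s v)"
    proof (rule bounded_linear_intro[where K="norm v"])
      show "norm (t *s v) \<le> norm t * norm v" for t
        by (simp add: norm_vec_def norm_mult L2_set_right_distrib)
    qed (simp_all add: vec_eq_iff algebra_simps)
    then have "((\<lambda>t. t *s v) has_derivative (\<lambda>t. t *s v)) (at t)"
      by (rule bounded_linear_imp_has_derivative)
    from has_derivative_compose[OF this D(1)]
    have "((\<lambda>t. F (t *s v)) has_derivative (\<lambda>t. D v * t)) (at t)"
      by (simp add: D(2) mult.commute)
    then have "((\<lambda>t. F (t *s v)) has_field_derivative D v) (at t)"
      by (simp only: has_field_derivative_def)
    then show "(\<lambda>t. F (t *s v)) field_differentiable at t within UNIV"
      unfolding field_differentiable_def by auto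
  qed
qed simp

text \<open>Cauchy's integral formula at the centre of the unit circle.\<close>

lemma holomorphic_circle_mean:
  assumes f: "f holomorphic_on UNIV"
  shows "(LINT t|lborel. indicator {0..1} t *\<^sub>R f (cis (2 * pi * t))) = f 0"
proof -
  have c: "((\<lambda>u. f u / (u - 0)) has_contour_integral (2 * of_real pi * \<i> * f 0)) (circlepath 0 1)"
    by (rule Cauchy_integral_circlepath_simple) (use f in \<open>auto intro: holomorphic_on_subset\<close>)
  have cp: "circlepath 0 1 t = cis (2 * pi * t)" for t
    by (simp add: circlepath cis_conv_exp mult_ac)
  have vd: "vector_derivative (circlepath 0 1) (at t) = (2 * of_real pi * \<i>) * cis (2 * pi * t)" for t
    by (simp add: vector_derivative_circlepath cis_conv_exp mult_ac)
  have "((\<lambda>t. f (cis (2 * pi * t)) / cis (2 * pi * t) * ((2 * of_real pi * \<i>) * cis (2 * pi * t)))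
     has_integral (2 * of_real pi * \<i> * f 0)) {0..1}"
    using c unfolding has_contour_integral by (simp add: cp vd)
  then have "((\<lambda>t. (2 * of_real pi * \<i>) * f (cis (2 * pi * t))) has_integral (2 * of_real pi * \<i> * f 0)) {0..1}"
    by (simp add: mult_ac)
  from has_integral_mult_right[OF this, of "1 / (2 * of_real pi * \<i>)"]
  have hi: "((\<lambda>t. f (cis (2 * pi * t))) has_integral f 0) {0..1}" by simp
  have "continuous_on {0..1} (\<lambda>t. f (cis (2 * pi * t)))"
    by (intro continuous_on_compose2[OF holomorphic_on_imp_continuous_on[OF f]] continuous_intros) auto
  then have "set_integrable lborel {0..1} (\<lambda>t. f (cis (2 * pi * t)))"
    by (intro borel_integrable_atLeastAtMost')
  from set_borel_integral_eq_integral(2)[OF this] show ?thesis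
    using integral_unique[OF hi] by (simp add: set_lebesgue_integral_def)
qed

lemma norm_cis_smult [simp]: "norm (cis \<theta> *s z) = norm z" for z :: "complex^'n"
  by (simp add: norm_vec_def norm_mult)

lemma distr_fock_borel_rotation: "distr fock_borel borel (\<lambda>z. cis \<theta> *s z) = (fock_borel :: (complex^'n) measure)"
proof (rule measure_eqI)
  fix A :: "(complex^'n) set" assume "A \<in> sets (distr fock_borel borel (\<lambda>z. cis \<theta> *s z))"
  then have A[measurable]: "A \<in> sets borel" by simp
  have "emeasure (distr fock_borel borel (\<lambda>z. cis \<theta> *s z)) A = (\<integral>\<^sup>+z. indicator A z \<partial>distr fock_borel borel (\<lambda>z. cis \<theta> *s z))"
    by (rule nn_integral_indicator[symmetric]) simp
  also have "\<dots> = (\<integral>\<^sup>+z. indicator A (cis \<theta> *s z) \<partial>fock_borel)"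
    by (rule nn_integral_distr) simp_all
  also have "\<dots> = (\<integral>\<^sup>+z. ennreal (fock_density (cis \<theta> *s z)) * indicator A (cis \<theta> *s z) \<partial>lborel)"
    by (subst nn_integral_fock_borel) (simp_all add: fock_density_def)
  also have "\<dots> = (\<integral>\<^sup>+z. ennreal (fock_density z) * indicator A z \<partial>distr lborel borel (\<lambda>z. cis \<theta> *s z))"
    by (rule nn_integral_distr[symmetric]) simp_all
  also have "\<dots> = (\<integral>\<^sup>+z. indicator A z \<partial>fock_borel)"
    unfolding distr_rotation by (rule nn_integral_fock_borel[symmetric]) simp
  also have "\<dots> = emeasure fock_borel A" by (rule nn_integral_indicator) simp
  finally show "emeasure (distr fock_borel borel (\<lambda>z. cis \<theta> *s z)) A = emeasure fock_borel A" .
qed simp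

text \<open>Rotation invariance lets the integrand be replaced by its average over the circle through \<open>w\<close>,
  which is its value at 0.\<close>

lemma entire_mean_value:
  fixes F :: "complex^'n \<Rightarrow> complex"
  assumes F: "entire F" and int: "integrable fock_borel F"
  shows "(LINT w|fock_borel. F w) = F 0"
proof -
  have [measurable]: "F \<in> borel_measurable borel" by (rule entire_measurable[OF F])
  interpret pair_sigma_finite "lborel :: real measure" "fock_borel :: (complex^'n) measure" ..
  define H where "H t w = (indicator {0..1} t :: real) *\<^sub>R F (cis (2 * pi * t) *s w)" for t w
  have [measurable]: "case_prod H \<in> borel_measurable (lborel \<Otimes>\<^sub>M fock_borel)"
    unfolding H_def[abs_def] by measurable
  have rot: "(\<integral>\<^sup>+w. ennreal (norm (F (cis \<theta> *s w))) \<partial>fock_borel) = (\<integral>\<^sup>+w. ennreal (norm (F w)) \<partial>fock_borel)" for \<theta>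
    by (subst (2) distr_fock_borel_rotation[of \<theta>, symmetric]) (simp add: nn_integral_distr)
  have rot': "(LINT w|fock_borel. F (cis \<theta> *s w)) = (LINT w|fock_borel. F w)" for \<theta>
    by (subst (2) distr_fock_borel_rotation[of \<theta>, symmetric]) (simp add: integral_distr)
  have "integrable (lborel \<Otimes>\<^sub>M fock_borel) (case_prod H)"
  proof (rule integrableI_bounded)
    have "(\<integral>\<^sup>+p. ennreal (norm (case_prod H p)) \<partial>(lborel \<Otimes>\<^sub>M fock_borel))
       = (\<integral>\<^sup>+t. \<integral>\<^sup>+w. indicator {0..1} t * ennreal (norm (F (cis (2 * pi * t) *s w))) \<partial>fock_borel \<partial>lborel)"
      by (subst fock_borel.nn_integral_fst[symmetric]) (auto intro!: nn_integral_cong simp: H_def indicator_def)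
    also have "\<dots> = (\<integral>\<^sup>+t. indicator {0..1} t * (\<integral>\<^sup>+w. ennreal (norm (F w)) \<partial>fock_borel) \<partial>(lborel :: real measure))"
      by (simp add: nn_integral_cmult rot)
    also have "\<dots> = (\<integral>\<^sup>+w. ennreal (norm (F w)) \<partial>fock_borel)"
      by (simp add: nn_integral_multc)
    also have "\<dots> < \<infinity>" using int by (simp add: integrable_iff_bounded)
    finally show "(\<integral>\<^sup>+p. ennreal (norm (case_prod H p)) \<partial>(lborel \<Otimes>\<^sub>M fock_borel)) < \<infinity>" .
  qed simp
  then have "(LINT w|fock_borel. LINT t|lborel. H t w) = (LINT t|lborel. LINT w|fock_borel. H t w)"
    by (rule Fubini_integral)
  also have "(LINT t|lborel. LINT w|fock_borel. H t w) = (LINT w|fock_borel. F w)"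
    by (simp add: H_def rot')
  also have "(LINT w|fock_borel. LINT t|lborel. H t w) = (LINT w|(fock_borel :: (complex^'n) measure). F 0)"
  proof (rule Bochner_Integration.integral_cong[OF refl])
    fix w
    have "(LINT t|lborel. H t w) = F (0 *s w)"
      unfolding H_def by (rule holomorphic_circle_mean[OF entire_slice_holomorphic[OF F]])
    then show "(LINT t|lborel. H t w) = F 0" by simp
  qed
  moreover have "measure (fock_borel :: (complex^'n) measure) UNIV = 1"
    using emeasure_fock_borel by (simp add: measure_def)
  ultimately show ?thesis by simp
qed

lemma sqint_exp_cdot: "sqint fock_borel (\<lambda>w. rkern a w)"
proof -
  have "sqint fock_borel (\<lambda>w. cnj (bargmann (\<lambda>u. cnj (kern a u)) w))"
    by (intro sqint_cnj sqint_bargmann sqint_kern)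
  then show ?thesis by (simp add: bargmann_cnj_kern exp_cnj cnj_cdot cdot_commute)
qed

lemma entire_translate_mult_exp:
  fixes F :: "complex^'n \<Rightarrow> complex"
  assumes "entire F"
  shows "entire (\<lambda>t. F (a + t) * exp (cdot b t))"
  unfolding entire_def
proof
  fix z
  obtain D where D: "(F has_derivative D) (at (a + z))" "\<And>c h. D (c *s h) = c * D h"
    using assms unfolding entire_def by metis
  have "((\<lambda>t. a + t) has_derivative (\<lambda>t. t)) (at z)" by (auto intro!: derivative_eq_intros)
  from has_derivative_compose[OF this D(1)]
  have 1: "((\<lambda>t. F (a + t)) has_derivative D) (at z)" .
  have 2: "(cdot b has_derivative cdot b) (at z)"
    by (rule bounded_linear_imp_has_derivative[OF bounded_linear_cdot])
  have "(exp has_derivative ((*) (exp (cdot b z)))) (at (cdot b z))"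
    using DERIV_exp[of "cdot b z"] by (simp only: has_field_derivative_def)
  from has_derivative_compose[OF 2 this]
  have 3: "((\<lambda>t. exp (cdot b t)) has_derivative (\<lambda>k. exp (cdot b z) * cdot b k)) (at z)" .
  show "\<exists>D. ((\<lambda>t. F (a + t) * exp (cdot b t)) has_derivative D) (at z) \<and> (\<forall>c h. D (c *s h) = c * D h)"
    by (intro exI conjI, rule has_derivative_mult[OF 1 3]) (simp add: D(2) cdot_scale_right algebra_simps)
qed

text \<open>After the translation \<open>w = a + t\<close>, the density and the kernel combine to the density at
  \<open>t\<close> and an entire exponential factor equal to 1 at \<open>t = 0\<close>, so the mean value
  property applies.\<close>

lemma entire_reproducing:
  fixes F :: "complex^'n \<Rightarrow> complex"
  assumes F: "entire F" and sq: "sqint fock_borel F"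
  shows "(LINT w|fock_borel. F w * rkern a w) = F a"
proof -
  have [measurable]: "F \<in> borel_measurable borel" by (rule entire_measurable[OF F])
  let ?P = "\<lambda>w. F w * rkern a w"
  define G where "G t = F (a + t) * exp (cdot ((-1/2) *s cnj_vec a) t)" for t
  have [measurable]: "G \<in> borel_measurable borel" unfolding G_def[abs_def] by simp
  have key: "fock_density (a + t) *\<^sub>R ?P (a + t) = fock_density t *\<^sub>R G t" for t
  proof -
    have "of_real ((norm (a + t))\<^sup>2) = of_real ((norm a)\<^sup>2) + of_real ((norm t)\<^sup>2) + cdot a (cnj_vec t) + cdot t (cnj_vec a)"
    proof -
      have "cnj_vec (a + t) = cnj_vec a + cnj_vec t" by (simp add: vec_eq_iff)
      then show ?thesis
        unfolding cdot_cnj_self[symmetric] by (simp add: cdot_add_left cdot_add_right)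
    qed
    then have e: "- of_real ((norm (a + t))\<^sup>2) / 2 + cdot a (cnj_vec (a + t)) / 2 = - of_real ((norm t)\<^sup>2) / 2 + cdot ((-1/2) *s cnj_vec a) t"
    proof -
      assume *: "of_real ((norm (a + t))\<^sup>2) = of_real ((norm a)\<^sup>2) + of_real ((norm t)\<^sup>2) + cdot a (cnj_vec t) + cdot t (cnj_vec a)"
      have "cnj_vec (a + t) = cnj_vec a + cnj_vec t" by (simp add: vec_eq_iff)
      moreover have "cdot ((-1/2) *s cnj_vec a) t = (-1/2) * cdot t (cnj_vec a)"
        by (subst cdot_commute) (rule cdot_scale_right)
      ultimately show ?thesis unfolding * by (simp add: cdot_add_right cdot_cnj_self field_simps)
    qed
    have "exp (complex_of_real (- (norm (a + t))\<^sup>2 / 2)) * exp (cdot a (cnj_vec (a + t)) / 2)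
        = exp (complex_of_real (- (norm t)\<^sup>2 / 2)) * exp (cdot ((-1/2) *s cnj_vec a) t)"
      unfolding exp_add[symmetric] using e by simp
    then show ?thesis
      unfolding fock_density_def G_def scaleR_conv_of_real of_real_mult exp_of_real[symmetric]
      by (simp only: mult_ac)
  qed
  have tr: "integrable lborel (\<lambda>w. fock_density w *\<^sub>R ?P w) \<longleftrightarrow> integrable lborel (\<lambda>t. fock_density t *\<^sub>R G t)"
     "(LINT w|lborel. fock_density w *\<^sub>R ?P w) = (LINT t|lborel. fock_density t *\<^sub>R G t)"
    unfolding key[symmetric]
    by (subst lborel_distr_plus[of a, symmetric], subst integrable_distr_eq, simp_all)
       (subst lborel_distr_plus[of a, symmetric], subst integral_distr, simp_all)
  have "integrable fock_borel ?P"
    by (rule sqint_integrable_mult[OF sq sqint_exp_cdot])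
  then have iG: "integrable fock_borel G"
    using tr(1) unfolding fock_borel_def by (simp add: integrable_density)
  have "(LINT w|fock_borel. ?P w) = (LINT t|fock_borel. G t)"
    using tr(2) unfolding fock_borel_def by (simp add: integral_density)
  also have "\<dots> = G 0"
    by (rule entire_mean_value[OF _ iG]) (unfold G_def[abs_def], rule entire_translate_mult_exp[OF F])
  finally show ?thesis by (simp add: G_def)
qed

section \<open>Surjectivity and injectivity of the Bargmann transform\<close>

text \<open>By the adjoint relation for \<open>cnj (kern z)\<close>, the Bargmann transform of the adjoint of
  \<open>F\<close> at \<open>z\<close> is the integral in the reproducing formula.\<close>

lemma entire_eq_bargmann:
  fixes F :: "complex^'n \<Rightarrow> complex"
  assumes F: "entire F" "sqint fock_borel F"
  shows "\<exists>f. sqint lborel f \<and> bargmann f = F \<and> (\<forall>h. sqint lborel h \<longrightarrow>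
     (LINT w|fock_borel. F w * cnj (bargmann h w)) = (LINT u|lborel. f u * cnj (h u)))"
proof -
  obtain f where f: "sqint lborel f"
    "\<And>h. sqint lborel h \<Longrightarrow> (LINT w|fock_borel. F w * cnj (bargmann h w)) = (LINT u|lborel. f u * cnj (h u))"
    using bargmann_adjoint_exists[OF F(2)] by blast
  have "bargmann f z = F z" for z
  proof -
    have "bargmann f z = (LINT u|lborel. f u * cnj (cnj (kern z u)))"
      using sqint_measurable[OF f(1)] by (subst bargmann_borel) simp_all
    also have "\<dots> = (LINT w|fock_borel. F w * cnj (bargmann (\<lambda>u. cnj (kern z u)) w))"
      by (rule f(2)[OF sqint_cnj[OF sqint_kern], symmetric])
    also have "\<dots> = (LINT w|fock_borel. F w * rkern z w)"
      by (simp add: bargmann_cnj_kern exp_cnj cnj_cdot cdot_commute)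
    also have "\<dots> = F z" by (rule entire_reproducing[OF F])
    finally show ?thesis .
  qed
  with f show ?thesis by blast
qed

text \<open>The Borel sets on which the integral vanishes form a Dynkin system, and the closed sets are stable under
  intersection and generate.\<close>

lemma integral_zero_on_closed_imp_AE_zero:
  fixes m :: "'a::euclidean_space \<Rightarrow> complex"
  assumes m: "integrable lborel m"
    and c: "\<And>C. closed C \<Longrightarrow> (LINT u|lborel. indicator C u *\<^sub>R m u) = 0"
  shows "AE u in lborel. m u = 0"
proof (rule sigma_finite_measure.density_zero[OF sigma_finite_lborel m])
  fix A :: "'a set" assume "A \<in> sets lborel"
  then have A: "A \<in> sigma_sets UNIV (Collect closed)" by (simp add: borel_eq_closed)
  have i: "integrable lborel (\<lambda>u. indicator A u *\<^sub>R m u)" if "A \<in> sigma_sets UNIV (Collect closed)" for A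
    using that by (intro integrable_mult_indicator m) (simp add: borel_eq_closed)
  have "Int_stable (Collect closed :: 'a set set)" "(Collect closed :: 'a set set) \<subseteq> Pow UNIV"
    by (auto simp: Int_stable_def)
  from this A have "(LINT u|lborel. indicator A u *\<^sub>R m u) = 0"
  proof (induction rule: sigma_sets_induct_disjoint)
    case (compl A)
    have "(\<lambda>u. indicator (UNIV - A) u *\<^sub>R m u) = (\<lambda>u. indicator UNIV u *\<^sub>R m u - indicator A u *\<^sub>R m u)"
      by (auto simp: indicator_def)
    then show ?case
      using compl c[of UNIV] i[of A] m by simp
  next
    case (union A)
    have "(LINT u:(\<Union>i. A i)|lborel. m u) = (\<Sum>i. LINT u:A i|lborel. m u)"
    proof (rule lebesgue_integral_countable_add)
      show "A i \<in> sets lborel" for i using union(2) by (auto simp: borel_eq_closed)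
      show "A i \<inter> A j = {}" if "i \<noteq> j" for i j using union(1) that by (auto simp: disjoint_family_on_def)
      show "set_integrable lborel (\<Union>(range A)) m"
        unfolding set_integrable_def
        by (rule i) (use union(2) in \<open>auto intro!: sigma_sets.Union\<close>)
    qed
    then show ?case using union(3) by (simp add: set_lebesgue_integral_def)
  qed (auto simp: c)
  then show "set_lebesgue_integral lborel A m = 0" by (simp add: set_lebesgue_integral_def)
qed

text \<open>Indicators of closed sets are decreasing limits of continuous functions with values between 0 and 1.\<close>

lemma continuous_test_zero_imp_AE_zero:
  fixes m :: "'a::euclidean_space \<Rightarrow> complex"
  assumes m: "integrable lborel m"
    and z: "\<And>\<phi>. continuous_on UNIV \<phi> \<Longrightarrow> (\<And>u. \<bar>\<phi> u\<bar> \<le> 1) \<Longrightarrow> (LINT u|lborel. m u * of_real (\<phi> u)) = 0"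
  shows "AE u in lborel. m u = 0"
proof (rule integral_zero_on_closed_imp_AE_zero[OF m])
  fix C :: "'a set" assume C: "closed C"
  have [measurable]: "m \<in> borel_measurable borel" "C \<in> sets borel"
    using borel_measurable_integrable[OF m] C by simp_all
  show "(LINT u|lborel. indicator C u *\<^sub>R m u) = 0"
  proof (cases "C = {}")
    case False
    define \<phi> where "\<phi> j u = max 0 (1 - real j * infdist u C)" for j u
    have \<phi>c: "continuous_on UNIV (\<phi> j)" for j
      unfolding \<phi>_def[abs_def] by (intro continuous_intros)
    have \<phi>b: "\<bar>\<phi> j u\<bar> \<le> 1" for j u
      unfolding \<phi>_def using infdist_nonneg[of u C] by (auto simp: max_def)
    have [measurable]: "\<phi> j \<in> borel_measurable borel" for j by (intro borel_measurable_continuous_onI \<phi>c)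
    have lim: "(\<lambda>j. \<phi> j u) \<longlonglongrightarrow> indicator C u" for u
    proof (cases "u \<in> C")
      case F: False
      have "infdist u C > 0"
        using F in_closed_iff_infdist_zero[OF C False, of u] infdist_nonneg[of u C] by linarith
      then obtain N where N: "1 < real N * infdist u C" using reals_Archimedean3 by blast
      have "\<forall>\<^sub>F j in sequentially. \<phi> j u = indicator C u"
        using eventually_ge_at_top[of N]
      proof eventually_elim
        case (elim j)
        have "real N * infdist u C \<le> real j * infdist u C"
          using elim infdist_nonneg[of u C] by (intro mult_right_mono) auto
        with N F show ?case by (simp add: \<phi>_def)
      qed
      then show ?thesis by (rule tendsto_eventually)
    qed (simp add: \<phi>_def)
    have "(\<lambda>j. LINT u|lborel. m u * of_real (\<phi> j u)) \<longlonglongrightarrow> (LINT u|lborel. m u * of_real (indicator C u))"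
    proof (rule integral_dominated_convergence[where w="\<lambda>u. norm (m u)"])
      show "AE u in lborel. norm (m u * of_real (\<phi> j u)) \<le> norm (m u)" for j
        using \<phi>b by (auto simp: norm_mult intro!: AE_I2 mult_left_le)
    qed (use m in \<open>auto intro!: AE_I2 tendsto_intros lim\<close>)
    then show ?thesis by (simp add: z[OF \<phi>c \<phi>b] LIMSEQ_const_iff scaleR_conv_of_real mult.commute)
  qed simp
qed

text \<open>The Gaussian means of a bounded continuous \<open>\<phi>\<close> converge to \<open>\<phi>\<close>, so
  \<open>m\<close> integrates to 0 against \<open>\<phi>\<close>.\<close>

lemma gaussian_means_zero_imp_AE_zero:
  fixes m :: "real^'n \<Rightarrow> complex"
  assumes m: "integrable lborel m"
    and g: "\<And>l v. l > 0 \<Longrightarrow> (LINT u|lborel. m u * of_real (exp (- l * (norm (u - v))\<^sup>2))) = 0"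
  shows "AE u in lborel. m u = 0"
proof (rule continuous_test_zero_imp_AE_zero[OF m])
  fix \<phi> :: "real^'n \<Rightarrow> real"
  assume \<phi>: "continuous_on UNIV \<phi>" "\<And>u. \<bar>\<phi> u\<bar> \<le> 1"
  have [measurable]: "m \<in> borel_measurable borel" "\<phi> \<in> borel_measurable borel"
    using borel_measurable_integrable[OF m] by (auto intro: borel_measurable_continuous_onI \<phi>)
  define W where "W t = exp (- (norm t)\<^sup>2)" for t :: "real^'n"
  define M where "M = integral\<^sup>L lborel W"
  have W: "integrable lborel W" and M: "M > 0"
    using has_bochner_integral_gaussian_real[of 1 "0 :: real^'n"]
    by (auto simp: has_bochner_integral_iff W_def[abs_def] M_def)
  \<comment> \<open>The mean of \<open>\<phi>\<close> over a Gaussian of width \<open>1 / (k + 1)\<close> at \<open>u\<close>, up to the factor \<open>M\<close>,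
    written after the substitution that fixes the Gaussian.\<close>
  define P where "P k u = (LINT t|lborel. \<phi> (u + (1 / real (Suc k)) *\<^sub>R t) * W t)" for k u
  have [measurable]: "W \<in> borel_measurable borel" "P k \<in> borel_measurable borel" for k
    unfolding P_def[abs_def] W_def[abs_def] by measurable
  have Wb: "\<bar>\<phi> v * W t\<bar> \<le> W t" for v t
    by (auto simp: W_def abs_mult intro!: mult_left_le_one_le \<phi>)
  have Pi: "integrable lborel (\<lambda>t. \<phi> (u + c *\<^sub>R t) * W t)" for u c
    by (rule Bochner_Integration.integrable_bound[OF W]) (auto intro!: AE_I2 order_trans[OF Wb])
  have Pb: "\<bar>P k u\<bar> \<le> M" for k u
    unfolding P_def M_def
    by (rule order_trans[OF integral_abs_bound]) (intro integral_mono integrable_abs Pi W Wb)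
  have Plim: "(\<lambda>k. P k u) \<longlonglongrightarrow> \<phi> u * M" for u
  proof -
    have "(\<lambda>k. \<phi> (u + (1 / real (Suc k)) *\<^sub>R t) * W t) \<longlonglongrightarrow> \<phi> u * W t" for t
    proof (rule tendsto_mult_right)
      have "(\<lambda>k. u + (1 / real (Suc k)) *\<^sub>R t) \<longlonglongrightarrow> u + 0 *\<^sub>R t"
        by (intro tendsto_intros LIMSEQ_Suc lim_1_over_n)
      then show "(\<lambda>k. \<phi> (u + (1 / real (Suc k)) *\<^sub>R t)) \<longlonglongrightarrow> \<phi> u"
        by (intro continuous_on_tendsto_compose[OF \<phi>(1)]) auto
    qed
    then have "(\<lambda>k. P k u) \<longlonglongrightarrow> (LINT t|lborel. \<phi> u * W t)"
      unfolding P_def by (intro integral_dominated_convergence[where w=W] AE_I2) (auto simp: W Wb)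
    then show ?thesis by (simp add: M_def)
  qed
  have zero: "(LINT u|lborel. m u * of_real (P k u)) = 0" for k
  proof -
    let ?s = "real (Suc k)" and ?c = "(1 / real (Suc k)) ^ CARD('n)"
    define E where "E u v = exp (- ?s\<^sup>2 * (norm (u - v))\<^sup>2)" for u v :: "real^'n"
    have [measurable]: "case_prod E \<in> borel_measurable (borel \<Otimes>\<^sub>M borel)"
      unfolding E_def[abs_def] by measurable
    have scale: "has_bochner_integral lborel (\<lambda>v. f v * E u v) (?c * (LINT t|lborel. f (u + (1 / ?s) *\<^sub>R t) * W t))"
      if [measurable]: "f \<in> borel_measurable borel" and i: "integrable lborel (\<lambda>t. f (u + (1 / ?s) *\<^sub>R t) * W t)" for f u
    proof -
      have d: "(lborel :: (real^'n) measure) = density (distr lborel borel (\<lambda>t. u + (1 / ?s) *\<^sub>R t)) (\<lambda>_. ennreal ?c)"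
        using lborel_affine[of "1 / ?s" u] by simp
      have e: "E u (u + (1 / ?s) *\<^sub>R t) = W t" for t
        by (simp add: E_def W_def power_mult_distrib power_divide)
      have "integrable lborel (\<lambda>v. f v * E u v)"
        by (subst d, subst integrable_density, simp, simp, simp, subst integrable_distr_eq, simp, simp)
           (simp only: e real_scaleR_def, intro integrable_mult_right i)
      moreover have "(LINT v|lborel. f v * E u v) = ?c * (LINT t|lborel. f (u + (1 / ?s) *\<^sub>R t) * W t)"
        by (subst d, subst integral_density, simp, simp, simp, subst integral_distr, simp, simp)
           (simp only: e real_scaleR_def integral_mult_right_zero)
      ultimately show ?thesis by (simp add: has_bochner_integral_iff)
    qed
    have E1: "has_bochner_integral lborel (E u) (?c * M)" for u
      using scale[of "\<lambda>_. 1" u] W by (simp add: M_def)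
    have En: "norm (norm (m u) * E u v) = norm (m u) * E u v" for u v
      by (simp add: E_def abs_mult)
    let ?f = "\<lambda>u v. m u * of_real (\<phi> v * E u v)"
    have int: "integrable (lborel \<Otimes>\<^sub>M lborel) (case_prod ?f)"
    proof (rule Bochner_Integration.integrable_bound)
      show "integrable (lborel \<Otimes>\<^sub>M lborel) (\<lambda>(u, v). norm (m u) * E u v)"
      proof (rule lborel_pair.Fubini_integrable)
        have "(\<lambda>u. LINT v|lborel. norm (case (u, v) of (u, v) \<Rightarrow> norm (m u) * E u v)) = (\<lambda>u. norm (m u) * (?c * M))"
          using E1 by (intro ext) (simp only: prod.case En integral_mult_right_zero has_bochner_integral_iff)
        then show "integrable lborel (\<lambda>u. LINT v|lborel. norm (case (u, v) of (u, v) \<Rightarrow> norm (m u) * E u v))"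
          using integrable_mult_left[OF integrable_norm[OF m]] by simp
      qed (use E1 in \<open>auto simp: has_bochner_integral_iff\<close>)
      show "AE p in lborel \<Otimes>\<^sub>M lborel. norm (case_prod ?f p) \<le> norm (case p of (u, v) \<Rightarrow> norm (m u) * E u v)"
        by (auto simp: norm_mult abs_mult intro!: AE_I2 mult_left_mono mult_left_le_one_le \<phi>)
    qed simp
    have "0 = (LINT v|lborel. of_real (\<phi> v) * (LINT u|lborel. m u * of_real (E u v)))"
      unfolding E_def by (subst g) simp_all
    also have "\<dots> = (LINT v|lborel. LINT u|lborel. ?f u v)"
      by (intro Bochner_Integration.integral_cong refl, subst integral_mult_right_zero[symmetric]) (simp add: mult_ac)
    also have "\<dots> = (LINT u|lborel. LINT v|lborel. ?f u v)"
      by (rule lborel_pair.Fubini_integral[OF int])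
    also have "\<dots> = (LINT u|lborel. of_real ?c * (m u * of_real (P k u)))"
    proof -
      have "(LINT v|lborel. \<phi> v * E u v) = ?c * P k u" for u
        using scale[OF _ Pi] unfolding has_bochner_integral_iff P_def by simp
      then have "(LINT v|lborel. ?f u v) = of_real ?c * (m u * of_real (P k u))" for u
        by (simp only: integral_mult_right_zero integral_complex_of_real) (simp only: of_real_mult mult.left_commute)
      then show ?thesis by (simp only:)
    qed
    also have "\<dots> = of_real ?c * (LINT u|lborel. m u * of_real (P k u))"
      by (rule integral_mult_right_zero)
    finally show ?thesis
      using of_real_eq_0_iff[of ?c, where ?'a=complex] by (simp del: of_real_power of_real_divide)
  qed
  have "(\<lambda>k. LINT u|lborel. m u * of_real (P k u)) \<longlonglongrightarrow> (LINT u|lborel. m u * of_real (\<phi> u * M))"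
  proof (rule integral_dominated_convergence[where w="\<lambda>u. norm (m u) * M"])
    show "AE u in lborel. norm (m u * of_real (P k u)) \<le> norm (m u) * M" for k
      by (auto simp: norm_mult intro!: AE_I2 mult_left_mono Pb)
    show "AE u in lborel. (\<lambda>k. m u * of_real (P k u)) \<longlonglongrightarrow> m u * of_real (\<phi> u * M)"
      by (intro AE_I2 tendsto_intros Plim)
  qed (use m in auto)
  then have "(LINT u|lborel. m u * of_real (\<phi> u) * of_real M) = 0"
    unfolding zero by (simp add: LIMSEQ_const_iff mult.assoc)
  then show "(LINT u|lborel. m u * of_real (\<phi> u)) = 0" using M by simp
qed

text \<open>At \<open>z = iy\<close> the hypothesis says that the Fourier transform of
  \<open>m u = h u * exp (- |u|^2/2)\<close> vanishes. Integrating it against a modulated Gaussian in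
  \<open>y\<close> gives the Gaussian means of \<open>m\<close>.\<close>

lemma bargmann_inj:
  fixes h :: "real^'n \<Rightarrow> complex"
  assumes h: "sqint lborel h" and z: "\<And>z. bargmann h z = 0"
  shows "AE u in lborel. h u = 0"
proof -
  have [measurable]: "h \<in> borel_measurable borel" using sqint_measurable[OF h] by simp
  define m where "m u = h u * of_real (exp (- (norm u)\<^sup>2 / 2))" for u
  have [measurable]: "m \<in> borel_measurable borel" unfolding m_def[abs_def] by simp
  have m: "integrable lborel m"
    using sqint_integrable_mult[OF h sqint_gaussian[of "1/2" 1]] by (simp add: m_def[abs_def])
  have four: "(LINT u|lborel. m u * exp (cdot (of_real_vec u) z)) = 0" for z
  proof -
    let ?c = "complex_of_real (pi powr (- real CARD('n) / 4)) * exp (- cdot z z / 4)"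
    have "0 = (LINT u|lborel. ?c * (m u * exp (cdot (of_real_vec u) z)))"
      using z[of z] by (subst (asm) bargmann_borel) (simp_all add: kern_def m_def mult_ac)
    also have "\<dots> = ?c * (LINT u|lborel. m u * exp (cdot (of_real_vec u) z))"
      by (rule integral_mult_right_zero)
    finally show ?thesis by simp
  qed
  have "AE u in lborel. m u = 0"
  proof (rule gaussian_means_zero_imp_AE_zero[OF m])
    fix l :: real and v :: "real^'n" assume l: "l > 0"
    \<comment> \<open>chosen such that the Fourier transform of \<open>exp (- e |y|^2)\<close> is a multiple of \<open>exp (- l |u|^2)\<close>\<close>
    define e where "e = 1 / (4 * l)"
    have e: "e > 0" using l by (simp add: e_def)
    define g where "g u y = exp (- of_real (e * (norm y)\<^sup>2) + cdot (of_real_vec y) (cvec 0 (u - v)))" for u y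
    have g: "g u y = exp (- of_real (e * (norm y)\<^sup>2)) * exp (- cdot (of_real_vec v) (cvec 0 y)) * exp (cdot (of_real_vec u) (cvec 0 y))" for u y
    proof -
      have "cdot (of_real_vec y) (cvec 0 (u - v)) = - cdot (of_real_vec v) (cvec 0 y) + cdot (of_real_vec u) (cvec 0 y)"
        by (simp add: complex_eq_iff Re_cdot Im_cdot inner_diff_right inner_commute)
      then show ?thesis
        unfolding g_def exp_add[symmetric] by (intro arg_cong[where f=exp]) simp
    qed
    have gn: "norm (g u y) = exp (- (e * (norm y)\<^sup>2))" for u y
      unfolding g_def by (simp add: Re_cdot)
    have ge: "integrable lborel (\<lambda>y::real^'n. exp (- (e * (norm y)\<^sup>2)))"
      using has_bochner_integral_gaussian_real[OF e, of "0::real^'n"] by (simp add: has_bochner_integral_iff)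
    have [measurable]: "case_prod g \<in> borel_measurable (borel \<Otimes>\<^sub>M borel)"
      unfolding g_def[abs_def] by measurable
    let ?f = "\<lambda>u y. m u * g u y"
    let ?c = "complex_of_real ((pi / e) powr (real CARD('n) / 2))"
    have inner: "(LINT y|lborel. g u y) = ?c * of_real (exp (- l * (norm (u - v))\<^sup>2))" for u
    proof -
      have "cdot (cvec 0 (u - v)) (cvec 0 (u - v)) / of_real (4 * e) = of_real (- l * (norm (u - v))\<^sup>2)"
        using l by (simp add: complex_eq_iff Re_cdot Im_cdot power2_norm_eq_inner e_def Re_divide Im_divide)
      then show ?thesis
        using has_bochner_integral_gaussian[OF e, of "cvec 0 (u - v)"]
        unfolding g_def has_bochner_integral_iff by (simp add: exp_of_real[symmetric] del: exp_of_real)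
    qed
    have int: "integrable (lborel \<Otimes>\<^sub>M lborel) (case_prod ?f)"
    proof (rule lborel_pair.Fubini_integrable)
      show "integrable lborel (\<lambda>u. LINT y|lborel. norm (case (u, y) of (u, y) \<Rightarrow> m u * g u y))"
        using integrable_norm[OF m] by (simp add: norm_mult gn)
      show "AE u in lborel. integrable lborel (\<lambda>y. case (u, y) of (u, y) \<Rightarrow> m u * g u y)"
      proof (intro AE_I2)
        fix u
        have "integrable lborel (\<lambda>y. m u * g u y)"
          by (rule integrable_mult_right, rule Bochner_Integration.integrable_bound[OF ge]) (auto simp: gn)
        then show "integrable lborel (\<lambda>y. case (u, y) of (u, y) \<Rightarrow> m u * g u y)" by simp
      qed
    qed simp
    have "(LINT u|lborel. LINT y|lborel. ?f u y) = (LINT y|lborel. LINT u|lborel. ?f u y)"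
      by (rule lborel_pair.Fubini_integral[OF int, symmetric])
    also have "\<dots> = (LINT y|(lborel :: (real^'n) measure). 0)"
    proof (rule Bochner_Integration.integral_cong[OF refl])
      fix y :: "real^'n"
      have "(LINT u|lborel. ?f u y) = (LINT u|lborel. (exp (- of_real (e * (norm y)\<^sup>2)) * exp (- cdot (of_real_vec v) (cvec 0 y)))
           * (m u * exp (cdot (of_real_vec u) (cvec 0 y))))"
        unfolding g by (simp only: mult_ac)
      also have "\<dots> = 0" by (subst integral_mult_right_zero) (simp add: four)
      finally show "(LINT u|lborel. ?f u y) = 0" .
    qed
    finally have z: "(LINT u|lborel. LINT y|lborel. ?f u y) = 0" by simp
    have "(LINT u|lborel. ?c * (m u * of_real (exp (- l * (norm (u - v))\<^sup>2)))) = (LINT u|lborel. LINT y|lborel. ?f u y)"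
      by (intro Bochner_Integration.integral_cong refl, subst integral_mult_right_zero, subst inner) (simp only: mult_ac)
    then have "(LINT u|lborel. ?c * (m u * of_real (exp (- l * (norm (u - v))\<^sup>2)))) = 0"
      unfolding z .
    then have "?c * (LINT u|lborel. m u * of_real (exp (- l * (norm (u - v))\<^sup>2))) = 0"
      by (subst (asm) integral_mult_right_zero)
    then show "(LINT u|lborel. m u * of_real (exp (- l * (norm (u - v))\<^sup>2))) = 0"
      using e by simp
  qed
  then show ?thesis by eventually_elim (simp add: m_def)
qed

section \<open>Null sets and translation invariance\<close>

lemma AE_lborel_null_set:
  assumes "AE x in lborel. P x"
  shows "\<exists>N\<in>sets borel. emeasure lborel N = 0 \<and> (\<forall>x. x \<notin> N \<longrightarrow> P x)"
proof -
  obtain N where N: "{x \<in> space lborel. \<not> P x} \<subseteq> N" "emeasure lborel N = 0" "N \<in> sets lborel"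
    by (rule AE_E[OF assms])
  show ?thesis by (rule bexI[of _ N]) (use N in auto)
qed

lemma borel_measurable_lebesgue_AE:
  fixes f g :: "'a::euclidean_space \<Rightarrow> complex"
  assumes g[measurable]: "g \<in> borel_measurable borel" and eq: "AE x in lborel. f x = g x"
  shows "f \<in> borel_measurable lebesgue"
proof -
  obtain N where N: "N \<in> sets borel" "emeasure lborel N = 0" "\<And>x. x \<notin> N \<Longrightarrow> f x = g x"
    using AE_lborel_null_set[OF eq] by blast
  have N0: "N \<in> null_sets lebesgue" using N(1,2) by (simp add: null_sets_def)
  show ?thesis
  proof (rule borel_measurableI)
    fix S :: "complex set" assume S: "open S"
    have "f -` S \<inter> space lebesgue = (g -` S - N) \<union> (f -` S \<inter> N)"
      using N(3) by auto
    moreover have "g -` S \<in> sets lebesgue"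
      using measurable_sets[OF measurable_completion[of g lborel borel], of S] S by simp
    moreover have "f -` S \<inter> N \<in> sets lebesgue"
      using completion.complete2[OF _ N0, of "f -` S \<inter> N"] by (auto dest: null_setsD2)
    ultimately show "f -` S \<inter> space lebesgue \<in> sets lebesgue"
      by (simp only:) (intro sets.Un sets.Diff null_setsD2[OF N0])
  qed
qed

text \<open>Completeness of Lebesgue measure makes \<open>f\<close> measurable.\<close>

lemma lebesgue_integral_cong_borel:
  fixes f g :: "'a::euclidean_space \<Rightarrow> complex"
  assumes g[measurable]: "g \<in> borel_measurable borel" and eq: "AE x in lborel. f x = g x"
  shows "(LINT x|lebesgue. f x) = (LINT x|lborel. g x)"
proof -
  have "(LINT x|lebesgue. f x) = (LINT x|lebesgue. g x)"
    using borel_measurable_lebesgue_AE[OF g eq] measurable_completion[of g lborel borel] AE_completion[OF eq]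
    by (intro integral_cong_AE) auto
  then show ?thesis by (simp add: integral_completion)
qed

lemma lborel_reflect: "lborel = distr lborel borel (\<lambda>x. t - x :: 'a::euclidean_space)"
  using lborel_affine[of "-1" t] by (simp add: density_1)

lemma nn_integral_reflect:
  fixes t :: "'a::euclidean_space"
  assumes [measurable]: "f \<in> borel_measurable borel"
  shows "(\<integral>\<^sup>+x. f (t - x) \<partial>lborel) = (\<integral>\<^sup>+x. f x \<partial>lborel)"
  by (subst (2) lborel_reflect[of t]) (simp add: nn_integral_distr)

lemma nn_integral_translate:
  fixes t :: "'a::euclidean_space"
  assumes [measurable]: "f \<in> borel_measurable borel"
  shows "(\<integral>\<^sup>+x. f (t + x) \<partial>lborel) = (\<integral>\<^sup>+x. f x \<partial>lborel)"
  by (subst (2) lborel_distr_plus[of t, symmetric]) (simp add: nn_integral_distr)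

lemma AE_compose_null:
  assumes P: "AE x in lborel. P x" and f[measurable]: "f \<in> borel_measurable M"
    and null: "\<And>N. N \<in> sets borel \<Longrightarrow> emeasure lborel N = 0 \<Longrightarrow> (\<integral>\<^sup>+p. indicator N (f p) \<partial>M) = 0"
  shows "AE p in M. P (f p)"
proof -
  obtain N where N[measurable]: "N \<in> sets borel" and N0: "emeasure lborel N = 0" "\<And>x. x \<notin> N \<Longrightarrow> P x"
    using AE_lborel_null_set[OF P] by blast
  have "AE p in M. (indicator N (f p) :: ennreal) = 0"
    using null[OF N N0(1)] by (subst (asm) nn_integral_0_iff_AE) auto
  then show ?thesis by eventually_elim (auto intro: N0 simp: indicator_def split: if_splits)
qed

lemma AE_lborel_diff:
  fixes P :: "'a::euclidean_space \<Rightarrow> bool"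
  assumes "AE y in lborel. P y"
  shows "AE p in lborel \<Otimes>\<^sub>M lborel. P (fst p - snd p)"
proof (rule AE_compose_null[OF assms])
  fix N :: "'a set" assume [measurable]: "N \<in> sets borel" and N: "emeasure lborel N = 0"
  have "(\<integral>\<^sup>+p. indicator N (fst p - snd p) \<partial>(lborel \<Otimes>\<^sub>M lborel)) = (\<integral>\<^sup>+u. \<integral>\<^sup>+v. indicator N (u - v) \<partial>lborel \<partial>(lborel :: 'a measure))"
    by (subst lborel.nn_integral_fst[symmetric]) auto
  then show "(\<integral>\<^sup>+p. indicator N (fst p - snd p) \<partial>(lborel \<Otimes>\<^sub>M lborel)) = 0"
    by (simp add: nn_integral_reflect[of "indicator N"] N)
qed simp

lemma nn_integral_cvec_swap:
  fixes f :: "complex^'n \<Rightarrow> ennreal"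
  assumes [measurable]: "f \<in> borel_measurable borel"
  shows "(\<integral>\<^sup>+z. f z \<partial>lborel) = (\<integral>\<^sup>+y. \<integral>\<^sup>+x. f (cvec x y) \<partial>lborel \<partial>lborel)"
  by (subst nn_integral_cvec, simp) (rule lborel_pair.Fubini'[symmetric], simp)

text \<open>The statement that almost every section of a null set is null, in the coordinates \<open>cvec x y\<close>.\<close>

lemma AE_cvec:
  fixes P :: "complex^'n \<Rightarrow> bool"
  assumes "AE z in lborel. P z"
  shows "AE y in lborel. AE x in lborel. P (cvec x y)"
proof -
  obtain N where N[measurable]: "N \<in> sets borel" and N0: "emeasure lborel N = 0" "\<And>x. x \<notin> N \<Longrightarrow> P x"
    using AE_lborel_null_set[OF assms] by blast
  have "(\<integral>\<^sup>+y. \<integral>\<^sup>+x. indicator N (cvec x y) \<partial>lborel \<partial>lborel) = 0"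
    using nn_integral_cvec_swap[of "indicator N"] N0(1) by simp
  then have "AE y in lborel. (\<integral>\<^sup>+x. indicator N (cvec x y) \<partial>lborel) = 0"
    by (subst (asm) nn_integral_0_iff_AE) auto
  then show ?thesis
  proof eventually_elim
    case (elim y)
    then have "AE x in lborel. (indicator N (cvec x y) :: ennreal) = 0"
      by (subst (asm) nn_integral_0_iff_AE) auto
    then show ?case by eventually_elim (auto intro: N0 simp: indicator_def split: if_splits)
  qed
qed

lemma AE_Im_vec:
  fixes P :: "real^'n \<Rightarrow> bool"
  assumes "AE y in lborel. P y"
  shows "AE z in lborel. P (t + Im_vec z)"
proof (rule AE_compose_null[OF assms])
  fix N :: "(real^'n) set" assume [measurable]: "N \<in> sets borel" and N: "emeasure lborel N = 0"
  have "(\<integral>\<^sup>+z. indicator N (t + Im_vec z) \<partial>lborel) = (\<integral>\<^sup>+x. \<integral>\<^sup>+y. indicator N (t + y) \<partial>lborel \<partial>(lborel :: (real^'n) measure))"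
    by (subst nn_integral_cvec) auto
  then show "(\<integral>\<^sup>+z. indicator N (t + Im_vec z) \<partial>lborel) = 0"
    by (simp add: nn_integral_translate[of "indicator N"] N)
qed simp

section \<open>The integral kernel of the Weyl transform\<close>

text \<open>Young's inequality. The inner integral is taken with respect to the measure with density
  \<open>\<lambda>v. g (u - v)\<close>, to which the Cauchy-Schwarz inequality is applied with the
  constant function 1.\<close>

lemma young_L1_L2:
  fixes g k :: "'a::euclidean_space \<Rightarrow> ennreal"
  assumes [measurable]: "g \<in> borel_measurable borel" "k \<in> borel_measurable borel"
  shows "(\<integral>\<^sup>+u. (\<integral>\<^sup>+v. g (u - v) * k v \<partial>lborel)\<^sup>2 \<partial>lborel) \<le> (\<integral>\<^sup>+t. g t \<partial>lborel)\<^sup>2 * (\<integral>\<^sup>+v. (k v)\<^sup>2 \<partial>lborel)"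
proof -
  let ?g = "\<integral>\<^sup>+t. g t \<partial>lborel"
  have r: "(\<integral>\<^sup>+v. g (u - v) \<partial>lborel) = ?g" for u by (rule nn_integral_reflect) simp
  have r': "(\<integral>\<^sup>+u. g (u - v) \<partial>lborel) = ?g" for v
    using nn_integral_translate[of g "- v"] by simp
  have "(\<integral>\<^sup>+v. g (u - v) * k v \<partial>lborel)\<^sup>2 \<le> ?g * (\<integral>\<^sup>+v. g (u - v) * (k v)\<^sup>2 \<partial>lborel)" for u
    using Cauchy_Schwarz_nn_integral[of "\<lambda>_. 1" "density lborel (\<lambda>v. g (u - v))" k]
    by (simp add: nn_integral_density r emeasure_density)
  then have "(\<integral>\<^sup>+u. (\<integral>\<^sup>+v. g (u - v) * k v \<partial>lborel)\<^sup>2 \<partial>lborel) \<le> (\<integral>\<^sup>+u. ?g * (\<integral>\<^sup>+v. g (u - v) * (k v)\<^sup>2 \<partial>lborel) \<partial>lborel)"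
    by (rule nn_integral_mono)
  also have "\<dots> = ?g * (\<integral>\<^sup>+u. \<integral>\<^sup>+v. g (u - v) * (k v)\<^sup>2 \<partial>lborel \<partial>lborel)"
    by (rule nn_integral_cmult) simp
  also have "(\<integral>\<^sup>+u. \<integral>\<^sup>+v. g (u - v) * (k v)\<^sup>2 \<partial>lborel \<partial>lborel) = (\<integral>\<^sup>+v. \<integral>\<^sup>+u. g (u - v) * (k v)\<^sup>2 \<partial>lborel \<partial>lborel)"
    by (rule lborel_pair.Fubini'[symmetric]) simp
  also have "\<dots> = ?g * (\<integral>\<^sup>+v. (k v)\<^sup>2 \<partial>lborel)"
    by (simp add: nn_integral_multc r' nn_integral_cmult)
  finally show ?thesis by (simp add: power2_eq_square mult.assoc)
qed

text \<open>A majorant of the integral kernel of the Weyl transform, as a function of the difference of its arguments.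
  It is integrable, hence finite almost everywhere.\<close>

definition fibre_mass :: "(complex^'n \<Rightarrow> complex) \<Rightarrow> real^'n \<Rightarrow> ennreal" where
  "fibre_mass \<sigma> y = ennreal ((2 * pi) powr (- real CARD('n) / 2)) * (\<integral>\<^sup>+x. ennreal (norm (\<sigma> (cvec x y))) \<partial>lborel)"

text \<open>The function \<open>\<psi>\<close> that belongs to a Borel symbol.\<close>

definition weyl_kernel :: "(complex^'n \<Rightarrow> complex) \<Rightarrow> real^'n \<Rightarrow> real^'n \<Rightarrow> complex" where
  "weyl_kernel \<sigma> u v = fourier1_inv \<sigma> ((1/2) *\<^sub>R (u + v)) (u - v)"

context
  fixes \<sigma> :: "complex^'n \<Rightarrow> complex"
  assumes sm[measurable]: "\<sigma> \<in> borel_measurable borel" and si: "integrable lborel \<sigma>"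
begin

lemma fourier1_inv_borel:
  "fourier1_inv \<sigma> \<xi> y = of_real ((2 * pi) powr (- real CARD('n) / 2)) * (LINT x|lborel. cis (x \<bullet> \<xi>) * \<sigma> (cvec x y))"
  unfolding fourier1_inv_def by (subst integral_completion) simp_all

lemma borel_measurable_fourier1_inv [measurable]:
  assumes [measurable]: "f \<in> borel_measurable M" "g \<in> borel_measurable M"
  shows "(\<lambda>p. fourier1_inv \<sigma> (f p) (g p)) \<in> borel_measurable M"
  unfolding fourier1_inv_borel by measurable

lemma borel_measurable_weyl_kernel [measurable]:
  assumes [measurable]: "f \<in> borel_measurable M" "g \<in> borel_measurable M"
  shows "(\<lambda>p. weyl_kernel \<sigma> (f p) (g p)) \<in> borel_measurable M"
  unfolding weyl_kernel_def by measurable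

lemma borel_measurable_fibre_mass [measurable]: "fibre_mass \<sigma> \<in> borel_measurable borel"
  unfolding fibre_mass_def[abs_def] by measurable

lemma fibre_mass_integrable: "(\<integral>\<^sup>+y. fibre_mass \<sigma> y \<partial>lborel) < \<infinity>"
proof -
  have "(\<integral>\<^sup>+y. fibre_mass \<sigma> y \<partial>lborel) = ennreal ((2 * pi) powr (- real CARD('n) / 2)) * (\<integral>\<^sup>+z. ennreal (norm (\<sigma> z)) \<partial>lborel)"
    unfolding fibre_mass_def
    by (subst nn_integral_cvec_swap[of "\<lambda>z. ennreal (norm (\<sigma> z))"], simp, rule nn_integral_cmult) simp
  also have "\<dots> < \<infinity>"
    using si unfolding integrable_iff_bounded by (simp add: ennreal_mult_less_top)
  finally show ?thesis .
qed

lemma norm_weyl_kernel_le: "ennreal (norm (weyl_kernel \<sigma> u v)) \<le> fibre_mass \<sigma> (u - v)"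
proof -
  let ?I = "LINT x|lborel. cis (x \<bullet> ((1/2) *\<^sub>R (u + v))) * \<sigma> (cvec x (u - v))"
  have "ennreal (norm (weyl_kernel \<sigma> u v)) = ennreal ((2 * pi) powr (- real CARD('n) / 2)) * ennreal (norm ?I)"
    unfolding weyl_kernel_def fourier1_inv_borel norm_mult by (subst ennreal_mult'[symmetric]) simp_all
  also have "ennreal (norm ?I) \<le> (\<integral>\<^sup>+x. ennreal (norm (cis (x \<bullet> ((1/2) *\<^sub>R (u + v))) * \<sigma> (cvec x (u - v)))) \<partial>lborel)"
    by (rule norm_integral_le_nn_integral)
  finally show ?thesis
    unfolding fibre_mass_def norm_mult by (simp add: mult_left_mono)
qed

lemma fibre_mass_conv_L2:
  assumes k: "sqint lborel k"
  shows "(\<integral>\<^sup>+u. (\<integral>\<^sup>+v. fibre_mass \<sigma> (u - v) * ennreal (norm (k v)) \<partial>lborel)\<^sup>2 \<partial>lborel) < \<infinity>"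
    "(\<integral>\<^sup>+u. (\<integral>\<^sup>+v. fibre_mass \<sigma> (v - u) * ennreal (norm (k v)) \<partial>lborel)\<^sup>2 \<partial>lborel) < \<infinity>"
proof -
  note [measurable] = sqint_measurable[OF k, simplified]
  have k2: "(\<integral>\<^sup>+v. (ennreal (norm (k v)))\<^sup>2 \<partial>lborel) < \<infinity>"
    using sqint_nn_integral[OF k] by (simp add: ennreal_power)
  have young: "(\<integral>\<^sup>+u. (\<integral>\<^sup>+v. g (u - v) * ennreal (norm (k v)) \<partial>lborel)\<^sup>2 \<partial>lborel) < \<infinity>"
    if [measurable]: "g \<in> borel_measurable borel" and g: "(\<integral>\<^sup>+y. g y \<partial>lborel) < \<infinity>" for g
    by (rule le_less_trans[OF young_L1_L2])
       (use g k2 in \<open>simp_all add: ennreal_mult_less_top power2_eq_square\<close>)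
  show "(\<integral>\<^sup>+u. (\<integral>\<^sup>+v. fibre_mass \<sigma> (u - v) * ennreal (norm (k v)) \<partial>lborel)\<^sup>2 \<partial>lborel) < \<infinity>"
    by (rule young) (use fibre_mass_integrable in simp_all)
  have "(\<integral>\<^sup>+y. fibre_mass \<sigma> (- y) \<partial>lborel) < \<infinity>"
    using nn_integral_reflect[of "fibre_mass \<sigma>" 0] fibre_mass_integrable by simp
  from young[OF _ this] show "(\<integral>\<^sup>+u. (\<integral>\<^sup>+v. fibre_mass \<sigma> (v - u) * ennreal (norm (k v)) \<partial>lborel)\<^sup>2 \<partial>lborel) < \<infinity>"
    by simp
qed

text \<open>The Cauchy-Schwarz inequality for \<open>k1\<close> and the convolution of \<open>k2\<close> with the
  majorant.\<close>

lemma weyl_kernel_form_integrable: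
  assumes k: "sqint lborel k1" "sqint lborel k2"
  shows "integrable (lborel \<Otimes>\<^sub>M lborel) (\<lambda>(u, v). k1 u * weyl_kernel \<sigma> u v * k2 v)"
proof (rule integrableI_bounded)
  note [measurable] = sqint_measurable[OF k(1), simplified] sqint_measurable[OF k(2), simplified]
  let ?Y = "\<lambda>u. \<integral>\<^sup>+v. fibre_mass \<sigma> (u - v) * ennreal (norm (k2 v)) \<partial>lborel"
  let ?I = "\<integral>\<^sup>+p. ennreal (norm (case p of (u, v) \<Rightarrow> k1 u * weyl_kernel \<sigma> u v * k2 v)) \<partial>(lborel \<Otimes>\<^sub>M lborel)"
  have "?I = (\<integral>\<^sup>+u. \<integral>\<^sup>+v. ennreal (norm (k1 u)) * (ennreal (norm (weyl_kernel \<sigma> u v)) * ennreal (norm (k2 v))) \<partial>lborel \<partial>lborel)"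
    by (subst lborel.nn_integral_fst[symmetric]) (simp_all add: norm_mult ennreal_mult' mult.assoc)
  also have "\<dots> \<le> (\<integral>\<^sup>+u. \<integral>\<^sup>+v. ennreal (norm (k1 u)) * (fibre_mass \<sigma> (u - v) * ennreal (norm (k2 v))) \<partial>lborel \<partial>lborel)"
    by (intro nn_integral_mono mult_left_mono mult_right_mono norm_weyl_kernel_le) auto
  also have "\<dots> = (\<integral>\<^sup>+u. ennreal (norm (k1 u)) * ?Y u \<partial>lborel)"
    by (intro nn_integral_cong nn_integral_cmult) simp
  finally have "?I\<^sup>2 \<le> (\<integral>\<^sup>+u. ennreal (norm (k1 u)) * ?Y u \<partial>lborel)\<^sup>2"
    by (rule power_mono_ennreal)
  also have "\<dots> \<le> (\<integral>\<^sup>+u. (ennreal (norm (k1 u)))\<^sup>2 \<partial>lborel) * (\<integral>\<^sup>+u. (?Y u)\<^sup>2 \<partial>lborel)"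
    by (rule Cauchy_Schwarz_nn_integral) simp_all
  also have "\<dots> < \<infinity>"
    using fibre_mass_conv_L2(1)[OF k(2)] sqint_nn_integral[OF k(1)] by (simp add: ennreal_power ennreal_mult_less_top)
  finally show "?I < \<infinity>" by (simp add: power_less_top_ennreal)
qed (use sqint_measurable[OF k(1), simplified] sqint_measurable[OF k(2), simplified] in simp)

lemma weyl_kernel_form_Fubini:
  assumes k: "sqint lborel k1" "sqint lborel k2"
  shows "(LINT v|lborel. LINT u|lborel. k1 u * weyl_kernel \<sigma> u v * k2 v) = (LINT u|lborel. LINT v|lborel. k1 u * weyl_kernel \<sigma> u v * k2 v)"
  by (rule lborel_pair.Fubini_integral[OF weyl_kernel_form_integrable[OF k]])

lemma sqint_weyl_kernel_conv:
  assumes k: "sqint lborel k"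
  shows "sqint lborel (\<lambda>u. LINT v|lborel. weyl_kernel \<sigma> u v * k v)"
proof (rule sqintI_nn)
  note [measurable] = sqint_measurable[OF k, simplified]
  show "(\<lambda>u. LINT v|lborel. weyl_kernel \<sigma> u v * k v) \<in> borel_measurable lborel" by measurable
  have "ennreal (norm (LINT v|lborel. weyl_kernel \<sigma> u v * k v)) \<le> (\<integral>\<^sup>+v. fibre_mass \<sigma> (u - v) * ennreal (norm (k v)) \<partial>lborel)" for u
    by (rule order_trans[OF norm_integral_le_nn_integral])
       (auto simp: norm_mult ennreal_mult' intro!: nn_integral_mono mult_right_mono norm_weyl_kernel_le)
  then have "(\<integral>\<^sup>+u. (ennreal (norm (LINT v|lborel. weyl_kernel \<sigma> u v * k v)))\<^sup>2 \<partial>lborel)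
     \<le> (\<integral>\<^sup>+u. (\<integral>\<^sup>+v. fibre_mass \<sigma> (u - v) * ennreal (norm (k v)) \<partial>lborel)\<^sup>2 \<partial>lborel)"
    by (intro nn_integral_mono power_mono_ennreal)
  also have "\<dots> < \<infinity>" by (rule fibre_mass_conv_L2[OF k])
  finally show "(\<integral>\<^sup>+u. ennreal ((norm (LINT v|lborel. weyl_kernel \<sigma> u v * k v))\<^sup>2) \<partial>lborel) < \<infinity>"
    by (simp add: ennreal_power)
qed

end

section \<open>The Weyl transform and its composition with the Bargmann transform\<close>

lemma borel_measurable_heis [measurable]:
  fixes F :: "'a \<Rightarrow> complex^'n"
  assumes [measurable]: "F \<in> borel_measurable M" "G \<in> borel_measurable M" "f \<in> borel_measurable borel"
  shows "(\<lambda>p. heis (F p) f (G p)) \<in> borel_measurable M"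
  unfolding heis_def by measurable

lemma norm_heis: "norm (heis z f \<xi>) = norm (f (\<xi> + Im_vec z))"
  by (simp add: heis_def norm_mult)

context
  fixes \<sigma> :: "complex^'n \<Rightarrow> complex"
  assumes sm[measurable]: "\<sigma> \<in> borel_measurable borel" and si: "integrable lborel \<sigma>"
begin

lemma nn_integral_heis:
  assumes [measurable]: "f \<in> borel_measurable borel"
  shows "ennreal ((2 * pi) powr (- real CARD('n) / 2)) * (\<integral>\<^sup>+z. ennreal (norm (\<sigma> z * heis z f \<xi>)) \<partial>lborel)
     = (\<integral>\<^sup>+v. fibre_mass \<sigma> (v - \<xi>) * ennreal (norm (f v)) \<partial>lborel)"
proof -
  note [measurable] = borel_measurable_fibre_mass[OF sm si]
  let ?c = "ennreal ((2 * pi) powr (- real CARD('n) / 2))"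
  have "(\<integral>\<^sup>+z. ennreal (norm (\<sigma> z * heis z f \<xi>)) \<partial>lborel)
     = (\<integral>\<^sup>+y. \<integral>\<^sup>+x. ennreal (norm (\<sigma> (cvec x y))) * ennreal (norm (f (\<xi> + y))) \<partial>lborel \<partial>lborel)"
    by (subst nn_integral_cvec_swap) (simp_all add: norm_mult norm_heis ennreal_mult')
  also have "\<dots> = (\<integral>\<^sup>+y. (\<integral>\<^sup>+x. ennreal (norm (\<sigma> (cvec x y))) \<partial>lborel) * ennreal (norm (f (\<xi> + y))) \<partial>lborel)"
    by (intro nn_integral_cong nn_integral_multc) simp
  finally have "?c * (\<integral>\<^sup>+z. ennreal (norm (\<sigma> z * heis z f \<xi>)) \<partial>lborel)
     = (\<integral>\<^sup>+y. fibre_mass \<sigma> y * ennreal (norm (f (\<xi> + y))) \<partial>lborel)"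
    unfolding fibre_mass_def by (simp only: mult.assoc) (rule nn_integral_cmult[symmetric], simp)
  also have "\<dots> = (\<integral>\<^sup>+v. fibre_mass \<sigma> (v - \<xi>) * ennreal (norm (f v)) \<partial>lborel)"
    using nn_integral_translate[of "\<lambda>v. fibre_mass \<sigma> (v - \<xi>) * ennreal (norm (f v))" \<xi>] by simp
  finally show ?thesis .
qed

lemma sqint_weyl_borel:
  assumes f: "sqint lborel f"
  shows "sqint lborel (\<lambda>\<xi>. LINT z|lborel. \<sigma> z * heis z f \<xi>)"
proof (rule sqintI_nn)
  note [measurable] = borel_measurable_fibre_mass[OF sm si] sqint_measurable[OF f, simplified]
  let ?c = "(2 * pi) powr (- real CARD('n) / 2)"
  let ?W = "\<lambda>\<xi>. LINT z|lborel. \<sigma> z * heis z f \<xi>"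
  show m: "?W \<in> borel_measurable lborel" by measurable
  have "ennreal ?c * ennreal (norm (?W \<xi>)) \<le> (\<integral>\<^sup>+v. fibre_mass \<sigma> (v - \<xi>) * ennreal (norm (f v)) \<partial>lborel)" for \<xi>
    by (subst nn_integral_heis[symmetric], simp) (intro mult_left_mono norm_integral_le_nn_integral, simp)
  then have "(\<integral>\<^sup>+\<xi>. (ennreal ?c * ennreal (norm (?W \<xi>)))\<^sup>2 \<partial>lborel)
     \<le> (\<integral>\<^sup>+\<xi>. (\<integral>\<^sup>+v. fibre_mass \<sigma> (v - \<xi>) * ennreal (norm (f v)) \<partial>lborel)\<^sup>2 \<partial>lborel)"
    by (intro nn_integral_mono power_mono_ennreal)
  also have "\<dots> < \<infinity>" by (rule fibre_mass_conv_L2(2)[OF sm si f])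
  also have "(\<integral>\<^sup>+\<xi>. (ennreal ?c * ennreal (norm (?W \<xi>)))\<^sup>2 \<partial>lborel) = (ennreal ?c)\<^sup>2 * (\<integral>\<^sup>+\<xi>. ennreal ((norm (?W \<xi>))\<^sup>2) \<partial>lborel)"
    using m by (subst nn_integral_cmult[symmetric]) (simp_all add: power_mult_distrib ennreal_power)
  finally show "(\<integral>\<^sup>+\<xi>. ennreal ((norm (?W \<xi>))\<^sup>2) \<partial>lborel) < \<infinity>"
    by (auto simp: ennreal_mult_less_top)
qed

text \<open>Integrating over the real part of \<open>z\<close> first produces a partial Fourier transform of
  \<open>\<sigma>\<close>; the substitution \<open>u = \<xi> + y\<close> turns its arguments into those of
  the kernel. The integral converges absolutely for almost every \<open>\<xi>\<close> by Young's inequality.\<close>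

lemma weyl_borel_eq_kernel:
  assumes f: "sqint lborel f"
  shows "AE \<xi> in lborel. (LINT z|lborel. \<sigma> z * heis z f \<xi>)
     = of_real ((2 * pi) powr (real CARD('n) / 2)) * (LINT u|lborel. f u * weyl_kernel \<sigma> u \<xi>)"
proof -
  note [measurable] = borel_measurable_fibre_mass[OF sm si] borel_measurable_fourier1_inv[OF sm si]
    borel_measurable_weyl_kernel[OF sm si] sqint_measurable[OF f, simplified]
  let ?c = "(2 * pi) powr (- real CARD('n) / 2)"
  let ?c' = "(2 * pi) powr (real CARD('n) / 2)"
  have cc: "?c' * ?c = 1" by (simp add: powr_add[symmetric])
  have "AE \<xi> in lborel. (\<integral>\<^sup>+v. fibre_mass \<sigma> (v - \<xi>) * ennreal (norm (f v)) \<partial>lborel)\<^sup>2 \<noteq> \<infinity>"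
    by (rule nn_integral_PInf_AE) (use fibre_mass_conv_L2(2)[OF sm si f] in \<open>simp_all add: less_top\<close>)
  then show ?thesis
  proof eventually_elim
    case (elim \<xi>)
    then have "ennreal ?c * (\<integral>\<^sup>+z. ennreal (norm (\<sigma> z * heis z f \<xi>)) \<partial>lborel) < \<infinity>"
      by (subst nn_integral_heis) (auto simp: less_top[symmetric] power_eq_top_ennreal)
    then have "(\<integral>\<^sup>+z. ennreal (norm (\<sigma> z * heis z f \<xi>)) \<partial>lborel) < \<infinity>"
      by (auto simp: ennreal_mult_less_top)
    then have iz: "integrable lborel (\<lambda>z. \<sigma> z * heis z f \<xi>)"
      by (intro integrableI_bounded) auto
    let ?k = "\<lambda>x y. \<sigma> (cvec x y) * heis (cvec x y) f \<xi>"
    have ip: "integrable (lborel \<Otimes>\<^sub>M lborel) (case_prod ?k)"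
      using iz by (subst (asm) lborel_cvec) (simp add: integrable_distr_eq case_prod_beta')
    have "(LINT z|lborel. \<sigma> z * heis z f \<xi>) = (LINT p|(lborel \<Otimes>\<^sub>M lborel). case_prod ?k p)"
      by (subst lborel_cvec) (simp add: integral_distr case_prod_beta')
    also have "\<dots> = (LINT y|lborel. LINT x|lborel. ?k x y)"
      by (rule lborel_pair.integral_snd[OF ip, symmetric])
    also have "\<dots> = (LINT y|lborel. of_real ?c' * (f (\<xi> + y) * weyl_kernel \<sigma> (\<xi> + y) \<xi>))"
    proof (rule Bochner_Integration.integral_cong[OF refl])
      fix y
      have "(LINT x|lborel. ?k x y) = (LINT x|lborel. f (\<xi> + y) * (cis (x \<bullet> ((1/2) *\<^sub>R (\<xi> + y + \<xi>))) * \<sigma> (cvec x y)))"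
      proof (intro Bochner_Integration.integral_cong refl)
        fix x :: "real^'n"
        have "x \<bullet> \<xi> + (x \<bullet> y) / 2 = x \<bullet> ((1/2) *\<^sub>R (\<xi> + y + \<xi>))"
          by (simp only: inner_scaleR_right inner_add_right) (simp add: field_simps)
        then show "?k x y = f (\<xi> + y) * (cis (x \<bullet> ((1/2) *\<^sub>R (\<xi> + y + \<xi>))) * \<sigma> (cvec x y))"
          by (simp only: heis_def Re_vec_cvec Im_vec_cvec mult_ac)
      qed
      also have "\<dots> = f (\<xi> + y) * (LINT x|lborel. cis (x \<bullet> ((1/2) *\<^sub>R (\<xi> + y + \<xi>))) * \<sigma> (cvec x y))"
        by (rule integral_mult_right_zero)
      also have "\<dots> = f (\<xi> + y) * (of_real (?c' * ?c) * (LINT x|lborel. cis (x \<bullet> ((1/2) *\<^sub>R (\<xi> + y + \<xi>))) * \<sigma> (cvec x y)))"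
        unfolding cc by simp
      also have "\<dots> = of_real ?c' * (f (\<xi> + y) * weyl_kernel \<sigma> (\<xi> + y) \<xi>)"
        unfolding weyl_kernel_def fourier1_inv_borel[OF sm si] by simp
      finally show "(LINT x|lborel. ?k x y) = of_real ?c' * (f (\<xi> + y) * weyl_kernel \<sigma> (\<xi> + y) \<xi>)" .
    qed
    also have "\<dots> = of_real ?c' * (LINT y|lborel. f (\<xi> + y) * weyl_kernel \<sigma> (\<xi> + y) \<xi>)"
      by (rule integral_mult_right_zero)
    also have "(LINT y|lborel. f (\<xi> + y) * weyl_kernel \<sigma> (\<xi> + y) \<xi>) = (LINT u|lborel. f u * weyl_kernel \<sigma> u \<xi>)"
      by (subst (2) lborel_distr_plus[of \<xi>, symmetric]) (simp add: integral_distr)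
    finally show ?case .
  qed
qed

lemma bargmann_weyl_borel:
  assumes f: "sqint lborel f"
  shows "bargmann (\<lambda>\<xi>. LINT z|lborel. \<sigma> z * heis z f \<xi>) w
     = of_real ((2 * pi) powr (real CARD('n) / 2)) * (LINT u|lborel. f u * (LINT v|lborel. weyl_kernel \<sigma> u v * kern w v))"
proof -
  note [measurable] = borel_measurable_weyl_kernel[OF sm si] sqint_measurable[OF f, simplified]
  let ?c' = "complex_of_real ((2 * pi) powr (real CARD('n) / 2))"
  let ?W = "\<lambda>\<xi>. LINT z|lborel. \<sigma> z * heis z f \<xi>"
  have [measurable]: "?W \<in> borel_measurable borel" using sqint_measurable[OF sqint_weyl_borel[OF f]] by simp
  have "bargmann ?W w = (LINT v|lborel. ?W v * kern w v)" by (rule bargmann_borel) simp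
  also have "\<dots> = (LINT v|lborel. ?c' * (LINT u|lborel. f u * weyl_kernel \<sigma> u v * kern w v))"
  proof (rule integral_cong_AE)
    show "AE v in lborel. ?W v * kern w v = ?c' * (LINT u|lborel. f u * weyl_kernel \<sigma> u v * kern w v)"
      using weyl_borel_eq_kernel[OF f] by eventually_elim simp
  qed simp_all
  also have "\<dots> = ?c' * (LINT v|lborel. LINT u|lborel. f u * weyl_kernel \<sigma> u v * kern w v)"
    by (rule integral_mult_right_zero)
  also have "(LINT v|lborel. LINT u|lborel. f u * weyl_kernel \<sigma> u v * kern w v)
     = (LINT u|lborel. LINT v|lborel. f u * weyl_kernel \<sigma> u v * kern w v)"
    by (rule weyl_kernel_form_Fubini[OF sm si f sqint_kern])
  finally show ?thesis by (simp add: mult.assoc)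
qed

text \<open>The kernel of the Bargmann transform on R^(2n) is the product of two kernels on R^n. Integrating the second
  variable first leaves a Bargmann transform on R^n in the first variable.\<close>

lemma bargmann2_eq_cnj_bargmann:
  fixes \<psi> :: "(real^'n) \<times> (real^'n) \<Rightarrow> complex"
  assumes \<psi>: "AE p in lborel. \<psi> p = weyl_kernel \<sigma> (fst p) (snd p)"
  shows "bargmann2 \<psi> (cnj_vec w) z = cnj (bargmann (\<lambda>u. cnj (LINT v|lborel. weyl_kernel \<sigma> u v * kern z v)) w)"
proof -
  note [measurable] = borel_measurable_weyl_kernel[OF sm si]
  let ?C = "complex_of_real (pi powr (- real (2 * CARD('n)) / 4)) * exp (- (cdot (cnj_vec w) (cnj_vec w) + cdot z z) / 4)"
  let ?E = "\<lambda>p::(real^'n) \<times> (real^'n). of_real (exp (- (norm p)\<^sup>2 / 2)) * exp (cdot (of_real_vec (fst p)) (cnj_vec w) + cdot (of_real_vec (snd p)) z)"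
  have kk: "?C * ?E p = kern (cnj_vec w) (fst p) * kern z (snd p)" for p
  proof -
    have 1: "pi powr (- real (2 * CARD('n)) / 4) = pi powr (- real CARD('n) / 4) * pi powr (- real CARD('n) / 4)"
      by (simp add: powr_add[symmetric])
    have 2: "exp (- (norm p)\<^sup>2 / 2) = exp (- (norm (fst p))\<^sup>2 / 2) * exp (- (norm (snd p))\<^sup>2 / 2)"
      unfolding exp_add[symmetric] by (cases p) (simp add: norm_Pair add_divide_distrib)
    have 3: "exp (- (cdot (cnj_vec w) (cnj_vec w) + cdot z z) / 4) = exp (- cdot (cnj_vec w) (cnj_vec w) / 4) * exp (- cdot z z / 4)"
      unfolding exp_add[symmetric] by (simp add: field_simps)
    show ?thesis
      unfolding kern_def 1 2 3 exp_add of_real_mult by (simp only: mult_ac)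
  qed
  have "bargmann2 \<psi> (cnj_vec w) z = (LINT p|lebesgue. ?C * (\<psi> p * of_real (exp (- (norm p)\<^sup>2 / 2)) * exp (cdot (of_real_vec (fst p)) (cnj_vec w) + cdot (of_real_vec (snd p)) z)))"
    unfolding bargmann2_def by (rule integral_mult_right_zero[symmetric])
  also have "\<dots> = (LINT p|lebesgue. \<psi> p * (?C * ?E p))"
    by (simp only: mult_ac)
  also have "\<dots> = (LINT p|lborel. kern (cnj_vec w) (fst p) * weyl_kernel \<sigma> (fst p) (snd p) * kern z (snd p))"
  proof (rule lebesgue_integral_cong_borel)
    show "AE p in lborel. \<psi> p * (?C * ?E p) = kern (cnj_vec w) (fst p) * weyl_kernel \<sigma> (fst p) (snd p) * kern z (snd p)"
      using \<psi> by eventually_elim (simp only: kk, simp only: mult_ac)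
    show "(\<lambda>p. kern (cnj_vec w) (fst p) * weyl_kernel \<sigma> (fst p) (snd p) * kern z (snd p)) \<in> borel_measurable borel"
      by (simp add: borel_prod[symmetric])
  qed
  also have "\<dots> = (LINT p|(lborel \<Otimes>\<^sub>M lborel). (case p of (u, v) \<Rightarrow> kern (cnj_vec w) u * weyl_kernel \<sigma> u v * kern z v))"
    by (simp add: lborel_prod case_prod_beta)
  also have "\<dots> = (LINT u|lborel. LINT v|lborel. kern (cnj_vec w) u * weyl_kernel \<sigma> u v * kern z v)"
    by (rule lborel_pair.integral_fst[OF weyl_kernel_form_integrable[OF sm si sqint_kern sqint_kern], symmetric])
  also have "\<dots> = (LINT u|lborel. cnj (cnj (LINT v|lborel. weyl_kernel \<sigma> u v * kern z v) * kern w u))"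
    by (simp only: mult.assoc integral_mult_right_zero complex_cnj_mult complex_cnj_cnj cnj_kern) (simp only: mult.commute)
  also have "\<dots> = cnj (bargmann (\<lambda>u. cnj (LINT v|lborel. weyl_kernel \<sigma> u v * kern z v)) w)"
    by (subst bargmann_borel, simp) (rule Bochner_Integration.integral_cnj)
  finally show ?thesis .
qed

end

text \<open>The translate of a null set in R^n, pulled back to C^n by the imaginary part, is a null set, so the value at
  every single \<open>\<xi>\<close> is unaffected by the choice of representatives.\<close>

lemma weyl_representatives:
  assumes "AE z in lborel. \<sigma> z = \<sigma>0 z" "\<sigma>0 \<in> borel_measurable borel"
    "AE x in lborel. f x = f0 x" "f0 \<in> borel_measurable borel"
  shows "weyl \<sigma> f \<xi> = (LINT z|lborel. \<sigma>0 z * heis z f0 \<xi>)"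
  unfolding weyl_def
proof (rule lebesgue_integral_cong_borel)
  show "AE z in lborel. \<sigma> z * heis z f \<xi> = \<sigma>0 z * heis z f0 \<xi>"
    using assms(1) AE_Im_vec[OF assms(3), of \<xi>] by eventually_elim (simp add: heis_def)
qed (use assms in simp)

lemma bargmann_cong_AE:
  assumes "AE x in lborel. f x = f0 x" "f0 \<in> borel_measurable borel"
  shows "bargmann f = bargmann f0"
proof
  fix z
  show "bargmann f z = bargmann f0 z"
    unfolding bargmann_borel[OF assms(2)] unfolding bargmann_kern
    by (rule lebesgue_integral_cong_borel) (use assms in auto)
qed

lemma integrable_lebesgue_representative:
  fixes \<sigma> :: "'a::euclidean_space \<Rightarrow> complex"
  assumes "integrable lebesgue \<sigma>"
  obtains \<sigma>0 where "\<sigma>0 \<in> borel_measurable borel" "integrable lborel \<sigma>0" "AE z in lborel. \<sigma> z = \<sigma>0 z"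
proof -
  obtain \<sigma>0 where s: "\<sigma>0 \<in> borel_measurable lborel" "AE z in lborel. \<sigma> z = \<sigma>0 z"
    using completion_ex_borel_measurable_complex[OF borel_measurable_integrable[OF assms]] by blast
  have "integrable lebesgue \<sigma>0 \<longleftrightarrow> integrable lebesgue \<sigma>"
    using s(1) measurable_completion[OF s(1)] AE_completion[OF s(2)] borel_measurable_integrable[OF assms]
    by (intro integrable_cong_AE) auto
  then have "integrable lborel \<sigma>0" using assms s(1) by (simp add: integrable_completion)
  with s show thesis by (intro that) auto
qed

lemma kernel_symbol_AE:
  fixes \<psi> :: "(real^'n) \<times> (real^'n) \<Rightarrow> complex"
  assumes k: "kernel_symbol \<psi> \<sigma>" and \<sigma>0: "\<sigma>0 \<in> borel_measurable borel" "AE z in lborel. \<sigma> z = \<sigma>0 z"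
  shows "AE p in lborel. \<psi> p = weyl_kernel \<sigma>0 (fst p) (snd p)"
proof -
  note [measurable] = \<sigma>0(1)
  have "AE y in lborel. \<forall>\<xi>. fourier1_inv \<sigma> \<xi> y = fourier1_inv \<sigma>0 \<xi> y"
    using AE_cvec[OF \<sigma>0(2)]
  proof eventually_elim
    case (elim y)
    have "(LINT x|lebesgue. cis (x \<bullet> \<xi>) * \<sigma> (cvec x y)) = (LINT x|lebesgue. cis (x \<bullet> \<xi>) * \<sigma>0 (cvec x y))" for \<xi>
    proof -
      have "(LINT x|lebesgue. cis (x \<bullet> \<xi>) * \<sigma> (cvec x y)) = (LINT x|lborel. cis (x \<bullet> \<xi>) * \<sigma>0 (cvec x y))"
        by (rule lebesgue_integral_cong_borel) (use elim in \<open>auto elim: eventually_mono\<close>)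
      also have "\<dots> = (LINT x|lebesgue. cis (x \<bullet> \<xi>) * \<sigma>0 (cvec x y))"
        by (rule integral_completion[symmetric]) simp
      finally show ?thesis .
    qed
    then show ?case unfolding fourier1_inv_def by simp
  qed
  from AE_lborel_diff[OF this]
  have 1: "AE p in lborel. \<forall>\<xi>. fourier1_inv \<sigma> \<xi> (fst p - snd p) = fourier1_inv \<sigma>0 \<xi> (fst p - snd p)"
    unfolding lborel_prod .
  have "AE p in lborel. \<psi> p = fourier1_inv \<sigma> ((1/2) *\<^sub>R (fst p + snd p)) (fst p - snd p)"
    using k unfolding kernel_symbol_def AE_completion_iff by (simp add: case_prod_beta)
  with 1 show ?thesis unfolding weyl_kernel_def by eventually_elim simp
qed

section \<open>The Bargmann transform between L^2 and the Fock space\<close>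

lemma fock_iff: "F \<in> fock \<longleftrightarrow> entire F \<and> sqint fock_borel F"
proof -
  have "integrable fock_measure (\<lambda>z. (norm (F z))\<^sup>2) \<longleftrightarrow> sqint fock_borel F" if "entire F"
    using entire_measurable[OF that] unfolding fock_measure_eq sqint_def
    by (subst integrable_completion) simp_all
  then show ?thesis by (auto simp: fock_def)
qed

lemma bargmann_in_fock:
  assumes "f \<in> L2"
  shows "bargmann f \<in> fock"
proof -
  obtain f0 where f0: "sqint lborel f0" "AE x in lborel. f x = f0 x"
    using L2_borel_representative[OF assms] .
  have "bargmann f = bargmann f0"
    using bargmann_cong_AE[OF f0(2)] sqint_measurable[OF f0(1)] by simp
  then show ?thesis
    using entire_bargmann[OF f0(1)] sqint_bargmann[OF f0(1)] by (simp add: fock_iff)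
qed

lemma bargmann_L2_inj:
  assumes f: "f \<in> L2" and g: "g \<in> L2" and eq: "bargmann f = bargmann g"
  shows "AE x in lborel. f x = g x"
proof -
  obtain f0 where f0: "sqint lborel f0" "AE x in lborel. f x = f0 x"
    using L2_borel_representative[OF f] .
  obtain g0 where g0: "sqint lborel g0" "AE x in lborel. g x = g0 x"
    using L2_borel_representative[OF g] .
  have [measurable]: "f0 \<in> borel_measurable borel" "g0 \<in> borel_measurable borel"
    using sqint_measurable[OF f0(1)] sqint_measurable[OF g0(1)] by simp_all
  have b: "bargmann f0 = bargmann g0"
    using eq bargmann_cong_AE[OF f0(2)] bargmann_cong_AE[OF g0(2)] by simp
  have "AE x in lborel. f0 x - g0 x = 0"
  proof (rule bargmann_inj[OF sqint_diff[OF f0(1) g0(1)]])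
    fix z
    have "bargmann (\<lambda>x. f0 x - g0 x) z = bargmann f0 z - bargmann g0 z"
      by (simp add: bargmann_borel left_diff_distrib Bochner_Integration.integral_diff
          sqint_integrable_mult[OF f0(1) sqint_kern] sqint_integrable_mult[OF g0(1) sqint_kern])
    then show "bargmann (\<lambda>x. f0 x - g0 x) z = 0" by (simp add: b)
  qed
  with f0(2) g0(2) show ?thesis by eventually_elim simp
qed

lemma sqint_lborel_L2: "sqint lborel f \<Longrightarrow> f \<in> L2"
  using sqint_completion[of f lborel] sqint_measurable[of lborel f] by (simp add: L2_eq_sqint)

lemma fock_bargmann_L2:
  assumes "F \<in> fock"
  shows "F \<in> bargmann ` L2"
proof -
  obtain f where "sqint lborel f" "bargmann f = F"
    using entire_eq_bargmann[of F] assms by (auto simp: fock_iff)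
  then show ?thesis by (auto intro: sqint_lborel_L2)
qed

lemma bargmann_inv_L2: "F \<in> fock \<Longrightarrow> bargmann_inv F \<in> L2"
  and bargmann_bargmann_inv: "F \<in> fock \<Longrightarrow> bargmann (bargmann_inv F) = F"
  unfolding bargmann_inv_def by (simp_all add: fock_bargmann_L2 inv_into_into f_inv_into_f)

lemma bargmann_inv_bargmann_AE: "f \<in> L2 \<Longrightarrow> AE x in lborel. bargmann_inv (bargmann f) x = f x"
  by (intro bargmann_L2_inj bargmann_inv_L2 bargmann_bargmann_inv bargmann_in_fock)

lemma weyl_L2:
  assumes \<sigma>: "integrable lebesgue \<sigma>" and f: "f \<in> L2"
  shows "weyl \<sigma> f \<in> L2"
proof -
  obtain \<sigma>0 where s: "\<sigma>0 \<in> borel_measurable borel" "integrable lborel \<sigma>0" "AE z in lborel. \<sigma> z = \<sigma>0 z"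
    using integrable_lebesgue_representative[OF \<sigma>] .
  obtain f0 where f0: "sqint lborel f0" "AE x in lborel. f x = f0 x"
    using L2_borel_representative[OF f] .
  have "weyl \<sigma> f = (\<lambda>\<xi>. LINT z|lborel. \<sigma>0 z * heis z f0 \<xi>)"
    using weyl_representatives[OF s(3,1) f0(2)] sqint_measurable[OF f0(1)] by auto
  then show ?thesis
    using sqint_lborel_L2[OF sqint_weyl_borel[OF s(1,2) f0(1)]] by simp
qed

lemma weyl_cong_AE:
  assumes \<sigma>: "integrable lebesgue \<sigma>" and f: "f \<in> L2" and eq: "AE x in lborel. f x = g x"
  shows "weyl \<sigma> f = weyl \<sigma> g"
proof -
  obtain \<sigma>0 where s: "\<sigma>0 \<in> borel_measurable borel" "integrable lborel \<sigma>0" "AE z in lborel. \<sigma> z = \<sigma>0 z"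
    using integrable_lebesgue_representative[OF \<sigma>] .
  obtain f0 where f0: "sqint lborel f0" "AE x in lborel. f x = f0 x"
    using L2_borel_representative[OF f] .
  have g0: "AE x in lborel. g x = f0 x" using f0(2) eq by eventually_elim simp
  show ?thesis
    using weyl_representatives[OF s(3,1) f0(2)] weyl_representatives[OF s(3,1) g0] sqint_measurable[OF f0(1)] by auto
qed

text \<open>Both sides are multiples of the double integral of
  \<open>f u * weyl_kernel \<sigma>0 u v * kern z v\<close>, where \<open>F = bargmann f\<close>.\<close>

lemma S_op_eq_weyl:
  fixes \<psi> :: "(real^'n) \<times> (real^'n) \<Rightarrow> complex"
  assumes \<sigma>: "integrable lebesgue \<sigma>" and k: "kernel_symbol \<psi> \<sigma>" and F: "F \<in> fock"
  shows "S_op \<psi> F z = of_real ((2 * pi) powr (- real CARD('n) / 2)) * bargmann (weyl \<sigma> (bargmann_inv F)) z"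
proof -
  obtain \<sigma>0 where s: "\<sigma>0 \<in> borel_measurable borel" "integrable lborel \<sigma>0" "AE z in lborel. \<sigma> z = \<sigma>0 z"
    using integrable_lebesgue_representative[OF \<sigma>] .
  note ker = kernel_symbol_AE[OF k s(1,3)]
  have F': "entire F" "sqint fock_borel F" using F by (auto simp: fock_iff)
  obtain f where f: "sqint lborel f" "bargmann f = F"
    "\<And>h. sqint lborel h \<Longrightarrow> (LINT w|fock_borel. F w * cnj (bargmann h w)) = (LINT u|lborel. f u * cnj (h u))"
    using entire_eq_bargmann[OF F'] by blast
  have "AE x in lborel. bargmann_inv F x = f x"
    using bargmann_L2_inj[OF bargmann_inv_L2[OF F] sqint_lborel_L2[OF f(1)]] bargmann_bargmann_inv[OF F] f(2) by simp
  then have "weyl \<sigma> (bargmann_inv F) = (\<lambda>\<xi>. LINT z|lborel. \<sigma>0 z * heis z f \<xi>)"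
    using weyl_representatives[OF s(3,1)] sqint_measurable[OF f(1)] by auto
  then have W: "bargmann (weyl \<sigma> (bargmann_inv F)) z = of_real ((2 * pi) powr (real CARD('n) / 2)) *
     (LINT u|lborel. f u * (LINT v|lborel. weyl_kernel \<sigma>0 u v * kern z v))"
    by (simp add: bargmann_weyl_borel[OF s(1,2) f(1)])
  define h where "h u = cnj (LINT v|lborel. weyl_kernel \<sigma>0 u v * kern z v)" for u
  have h: "sqint lborel h"
    unfolding h_def[abs_def] by (intro sqint_cnj sqint_weyl_kernel_conv[OF s(1,2)] sqint_kern)
  have [measurable]: "F \<in> borel_measurable borel" "bargmann h \<in> borel_measurable borel"
    using entire_measurable[OF F'(1)] borel_measurable_bargmann[OF h] by simp_all
  have "S_op \<psi> F z = (LINT w|fock_measure. F w * cnj (bargmann h w))"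
    unfolding S_op_def bargmann2_eq_cnj_bargmann[OF s(1,2) ker] h_def[abs_def] ..
  also have "\<dots> = (LINT w|fock_borel. F w * cnj (bargmann h w))"
    unfolding fock_measure_eq by (rule integral_completion) simp
  also have "\<dots> = (LINT u|lborel. f u * (LINT v|lborel. weyl_kernel \<sigma>0 u v * kern z v))"
    unfolding f(3)[OF h] by (simp add: h_def)
  finally have S: "S_op \<psi> F z = (LINT u|lborel. f u * (LINT v|lborel. weyl_kernel \<sigma>0 u v * kern z v))" .
  have "(2 * pi) powr (- real CARD('n) / 2) * (2 * pi) powr (real CARD('n) / 2) = 1"
    by (simp add: powr_add[symmetric])
  then have "complex_of_real ((2 * pi) powr (- real CARD('n) / 2)) * complex_of_real ((2 * pi) powr (real CARD('n) / 2)) = 1"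
    unfolding of_real_mult[symmetric] by simp
  then show ?thesis unfolding W S mult.assoc[symmetric] by simp
qed

section \<open>Powers of the Hermite operator\<close>

lemma l2_inner_cong_AE:
  assumes "AE x in lborel. f x = g x" "f \<in> borel_measurable lebesgue" "g \<in> borel_measurable lebesgue" "h \<in> borel_measurable lebesgue"
  shows "l2_inner f h = l2_inner g h"
proof -
  note [measurable] = assms(2-4)
  show ?thesis unfolding l2_inner_def
    by (rule integral_cong_AE) (use AE_completion[OF assms(1)] in \<open>auto elim: eventually_mono\<close>)
qed

lemma L2_measurable: "f \<in> L2 \<Longrightarrow> f \<in> borel_measurable lebesgue"
  by (simp add: L2_def)

lemma L2_cong_AE:
  assumes "f \<in> L2" "AE x in lborel. f x = g x"
  shows "g \<in> L2"
proof -
  obtain f0 where f0: "sqint lborel f0" "AE x in lborel. f x = f0 x"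
    using L2_borel_representative[OF assms(1)] .
  have "AE x in lborel. g x = f0 x" using assms(2) f0(2) by eventually_elim simp
  then have "g \<in> borel_measurable lebesgue"
    using sqint_measurable[OF f0(1)] by (intro borel_measurable_lebesgue_AE[of f0]) auto
  then show ?thesis
    using assms sqint_cong_AE[of lebesgue f g] AE_completion[OF assms(2)] by (simp add: L2_eq_sqint)
qed

text \<open>The definition refers to \<open>f\<close> only through membership in L^2 and inner products.\<close>

lemma is_hermite_power_cong_AE:
  assumes f: "f \<in> L2" and eq: "AE x in lborel. f x = f' x"
  shows "is_hermite_power r f = is_hermite_power r f'"
proof -
  have f': "f' \<in> L2" by (rule L2_cong_AE[OF f eq])
  have "l2_inner f \<phi> = l2_inner f' \<phi>" if "\<phi> \<in> eigenspace l" for \<phi> l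
    using that f f' eq by (intro l2_inner_cong_AE) (auto simp: eigenspace_def L2_def)
  then have "is_eigenprojection l f p = is_eigenprojection l f' p" for l p
    unfolding is_eigenprojection_def by auto
  with f f' show ?thesis unfolding is_hermite_power_def[abs_def] by simp
qed

lemma hermite_power_cong_AE: "f \<in> L2 \<Longrightarrow> AE x in lborel. f x = f' x \<Longrightarrow> hermite_power r f = hermite_power r f'"
  unfolding hermite_power_def by (simp add: is_hermite_power_cong_AE)

lemma hermite_sobolev_cong_AE:
  assumes "f \<in> hermite_sobolev s" "AE x in lborel. f x = f' x"
  shows "f' \<in> hermite_sobolev s"
  using assms L2_cong_AE[of f f'] is_hermite_power_cong_AE[of f f'] by (auto simp: hermite_sobolev_def)

lemma hermite_sobolev_L2: "f \<in> hermite_sobolev s \<Longrightarrow> f \<in> L2"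
  by (simp add: hermite_sobolev_def)

lemma C1_lincomb:
  assumes f: "C1 f" and g: "C1 g"
  shows "C1 (\<lambda>x. a * f x + b * g x)" "partial i (\<lambda>x. a * f x + b * g x) = (\<lambda>x. a * partial i f x + b * partial i g x)"
proof -
  have d: "((\<lambda>t::real. a * f (x + t *\<^sub>R axis i 1) + b * g (x + t *\<^sub>R axis i 1)) has_vector_derivative (a * partial i f x + b * partial i g x)) (at 0)" for x i
  proof -
    have "((\<lambda>t::real. f (x + t *\<^sub>R axis i 1)) has_vector_derivative partial i f x) (at 0)"
      "((\<lambda>t::real. g (x + t *\<^sub>R axis i 1)) has_vector_derivative partial i g x) (at 0)"
      using f g unfolding C1_def partial_def by (auto simp: vector_derivative_works)
    then show ?thesis by (intro has_vector_derivative_add has_vector_derivative_mult_right)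
  qed
  show p: "partial i (\<lambda>x. a * f x + b * g x) = (\<lambda>x. a * partial i f x + b * partial i g x)" for i
    unfolding partial_def[of i "\<lambda>x. a * f x + b * g x"] by (rule ext) (rule vector_derivative_at[OF d])
  show "C1 (\<lambda>x. a * f x + b * g x)"
    unfolding C1_def
  proof (intro allI conjI)
    fix i x
    show "(\<lambda>t::real. a * f (x + t *\<^sub>R axis i 1) + b * g (x + t *\<^sub>R axis i 1)) differentiable at 0"
      using d by (rule differentiableI_vector)
  next
    fix i
    show "continuous_on UNIV (partial i (\<lambda>x. a * f x + b * g x))"
      unfolding p using f g by (auto simp: C1_def intro!: continuous_intros)
  qed
qed

lemma L2_lincomb:
  assumes "f \<in> L2" "g \<in> L2"
  shows "(\<lambda>x. a * f x + b * g x) \<in> L2"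
  using assms unfolding L2_eq_sqint by (intro sqint_add sqint_cmult)

lemma eigenspace_lincomb:
  assumes f: "f \<in> eigenspace l" and g: "g \<in> eigenspace l"
  shows "(\<lambda>x. a * f x + b * g x) \<in> eigenspace l"
proof -
  have C: "C1 f" "C1 g" "\<And>i. C1 (partial i f)" "\<And>i. C1 (partial i g)" and L: "f \<in> L2" "g \<in> L2" and
    H: "\<And>x. hermite_op f x = of_real l * f x" "\<And>x. hermite_op g x = of_real l * g x"
    using f g by (auto simp: eigenspace_def C2_def)
  have lap: "laplacian (\<lambda>x. a * f x + b * g x) x = a * laplacian f x + b * laplacian g x" for x
    unfolding laplacian_def by (simp add: C1_lincomb(2) C sum.distrib sum_distrib_left)
  have "C2 (\<lambda>x. a * f x + b * g x)"
    unfolding C2_def by (auto simp: C1_lincomb(2) C intro!: C1_lincomb(1))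
  moreover have "hermite_op (\<lambda>x. a * f x + b * g x) x = of_real l * (a * f x + b * g x)" for x
  proof -
    have "hermite_op (\<lambda>x. a * f x + b * g x) x = a * hermite_op f x + b * hermite_op g x"
      unfolding hermite_op_def lap by (simp add: algebra_simps)
    then show ?thesis by (simp add: H algebra_simps)
  qed
  ultimately show ?thesis using L2_lincomb[OF L] by (simp add: eigenspace_def)
qed

lemma l2_inner_lincomb:
  assumes "f \<in> L2" "g \<in> L2" "h \<in> L2"
  shows "l2_inner (\<lambda>x. a * f x + b * g x) h = a * l2_inner f h + b * l2_inner g h"
proof -
  have i: "integrable lebesgue (\<lambda>x. f x * cnj (h x))" "integrable lebesgue (\<lambda>x. g x * cnj (h x))"
    using assms by (auto simp: L2_eq_sqint intro!: sqint_integrable_mult sqint_cnj)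
  show ?thesis
    unfolding l2_inner_def using i by (simp add: distrib_right mult.assoc)
qed

lemma eigenspace_L2: "f \<in> eigenspace l \<Longrightarrow> f \<in> L2"
  by (simp add: eigenspace_def)

lemma is_eigenprojection_cmult:
  fixes f :: "real^'n \<Rightarrow> complex"
  assumes f: "f \<in> L2" and p: "is_eigenprojection l f p"
  shows "is_eigenprojection l (\<lambda>x. c * f x) (\<lambda>x. c * p x)"
proof -
  have pe: "p \<in> eigenspace l" using p by (simp add: is_eigenprojection_def)
  show ?thesis unfolding is_eigenprojection_def
  proof (intro conjI ballI)
    show "(\<lambda>x. c * p x) \<in> eigenspace l" using eigenspace_lincomb[OF pe pe, of c 0] by simp
    fix \<phi> :: "real^'n \<Rightarrow> complex" assume \<phi>: "\<phi> \<in> eigenspace l"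
    have "l2_inner f \<phi> = l2_inner p \<phi>" using p \<phi> by (simp add: is_eigenprojection_def)
    then show "l2_inner (\<lambda>x. c * f x) \<phi> = l2_inner (\<lambda>x. c * p x) \<phi>"
      using l2_inner_lincomb[OF f f eigenspace_L2[OF \<phi>], of c 0]
        l2_inner_lincomb[OF eigenspace_L2[OF pe] eigenspace_L2[OF pe] eigenspace_L2[OF \<phi>], of c 0] by simp
  qed
qed

lemma sqnorm_zero_imp_AE_zero:
  assumes "sqint lebesgue f" "sqnorm lebesgue f = 0"
  shows "AE x in lborel. f x = 0"
proof -
  have "AE x in lebesgue. (norm (f x))\<^sup>2 = 0"
    using integral_nonneg_eq_0_iff_AE[OF sqint_integrable[OF assms(1)]] assms(2) by simp
  then show ?thesis by (simp add: AE_completion_iff)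
qed

text \<open>The difference of two projections lies in the eigenspace and is orthogonal to it.\<close>

lemma is_eigenprojection_unique:
  assumes p: "is_eigenprojection l f p" and q: "is_eigenprojection l f q"
  shows "AE x in lborel. p x = q x"
proof -
  define d where "d x = 1 * p x + (-1) * q x" for x
  have pe: "p \<in> eigenspace l" "q \<in> eigenspace l" using p q by (auto simp: is_eigenprojection_def)
  have d: "d \<in> eigenspace l" unfolding d_def[abs_def] by (rule eigenspace_lincomb[OF pe])
  have "l2_inner d d = 1 * l2_inner p d + (-1) * l2_inner q d"
    unfolding d_def[abs_def] by (rule l2_inner_lincomb) (use pe d in \<open>auto simp: d_def[abs_def] dest: eigenspace_L2\<close>)
  also have "\<dots> = 0" using p q d by (simp add: is_eigenprojection_def)
  finally have "l2_inner d d = 0" .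
  moreover have "l2_inner d d = of_real (sqnorm lebesgue d)"
    unfolding l2_inner_def by (simp add: complex_norm_square[symmetric] del: of_real_power)
  ultimately have "sqnorm lebesgue d = 0" by simp
  then have "AE x in lborel. d x = 0"
    using eigenspace_L2[OF d] by (intro sqnorm_zero_imp_AE_zero) (simp add: L2_eq_sqint)
  then show ?thesis by eventually_elim (simp add: d_def)
qed

lemma l2_norm_cong_AE:
  assumes "AE x in lborel. f x = g x" "f \<in> L2" "g \<in> L2"
  shows "l2_norm f = l2_norm g"
proof -
  note [measurable] = L2_measurable[OF assms(2)] L2_measurable[OF assms(3)]
  have "sqnorm lebesgue f = sqnorm lebesgue g"
    by (rule integral_cong_AE) (use AE_completion[OF assms(1)] in \<open>auto elim: eventually_mono\<close>)
  then show ?thesis by (simp add: l2_norm_def)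
qed

lemma l2_norm_cmult: "l2_norm (\<lambda>x. c * f x) = norm c * l2_norm f"
  by (simp add: l2_norm_def norm_mult power_mult_distrib real_sqrt_mult)

lemma L2_sum: "finite A \<Longrightarrow> (\<And>l. l \<in> A \<Longrightarrow> P l \<in> L2) \<Longrightarrow> (\<lambda>x. \<Sum>l\<in>A. c l * P l x) \<in> L2"
proof (induction A rule: finite_induct)
  case empty
  then show ?case by (simp add: L2_def)
next
  case (insert l A)
  then show ?case using L2_lincomb[of "P l" "\<lambda>x. \<Sum>l\<in>A. c l * P l x" "c l" 1] by simp
qed

text \<open>The two families of partial sums agree almost everywhere, and both \<open>g\<close> and \<open>h\<close> are
  limits of them.\<close>

lemma is_hermite_power_unique:
  fixes f :: "real^'n \<Rightarrow> complex"
  assumes g: "is_hermite_power r f g" and h: "is_hermite_power r f h"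
  shows "AE x in lborel. g x = h x"
proof -
  let ?S = "hermite_spectrum TYPE('n)"
  have L: "g \<in> L2" "h \<in> L2" using g h by (auto simp: is_hermite_power_def)
  obtain P where P: "\<And>l. l \<in> ?S \<Longrightarrow> is_eigenprojection l f (P l)"
    "((\<lambda>A. l2_norm (\<lambda>x. g x - (\<Sum>l\<in>A. of_real (l powr r) * P l x))) \<longlongrightarrow> 0) (finite_subsets_at_top ?S)"
    using g unfolding is_hermite_power_def by blast
  obtain Q where Q: "\<And>l. l \<in> ?S \<Longrightarrow> is_eigenprojection l f (Q l)"
    "((\<lambda>A. l2_norm (\<lambda>x. h x - (\<Sum>l\<in>A. of_real (l powr r) * Q l x))) \<longlongrightarrow> 0) (finite_subsets_at_top ?S)"
    using h unfolding is_hermite_power_def by blast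
  define p where "p A x = (\<Sum>l\<in>A. of_real (l powr r) * P l x)" for A x
  define q where "q A x = (\<Sum>l\<in>A. of_real (l powr r) * Q l x)" for A x
  have PL: "P l \<in> L2" "Q l \<in> L2" if "l \<in> ?S" for l
    using P(1)[OF that] Q(1)[OF that] by (auto simp: is_eigenprojection_def dest: eigenspace_L2)
  have *: "(l2_norm (\<lambda>x. g x - h x))\<^sup>2 \<le> 2 * (l2_norm (\<lambda>x. g x - p A x))\<^sup>2 + 2 * (l2_norm (\<lambda>x. h x - q A x))\<^sup>2"
    if A: "finite A" "A \<subseteq> ?S" for A
  proof -
    have pq: "AE x in lborel. p A x = q A x"
    proof -
      have "AE x in lborel. \<forall>l\<in>A. P l x = Q l x"
        using is_eigenprojection_unique[OF P(1) Q(1)] A by (intro AE_finite_allI) auto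
      then show ?thesis by eventually_elim (simp add: p_def q_def)
    qed
    have pl: "p A \<in> L2" "q A \<in> L2"
      unfolding p_def[abs_def] q_def[abs_def] using A PL by (auto intro!: L2_sum)
    have s: "sqint lebesgue (\<lambda>x. g x - p A x)" "sqint lebesgue (\<lambda>x. h x - q A x)" "sqint lebesgue (\<lambda>x. g x - h x)"
      "sqint lebesgue (\<lambda>x. h x - p A x)"
      using L pl by (auto simp: L2_eq_sqint intro!: sqint_diff)
    have e: "l2_norm (\<lambda>x. h x - q A x) = l2_norm (\<lambda>x. h x - p A x)"
      using s pq by (intro l2_norm_cong_AE) (auto simp: L2_eq_sqint elim: eventually_mono)
    have "sqnorm lebesgue (\<lambda>x. g x - h x) \<le> (LINT x|lebesgue. 2 * (norm (g x - p A x))\<^sup>2 + 2 * (norm (h x - p A x))\<^sup>2)"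
    proof (rule integral_mono)
      show "(norm (g x - h x))\<^sup>2 \<le> 2 * (norm (g x - p A x))\<^sup>2 + 2 * (norm (h x - p A x))\<^sup>2" for x
        using norm_add_power2_le[of "g x - p A x" "p A x - h x"] by (simp add: norm_minus_commute)
    qed (use s in \<open>auto intro!: sqint_integrable\<close>)
    also have "\<dots> = 2 * sqnorm lebesgue (\<lambda>x. g x - p A x) + 2 * sqnorm lebesgue (\<lambda>x. h x - p A x)"
      using sqint_integrable[OF s(1)] sqint_integrable[OF s(4)] by simp
    finally show ?thesis unfolding e by (simp add: l2_norm_def)
  qed
  have "((\<lambda>A. 2 * (l2_norm (\<lambda>x. g x - p A x))\<^sup>2 + 2 * (l2_norm (\<lambda>x. h x - q A x))\<^sup>2) \<longlongrightarrow> 2 * 0\<^sup>2 + 2 * 0\<^sup>2) (finite_subsets_at_top ?S)"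
    unfolding p_def q_def by (intro tendsto_intros P(2) Q(2))
  moreover have "\<forall>\<^sub>F A in finite_subsets_at_top ?S. (l2_norm (\<lambda>x. g x - h x))\<^sup>2 \<le> 2 * (l2_norm (\<lambda>x. g x - p A x))\<^sup>2 + 2 * (l2_norm (\<lambda>x. h x - q A x))\<^sup>2"
    using * by (intro eventually_finite_subsets_at_top_weakI)
  ultimately have "(l2_norm (\<lambda>x. g x - h x))\<^sup>2 \<le> 2 * 0\<^sup>2 + 2 * 0\<^sup>2"
    by (intro tendsto_lowerbound[where F="finite_subsets_at_top ?S"]) auto
  then have "sqnorm lebesgue (\<lambda>x. g x - h x) \<le> 0" by (simp add: l2_norm_def)
  then have "sqnorm lebesgue (\<lambda>x. g x - h x) = 0" by (intro antisym) auto
  then have "AE x in lborel. g x - h x = 0"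
    using L by (intro sqnorm_zero_imp_AE_zero) (auto simp: L2_eq_sqint intro!: sqint_diff)
  then show ?thesis by eventually_elim simp
qed

lemma is_hermite_power_cmult:
  fixes f :: "real^'n \<Rightarrow> complex"
  assumes "is_hermite_power r f g"
  shows "is_hermite_power r (\<lambda>x. c * f x) (\<lambda>x. c * g x)"
proof -
  let ?S = "hermite_spectrum TYPE('n)"
  have L: "f \<in> L2" "g \<in> L2" using assms by (auto simp: is_hermite_power_def)
  obtain P where P: "\<And>l. l \<in> ?S \<Longrightarrow> is_eigenprojection l f (P l)"
    "((\<lambda>A. l2_norm (\<lambda>x. g x - (\<Sum>l\<in>A. of_real (l powr r) * P l x))) \<longlongrightarrow> 0) (finite_subsets_at_top ?S)"
    using assms unfolding is_hermite_power_def by blast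
  have "l2_norm (\<lambda>x. c * g x - (\<Sum>l\<in>A. of_real (l powr r) * (c * P l x))) = norm c * l2_norm (\<lambda>x. g x - (\<Sum>l\<in>A. of_real (l powr r) * P l x))" for A
    unfolding l2_norm_cmult[symmetric] by (simp add: right_diff_distrib sum_distrib_left mult_ac)
  moreover have "((\<lambda>A. norm c * l2_norm (\<lambda>x. g x - (\<Sum>l\<in>A. of_real (l powr r) * P l x))) \<longlongrightarrow> norm c * 0) (finite_subsets_at_top ?S)"
    by (intro tendsto_intros P(2))
  ultimately have "((\<lambda>A. l2_norm (\<lambda>x. c * g x - (\<Sum>l\<in>A. of_real (l powr r) * (c * P l x)))) \<longlongrightarrow> 0) (finite_subsets_at_top ?S)"
    by simp
  moreover have "\<forall>l\<in>?S. is_eigenprojection l (\<lambda>x. c * f x) (\<lambda>x. c * P l x)"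
    using is_eigenprojection_cmult[OF L(1) P(1)] by blast
  ultimately show ?thesis
    unfolding is_hermite_power_def using L2_lincomb[OF L(1) L(1), of c 0] L2_lincomb[OF L(2) L(2), of c 0]
    by (intro conjI exI[of _ "\<lambda>l x. c * P l x"]) auto
qed

lemma hermite_sobolev_cmult: "f \<in> hermite_sobolev s \<Longrightarrow> (\<lambda>x. c * f x) \<in> hermite_sobolev s"
  using is_hermite_power_cmult L2_lincomb[of f f c 0] by (fastforce simp: hermite_sobolev_def)

lemma is_hermite_power_hermite_power:
  assumes "is_hermite_power r f g"
  shows "is_hermite_power r f (hermite_power r f)"
  unfolding hermite_power_def using assms by (rule someI[where P="is_hermite_power r f"])

lemma hermite_sobolev_norm_cmult:
  fixes f :: "real^'n \<Rightarrow> complex"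
  assumes f: "f \<in> hermite_sobolev s"
  shows "hermite_sobolev_norm s (\<lambda>x. c * f x) = norm c * hermite_sobolev_norm s f"
proof -
  have ex: "is_hermite_power (s / 2) h (hermite_power (s / 2) h)" if "h \<in> hermite_sobolev s" for h :: "real^'n \<Rightarrow> complex"
    using that unfolding hermite_sobolev_def by (auto intro: is_hermite_power_hermite_power)
  have "AE x in lborel. hermite_power (s / 2) (\<lambda>x. c * f x) x = c * hermite_power (s / 2) f x"
    by (rule is_hermite_power_unique[OF ex[OF hermite_sobolev_cmult[OF f]] is_hermite_power_cmult[OF ex[OF f]]])
  moreover have "hermite_power (s / 2) (\<lambda>x. c * f x) \<in> L2" "(\<lambda>x. c * hermite_power (s / 2) f x) \<in> L2"
    using ex[OF hermite_sobolev_cmult[OF f]] is_hermite_power_cmult[OF ex[OF f]] by (auto simp: is_hermite_power_def)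
  ultimately show ?thesis
    unfolding hermite_sobolev_norm_def by (simp add: l2_norm_cong_AE l2_norm_cmult)
qed

section \<open>The correspondence of operators\<close>

lemma fock_sobolev_norm_bargmann:
  assumes "f \<in> L2" shows "fock_sobolev_norm s (bargmann f) = hermite_sobolev_norm s f"
  using hermite_power_cong_AE[OF bargmann_inv_L2[OF bargmann_in_fock[OF assms]] bargmann_inv_bargmann_AE[OF assms]]
  by (simp add: fock_sobolev_norm_def hermite_sobolev_norm_def)

theorem theorem1p10:
  shows "\<exists>C::real. C > 0 \<and>
    (\<forall>(\<psi> :: (real^'n) \<times> (real^'n) \<Rightarrow> complex) (\<sigma> :: complex^'n \<Rightarrow> complex).
       integrable lebesgue \<sigma> \<and> kernel_symbol \<psi> \<sigma> \<longrightarrow>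
         (\<forall>F\<in>fock. \<forall>z. S_op \<psi> F z = of_real C * bargmann (weyl \<sigma> (bargmann_inv F)) z) \<and>
         (\<forall>s\<ge>0. bounded_op_on (fock_sobolev s) (fock_sobolev_norm s) (S_op \<psi>) \<longleftrightarrow>
                 bounded_op_on (hermite_sobolev s) (hermite_sobolev_norm s) (weyl \<sigma>)))"
proof (intro exI[of _ "(2 * pi) powr (- real CARD('n) / 2)"] conjI allI impI)
  let ?C = "(2 * pi) powr (- real CARD('n) / 2)"
  show C: "?C > 0" by simp
  fix \<psi> :: "(real^'n) \<times> (real^'n) \<Rightarrow> complex" and \<sigma> :: "complex^'n \<Rightarrow> complex"
  assume *: "integrable lebesgue \<sigma> \<and> kernel_symbol \<psi> \<sigma>"
  then have \<sigma>: "integrable lebesgue \<sigma>" and k: "kernel_symbol \<psi> \<sigma>" by auto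
  show id: "\<forall>F\<in>fock. \<forall>z. S_op \<psi> F z = of_real ?C * bargmann (weyl \<sigma> (bargmann_inv F)) z"
    using S_op_eq_weyl[OF \<sigma> k] by blast
  have S: "S_op \<psi> (bargmann f) = bargmann (\<lambda>x. of_real ?C * weyl \<sigma> f x)" if f: "f \<in> L2" for f
  proof
    fix z
    have "weyl \<sigma> (bargmann_inv (bargmann f)) = weyl \<sigma> f"
      by (rule weyl_cong_AE[OF \<sigma> bargmann_inv_L2[OF bargmann_in_fock[OF f]] bargmann_inv_bargmann_AE[OF f]])
    then have "S_op \<psi> (bargmann f) z = of_real ?C * bargmann (weyl \<sigma> f) z"
      using S_op_eq_weyl[OF \<sigma> k bargmann_in_fock[OF f]] by simp
    also have "\<dots> = bargmann (\<lambda>x. of_real ?C * weyl \<sigma> f x) z"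
      unfolding bargmann_kern by (subst integral_mult_right_zero[symmetric]) (simp only: mult.assoc)
    finally show "S_op \<psi> (bargmann f) z = bargmann (\<lambda>x. of_real ?C * weyl \<sigma> f x) z" .
  qed
  fix s :: real assume "s \<ge> 0"
  let ?X = "hermite_sobolev s :: (real^'n \<Rightarrow> complex) set"
  have mem: "weyl \<sigma> f \<in> ?X \<longleftrightarrow> S_op \<psi> (bargmann f) \<in> fock_sobolev s" if f: "f \<in> ?X" for f
  proof
    assume "weyl \<sigma> f \<in> ?X"
    then show "S_op \<psi> (bargmann f) \<in> fock_sobolev s"
      unfolding S[OF hermite_sobolev_L2[OF f]] fock_sobolev_def by (intro imageI hermite_sobolev_cmult)
  next
    assume "S_op \<psi> (bargmann f) \<in> fock_sobolev s"
    then obtain g where g: "g \<in> ?X" "bargmann g = bargmann (\<lambda>x. of_real ?C * weyl \<sigma> f x)"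
      unfolding S[OF hermite_sobolev_L2[OF f]] fock_sobolev_def by force
    have w: "weyl \<sigma> f \<in> L2" by (rule weyl_L2[OF \<sigma> hermite_sobolev_L2[OF f]])
    have "AE x in lborel. g x = of_real ?C * weyl \<sigma> f x"
      using L2_lincomb[OF w w, of "of_real ?C" 0] by (intro bargmann_L2_inj hermite_sobolev_L2[OF g(1)] g(2)) simp
    then have "AE x in lborel. of_real (1 / ?C) * g x = weyl \<sigma> f x"
      by eventually_elim simp
    then show "weyl \<sigma> f \<in> ?X"
      by (rule hermite_sobolev_cong_AE[OF hermite_sobolev_cmult[OF g(1)]])
  qed
  have nrm: "fock_sobolev_norm s (S_op \<psi> (bargmann f)) = ?C * hermite_sobolev_norm s (weyl \<sigma> f)"
    if f: "f \<in> ?X" and w: "weyl \<sigma> f \<in> ?X" for f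
    unfolding S[OF hermite_sobolev_L2[OF f]]
    using fock_sobolev_norm_bargmann[OF hermite_sobolev_L2[OF hermite_sobolev_cmult[OF w]]]
      hermite_sobolev_norm_cmult[OF w] by simp
  have nrm0: "fock_sobolev_norm s (bargmann f) = hermite_sobolev_norm s f" if "f \<in> ?X" for f
    by (rule fock_sobolev_norm_bargmann[OF hermite_sobolev_L2[OF that]])
  show "bounded_op_on (fock_sobolev s) (fock_sobolev_norm s) (S_op \<psi>) \<longleftrightarrow>
     bounded_op_on ?X (hermite_sobolev_norm s) (weyl \<sigma>)"
  proof
    assume "bounded_op_on (fock_sobolev s) (fock_sobolev_norm s) (S_op \<psi>)"
    then obtain B where B: "\<And>f. f \<in> ?X \<Longrightarrow> S_op \<psi> (bargmann f) \<in> fock_sobolev s"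
      "\<And>f. f \<in> ?X \<Longrightarrow> fock_sobolev_norm s (S_op \<psi> (bargmann f)) \<le> B * fock_sobolev_norm s (bargmann f)"
      unfolding bounded_op_on_def fock_sobolev_def by blast
    have "hermite_sobolev_norm s (weyl \<sigma> f) \<le> (B / ?C) * hermite_sobolev_norm s f" if "f \<in> ?X" for f
      using B(2)[OF that] nrm[OF that] mem[OF that] B(1)[OF that] nrm0[OF that] C by (simp add: field_simps)
    then show "bounded_op_on ?X (hermite_sobolev_norm s) (weyl \<sigma>)"
      unfolding bounded_op_on_def using B(1) mem by blast
  next
    assume "bounded_op_on ?X (hermite_sobolev_norm s) (weyl \<sigma>)"
    then obtain B where B: "\<And>f. f \<in> ?X \<Longrightarrow> weyl \<sigma> f \<in> ?X"
      "\<And>f. f \<in> ?X \<Longrightarrow> hermite_sobolev_norm s (weyl \<sigma> f) \<le> B * hermite_sobolev_norm s f"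
      unfolding bounded_op_on_def by blast
    have "fock_sobolev_norm s (S_op \<psi> (bargmann f)) \<le> (?C * B) * fock_sobolev_norm s (bargmann f)" if "f \<in> ?X" for f
      using mult_left_mono[OF B(2)[OF that], of ?C] nrm[OF that B(1)[OF that]] nrm0[OF that] by (simp add: mult.assoc)
    then show "bounded_op_on (fock_sobolev s) (fock_sobolev_norm s) (S_op \<psi>)"
      unfolding bounded_op_on_def fock_sobolev_def using B(1) mem unfolding fock_sobolev_def by blast
  qed
qed

end
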